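(* Let $(\Gamma,\mathcal G)$ be an elliptically regular boundary pair associated with $\mathfrak h$ and let $z\in\mathbb C\setminus\sigma(H^D)$. Then: (i) The norms $\|\cdot\|_{\mathfrak l_z}$ and $\|\cdot\|_{\mathcal G^{1/2}}$ are equivalent on $\mathcal G^{1/2}$; precisely, for all $\phi\in\mathcal G^{1/2}$, $$\|\phi\|_{\mathcal G^{1/2}}^2\le\|\phi\|_{\mathfrak l_z}^2:=\operatorname{Re}\mathfrak l_z(\phi)+\omega(z)\|\phi\|_{\mathcal G}^2\le\bigl(L(z)+\omega(z)\|\Gamma\|_{1\to0}^2\bigr)\|\phi\|_{\mathcal G^{1/2}}^2 .$$ (ii) For all $\lambda\in\mathbb R\setminus\sigma(H^D)$ the form $\mathfrak l_\lambda$, respectively the associated operator $\Lambda(\lambda)$, is bounded from below. (iii) The form $\mathfrak l_z$ is closed and sectorial: $\mathfrak l_z(\phi)\in\Sigma_\vartheta-\omega(z)\|\phi\|_{\mathcal G}^2$ for all $\phi\in\mathcal G^{1/2}$, where $\Sigma_\vartheta:=\{w\in\mathbb C:|\arg w|\le\vartheta\}$ (with $0$ included) and $\vartheta=\vartheta_z:=\arctan L(z)$. (iv) The family of associated operators $(\Lambda(z))_{z\in\mathbb C\setminus\sigma(H^D)}$ is self-adjoint, i.e. $\Lambda(z)^*=\Lambda(\overline z)$. In particular, $\Lambda(z)$ is closed, and self-adjoint if $z\in\mathbb R\setminus\sigma(H^D)$. Moreover, $\operatorname{dom}\Lambda(z)=\mathcal G^1$ is independent of $z$, and $\Lambda(z)$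 is bounded as an operator $\mathcal G^1\to\mathcal G$. (v) $\Lambda(z)$ is sectorial: $\sigma(\Lambda(z))\subset\Sigma_\vartheta-\omega(z)$ with $\vartheta=\vartheta_z$. (vi) $\Lambda(z)$ is $m$-sectorial in the sense of Kato: with $\vartheta=\vartheta_z$, $$\|(\Lambda(z)-w)^{-1}\|_{\mathcal G\to\mathcal G}\le\frac1{|w+\omega(z)|\sin(\vartheta_0-\vartheta)}$$ for all $\vartheta_0\in(\vartheta,\pi)$ and all $w\in\mathbb C\setminus(\Sigma_{\vartheta_0}-\omega(z))$.
   Context: All Hilbert spaces are complex; inner products and sesquilinear forms are linear in the first argument. Let $\mathfrak h$ be a closed, non-negative, densely defined quadratic form in a Hilbert space $\mathcal H$ (the same symbol denotes its sesquilinear form), with domain $\mathcal H^1:=\operatorname{dom}\mathfrak h$, a Hilbert space with norm $\|u\|_{\mathcal H^1}^2=\mathfrak h(u)+\|u\|_{\mathcal H}^2$. A boundary pair associated with $\mathfrak h$ is a pair $(\Gamma,\mathcal G)$ of a Hilbert space $\mathcal G$ and a bounded operator $\Gamma\colon\mathcal H^1\to\mathcal G$ (with norm $\|\Gamma\|_{1\to0}$) such that $\mathcal H^{1,D}:=\ker\Gamma$ is dense in $\mathcal H$ and $\mathcal G^{1/2}:=\operatorname{ran}\Gamma$ is dense in $\mathcal G$. The Dirichlet operator $H^D$ is the self-adjoint operator associated with the closed form $\mathfrak h|_{\mathcal H^{1,D}}$. For $z\in\mathbb C$ let $\mathcal N^1(z):=\{h\in\mathcal H^1: \mathfrak h(h,f)=z\langle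 h,f\rangle_{\mathcal H}\ \forall f\in\mathcal H^{1,D}\}$. For $z\notin\sigma(H^D)$, $\Gamma$ restricts to a bijection $\mathcal N^1(z)\to\mathcal G^{1/2}$, whose inverse is $S(z)\colon\mathcal G^{1/2}\to\mathcal N^1(z)\subset\mathcal H^1$; $S:=S(-1)$. The space $\mathcal G^{1/2}$ is a Hilbert space with norm $\|\phi\|_{\mathcal G^{1/2}}:=\|S\phi\|_{\mathcal H^1}$. The Dirichlet-to-Neumann form is $\mathfrak l_z(\phi,\psi):=\mathfrak h(S(z)\phi,S\psi)-z\langle S(z)\phi,S\psi\rangle_{\mathcal H}$, $\phi,\psi\in\mathcal G^{1/2}$, with $\mathfrak l_z(\phi):=\mathfrak l_z(\phi,\phi)$. The associated operator $\Lambda(z)$ in $\mathcal G$: $\phi\in\operatorname{dom}\Lambda(z)$ and $\Lambda(z)\phi=\eta$ iff $\phi\in\mathcal G^{1/2}$, $\eta\in\mathcal G$ and $\mathfrak l_z(\phi,\psi)=\langle\eta,\psi\rangle_{\mathcal G}$ for all $\psi\in\mathcal G^{1/2}$. $\Lambda:=\Lambda(-1)$ is self-adjoint and uniformly positive, and $\mathcal G^1:=\operatorname{dom}\Lambda$ with norm $\|\Lambda\phi\|_{\mathcal G}$. The boundary pair is elliptically regular if $S$ is bounded as a map from $\mathcal G^{1/2}$ with the norm of $\mathcal G$ into $\mathcal H$; then $C$ denotes the norm of its bounded extension $\mathcal G\to\mathcal H$. The constants are $$L(z):=1+|z+1|\,\|S(z)\|_{\mathcal G^{1/2}\to\mathcal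 H^1},\qquad \omega(z):=C^2\max\Bigl\{\sup_{\lambda\in\sigma(H^D)}\operatorname{Re}\frac{(z+1)(\lambda+1)}{\lambda-z},\,0\Bigr\}.$$ *)

theory Defs
  imports "HOL-Analysis.Analysis"
begin

section \<open>Complex Hilbert spaces\<close>

text \<open>
  The real inner product and the norm of the superclasses are those of the underlying real
  Hilbert space. The complex inner product is linear in the first argument.
\<close>

class complex_hilbert = real_inner + banach +
  fixes scaleC :: "complex \<Rightarrow> 'a \<Rightarrow> 'a"  (infixr "*\<^sub>C" 75)
    and cinner :: "'a \<Rightarrow> 'a \<Rightarrow> complex"
  assumes scaleC_add_right: "c *\<^sub>C (x + y) = c *\<^sub>C x + c *\<^sub>C y"
    and scaleC_add_left: "(c + d) *\<^sub>C x = c *\<^sub>C x + d *\<^sub>C x"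
    and scaleC_scaleC: "c *\<^sub>C d *\<^sub>C x = (c * d) *\<^sub>C x"
    and scaleC_of_real: "complex_of_real r *\<^sub>C x = r *\<^sub>R x"
    and cinner_commute: "cinner x y = cnj (cinner y x)"
    and cinner_add_left: "cinner (x + y) z = cinner x z + cinner y z"
    and cinner_scaleC_left: "cinner (c *\<^sub>C x) y = c * cinner x y"
    and Re_cinner: "Re (cinner x y) = inner x y"

instantiation complex :: complex_hilbert
begin

definition scaleC_complex :: "complex \<Rightarrow> complex \<Rightarrow> complex"
  where "scaleC_complex c x = c * x"

definition cinner_complex :: "complex \<Rightarrow> complex \<Rightarrow> complex"
  where "cinner_complex x y = x * cnj y"

instance
  by standard
    (simp_all add: scaleC_complex_def cinner_complex_def inner_complex_def algebra_simps
      scaleR_conv_of_real)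

end

definition csubspace :: "'a::complex_hilbert set \<Rightarrow> bool"
  where "csubspace D \<longleftrightarrow>
    0 \<in> D \<and> (\<forall>u\<in>D. \<forall>v\<in>D. u + v \<in> D) \<and> (\<forall>c. \<forall>u\<in>D. c *\<^sub>C u \<in> D)"

definition clinear_on :: "'a::complex_hilbert set \<Rightarrow> ('a \<Rightarrow> 'b::complex_hilbert) \<Rightarrow> bool"
  where "clinear_on D T \<longleftrightarrow>
    (\<forall>u\<in>D. \<forall>v\<in>D. T (u + v) = T u + T v) \<and> (\<forall>c. \<forall>u\<in>D. T (c *\<^sub>C u) = c *\<^sub>C T u)"

definition norm_on :: "'a::complex_hilbert set \<Rightarrow> ('a \<Rightarrow> real) \<Rightarrow> bool"
  where "norm_on D p \<longleftrightarrow>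
    (\<forall>u\<in>D. 0 \<le> p u \<and> (p u = 0 \<longleftrightarrow> u = 0)) \<and>
    (\<forall>u\<in>D. \<forall>v\<in>D. p (u + v) \<le> p u + p v) \<and>
    (\<forall>c. \<forall>u\<in>D. p (c *\<^sub>C u) = cmod c * p u)"

definition equivalent_norms_on ::
    "'a::complex_hilbert set \<Rightarrow> ('a \<Rightarrow> real) \<Rightarrow> ('a \<Rightarrow> real) \<Rightarrow> bool"
  where "equivalent_norms_on D p q \<longleftrightarrow>
    norm_on D p \<and> norm_on D q \<and>
    (\<exists>a>0. \<exists>b>0. \<forall>u\<in>D. a * p u \<le> q u \<and> q u \<le> b * p u)"

text \<open>
  Operator norm of a map on \<open>D\<close> with respect to a norm \<open>p\<close> on the source and \<open>q\<close> on the
  target; as in \<^const>\<open>onorm\<close>, the convention \<open>0 / 0 = 0\<close> takes care of the zero vector.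
\<close>

definition onorm_on :: "'a set \<Rightarrow> ('a \<Rightarrow> real) \<Rightarrow> ('b \<Rightarrow> real) \<Rightarrow> ('a \<Rightarrow> 'b) \<Rightarrow> real"
  where "onorm_on D p q T = (SUP u\<in>D. q (T u) / p u)"


section \<open>Unbounded operators\<close>

text \<open>
  An unbounded operator is represented by its graph, so \<^const>\<open>Domain\<close> is its domain. The
  notions below are meant for graphs satisfying \<open>linear_operator\<close>.
\<close>

definition linear_operator :: "('a::complex_hilbert \<times> 'b::complex_hilbert) set \<Rightarrow> bool"
  where "linear_operator T \<longleftrightarrow>
    single_valued T \<and> (0, 0) \<in> T \<and>
    (\<forall>u v u' v'. (u, v) \<in> T \<longrightarrow> (u', v') \<in> T \<longrightarrow> (u + u', v + v') \<in> T) \<and>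
    (\<forall>c u v. (u, v) \<in> T \<longrightarrow> (c *\<^sub>C u, c *\<^sub>C v) \<in> T)"

definition densely_defined :: "('a::complex_hilbert \<times> 'b::complex_hilbert) set \<Rightarrow> bool"
  where "densely_defined T \<longleftrightarrow> closure (Domain T) = UNIV"

definition op_apply :: "('a \<times> 'b) set \<Rightarrow> 'a \<Rightarrow> 'b"
  where "op_apply T u = (THE v. (u, v) \<in> T)"

definition op_adjoint :: "('a::complex_hilbert \<times> 'a) set \<Rightarrow> ('a \<times> 'a) set"
  where "op_adjoint T = {(x, y). \<forall>u v. (u, v) \<in> T \<longrightarrow> cinner v x = cinner u y}"

definition self_adjoint :: "('a::complex_hilbert \<times> 'a) set \<Rightarrow> bool"
  where "self_adjoint T \<longleftrightarrow> linear_operator T \<and> densely_defined T \<and> op_adjoint T = T"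

text \<open>The operator \<open>T - w\<close>.\<close>

definition op_shift :: "('a::complex_hilbert \<times> 'a) set \<Rightarrow> complex \<Rightarrow> ('a \<times> 'a) set"
  where "op_shift T w = {(u, v - w *\<^sub>C u) | u v. (u, v) \<in> T}"

text \<open>The operator \<open>(T - w)\<inverse>\<close>, meaningful if \<open>T - w\<close> is a bijection onto the whole space.\<close>

definition resolvent :: "('a::complex_hilbert \<times> 'a) set \<Rightarrow> complex \<Rightarrow> 'a \<Rightarrow> 'a"
  where "resolvent T w f = (THE u. (u, f) \<in> op_shift T w)"

definition resolvent_set :: "('a::complex_hilbert \<times> 'a) set \<Rightarrow> complex set"
  where "resolvent_set T =
    {w. (\<forall>f. \<exists>!u. (u, f) \<in> op_shift T w) \<and> bounded_linear (resolvent T w)}"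

definition op_spectrum :: "('a::complex_hilbert \<times> 'a) set \<Rightarrow> complex set"
  where "op_spectrum T = - resolvent_set T"

definition numerical_range :: "('a::complex_hilbert \<times> 'a) set \<Rightarrow> complex set"
  where "numerical_range T = {cinner v u | u v. (u, v) \<in> T \<and> norm u = 1}"

definition op_bounded_below :: "('a::complex_hilbert \<times> 'a) set \<Rightarrow> bool"
  where "op_bounded_below T \<longleftrightarrow>
    (\<exists>c. \<forall>u v. (u, v) \<in> T \<longrightarrow> cinner v u \<in> \<real> \<and> c * (norm u)\<^sup>2 \<le> Re (cinner v u))"

definition sector :: "real \<Rightarrow> complex set"
  where "sector \<theta> = {w. w = 0 \<or> \<bar>Arg w\<bar> \<le> \<theta>}"

text \<open>
  Kato, \<^emph>\<open>Perturbation Theory for Linear Operators\<close>, V.3.10: an operator is m-sectorial if its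
  numerical range lies in a sector with vertex \<open>\<gamma>\<close> and semi-angle \<open>\<theta> < \<pi>/2\<close>, and it is
  quasi-m-accretive.
\<close>

definition m_accretive :: "('a::complex_hilbert \<times> 'a) set \<Rightarrow> bool"
  where "m_accretive T \<longleftrightarrow> linear_operator T \<and>
    (\<forall>\<mu>. Re \<mu> > 0 \<longrightarrow> - \<mu> \<in> resolvent_set T \<and> onorm (resolvent T (- \<mu>)) \<le> 1 / Re \<mu>)"

definition m_sectorial :: "real \<Rightarrow> real \<Rightarrow> ('a::complex_hilbert \<times> 'a) set \<Rightarrow> bool"
  where "m_sectorial \<gamma> \<theta> T \<longleftrightarrow>
    0 \<le> \<theta> \<and> \<theta> < pi / 2 \<and>
    numerical_range T \<subseteq> (\<lambda>s. s + complex_of_real \<gamma>) ` sector \<theta> \<and>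
    (\<exists>\<alpha>. m_accretive (op_shift T (- complex_of_real \<alpha>)))"


section \<open>Sesquilinear forms\<close>

text \<open>A form is given by its domain \<open>D\<close> and a function whose values outside \<open>D\<close> are irrelevant.\<close>

definition sesquilinear_on ::
    "'a::complex_hilbert set \<Rightarrow> ('a \<Rightarrow> 'a \<Rightarrow> complex) \<Rightarrow> bool"
  where "sesquilinear_on D t \<longleftrightarrow>
    (\<forall>u\<in>D. \<forall>v\<in>D. \<forall>w\<in>D. t (u + v) w = t u w + t v w \<and> t w (u + v) = t w u + t w v) \<and>
    (\<forall>c. \<forall>u\<in>D. \<forall>w\<in>D. t (c *\<^sub>C u) w = c * t u w \<and> t w (c *\<^sub>C u) = cnj c * t w u)"

text \<open>
  Closedness in the sense of Kato, VI.1.3. For a non-negative form this is completeness of the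
  domain with respect to \<open>form_norm\<close> below.
\<close>

definition closed_form ::
    "'a::complex_hilbert set \<Rightarrow> ('a \<Rightarrow> 'a \<Rightarrow> complex) \<Rightarrow> bool"
  where "closed_form D t \<longleftrightarrow>
    (\<forall>u x. range u \<subseteq> D \<longrightarrow> u \<longlonglongrightarrow> x \<longrightarrow>
       (\<forall>e>0. \<exists>N::nat. \<forall>m\<ge>N. \<forall>n\<ge>N. cmod (t (u m - u n) (u m - u n)) < e) \<longrightarrow>
       x \<in> D \<and> (\<lambda>n. t (u n - x) (u n - x)) \<longlonglongrightarrow> 0)"

definition form_bounded_below ::
    "'a::complex_hilbert set \<Rightarrow> ('a \<Rightarrow> 'a \<Rightarrow> complex) \<Rightarrow> bool"
  where "form_bounded_below D t \<longleftrightarrow>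
    (\<exists>c. \<forall>u\<in>D. t u u \<in> \<real> \<and> c * (norm u)\<^sup>2 \<le> Re (t u u))"

text \<open>The operator associated with a form.\<close>

definition form_operator ::
    "'a::complex_hilbert set \<Rightarrow> ('a \<Rightarrow> 'a \<Rightarrow> complex) \<Rightarrow> ('a \<times> 'a) set"
  where "form_operator D t = {(u, v). u \<in> D \<and> (\<forall>w\<in>D. t u w = cinner v w)}"

text \<open>Closed, non-negative, densely defined forms and the norm they induce on their domain.\<close>

definition closed_nonneg_form ::
    "'a::complex_hilbert set \<Rightarrow> ('a \<Rightarrow> 'a \<Rightarrow> complex) \<Rightarrow> bool"
  where "closed_nonneg_form D t \<longleftrightarrow>
    csubspace D \<and> closure D = UNIV \<and> sesquilinear_on D t \<and>
    (\<forall>u\<in>D. t u u \<in> \<real> \<and> 0 \<le> Re (t u u)) \<and> closed_form D t"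

definition form_norm :: "('a::complex_hilbert \<Rightarrow> 'a \<Rightarrow> complex) \<Rightarrow> 'a \<Rightarrow> real"
  where "form_norm t u = sqrt (Re (t u u) + (norm u)\<^sup>2)"


section \<open>Boundary pairs\<close>

context
  fixes H1 :: "'h::complex_hilbert set"
    and \<h> :: "'h \<Rightarrow> 'h \<Rightarrow> complex"
    and \<Gamma> :: "'h \<Rightarrow> 'g::complex_hilbert"
begin

definition H1D :: "'h set"
  where "H1D = {u\<in>H1. \<Gamma> u = 0}"

definition G_half :: "'g set"
  where "G_half = \<Gamma> ` H1"

definition boundary_pair :: bool
  where "boundary_pair \<longleftrightarrow>
    closed_nonneg_form H1 \<h> \<and> clinear_on H1 \<Gamma> \<and>
    (\<exists>K. \<forall>u\<in>H1. norm (\<Gamma> u) \<le> K * form_norm \<h> u) \<and>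
    closure H1D = UNIV \<and> closure G_half = UNIV"

definition norm_\<Gamma> :: real
  where "norm_\<Gamma> = onorm_on H1 (form_norm \<h>) norm \<Gamma>"

definition dirichlet_operator :: "('h \<times> 'h) set"
  where "dirichlet_operator = form_operator H1D \<h>"

definition N1 :: "complex \<Rightarrow> 'h set"
  where "N1 z = {u\<in>H1. \<forall>f\<in>H1D. \<h> u f = z * cinner u f}"

text \<open>Only used on \<open>G_half\<close> and for \<open>z\<close> outside the spectrum of the Dirichlet operator.\<close>

definition sol_op :: "complex \<Rightarrow> 'g \<Rightarrow> 'h"
  where "sol_op z = inv_into (N1 z) \<Gamma>"

definition norm_half :: "'g \<Rightarrow> real"
  where "norm_half \<phi> = form_norm \<h> (sol_op (-1) \<phi>)"

definition dn_form :: "complex \<Rightarrow> 'g \<Rightarrow> 'g \<Rightarrow> complex"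
  where "dn_form z \<phi> \<psi> = \<h> (sol_op z \<phi>) (sol_op (-1) \<psi>) - z * cinner (sol_op z \<phi>) (sol_op (-1) \<psi>)"

definition dn_operator :: "complex \<Rightarrow> ('g \<times> 'g) set"
  where "dn_operator z = form_operator G_half (dn_form z)"

definition G_one :: "'g set"
  where "G_one = Domain (dn_operator (-1))"

definition norm_one :: "'g \<Rightarrow> real"
  where "norm_one \<phi> = norm (op_apply (dn_operator (-1)) \<phi>)"

definition elliptically_regular :: bool
  where "elliptically_regular \<longleftrightarrow>
    (\<exists>K. \<forall>\<phi>\<in>G_half. norm (sol_op (-1) \<phi>) \<le> K * norm \<phi>)"

text \<open>The bounded extension of \<open>sol_op (-1)\<close> to the whole space.\<close>

definition sol_op_ext :: "'g \<Rightarrow> 'h"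
  where "sol_op_ext = (THE T. bounded_linear T \<and> (\<forall>\<phi>\<in>G_half. T \<phi> = sol_op (-1) \<phi>))"

definition C_ell :: real
  where "C_ell = onorm sol_op_ext"

definition L_const :: "complex \<Rightarrow> real"
  where "L_const z = 1 + cmod (z + 1) * onorm_on G_half norm_half (form_norm \<h>) (sol_op z)"

text \<open>
  The supremum is taken in the extended reals, so that it is \<open>-\<infinity>\<close> if the spectrum is empty (that
  is, if \<^typ>\<open>'h\<close> is the zero space). It is never \<open>\<infinity>\<close> for \<open>z\<close> outside the spectrum.
\<close>

definition \<omega>_const :: "complex \<Rightarrow> real"
  where "\<omega>_const z = C_ell\<^sup>2 * real_of_ereal
    (max (SUP \<mu>\<in>op_spectrum dirichlet_operator. ereal (Re ((z + 1) * (\<mu> + 1) / (\<mu> - z)))) 0)"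

definition \<theta>_const :: "complex \<Rightarrow> real"
  where "\<theta>_const z = arctan (L_const z)"

definition norm_dn_form :: "complex \<Rightarrow> 'g \<Rightarrow> real"
  where "norm_dn_form z \<phi> = sqrt (Re (dn_form z \<phi> \<phi>) + \<omega>_const z * (norm \<phi>)\<^sup>2)"

end

end

(*
  Let S(z) be the solution operator and x = S phi, y = S(z) phi. Since y - x lies in ker Gamma,
    l_z(phi, psi) = <S phi, S psi>_1 - (z + 1) <S(z) phi, S psi>,
  so l_z is a perturbation of the inner product of G^{1/2}, and y - x = (z + 1) T y with
  T = (H^D + 1)^{-1}. A quadratic polynomial that is non-negative on the spectrum of T is
  non-negative at T; this replaces the spectral theorem and gives
  Re ((z + 1) <y, x>) <= sup |x|^2, hence the lower bound in (i) by elliptic regularity.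
  With the upper bound L(z), the form l_z + omega(z) takes values in a sector, and everything
  else is the theory of closed sectorial forms: if w is outside the sector then a half-plane
  separates them, the correspondingly rotated form is coercive, and Lax-Milgram makes
  Lambda(z) - w surjective; the resolvent estimate is the distance from w to the sector.
*)
theory Submission
  imports Defs
begin

section \<open>Hilbert spaces carried by sets\<close>

text \<open>The spectral parameter \<lambda> of the Dirichlet operator becomes
  \<open>t = 1 / (\<lambda> + 1)\<close> for the bounded operator \<open>T\<close>. The price is the
  point \<open>t = 0\<close>, which belongs to no \<lambda>: assumptions on the spectrum of the
  Dirichlet operator say nothing there directly, and a negative value of the polynomial at 0 has to
  be excluded by a separate argument. The form domain, the kernel of \<Gamma> and the range of
  \<Gamma> are Hilbert spaces for norms other than that of the surrounding type. Riesz and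
  Lax-Milgram are therefore proved for subsets with their own inner product, and over the reals, for
  real parts of forms; testing with \<open>i f\<close> next to \<open>f\<close> restores the complex
  identities. Two assertions need more than the theory of sectorial forms. The adjoint of
  \<open>\<Lambda>(z)\<close> is \<open>\<Lambda>(cnj z)\<close> because the second argument of
  \<open>l_z\<close> may be any extension of the boundary value, and because the resolvent set is
  closed under conjugation. The domain is independent of z because
  \<open>\<Lambda>(z) - \<Lambda>\<close> is bounded on all of the boundary space, which is a second
  use of elliptic regularity.\<close>

lemma quadratic_nonneg_discriminant:
  fixes A B C :: real
  assumes "\<And>t. 0 \<le> A + 2 * t * B + t\<^sup>2 * C"
  shows "B\<^sup>2 \<le> A * C"
\<comment> \<open>The lemma replaces Cauchy-Schwarz for degenerate forms, so C may vanish; a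
  non-negative affine function of t is constant.\<close>
proof (cases "C = 0")
  case True
  have "B = 0"
  proof (rule ccontr)
    assume "B \<noteq> 0"
    then have "A + 2 * (- (A + 1) / (2 * B)) * B = - 1" by (simp add: field_simps)
    with assms[of "- (A + 1) / (2 * B)"] True show False by simp
  qed
  with True show ?thesis by simp
next
  case False
  have "0 \<le> C"
  proof (rule ccontr)
    assume "\<not> 0 \<le> C"
    then have C: "C < 0" by simp
    \<comment> \<open>With \<open>t >= 1\<close> the lower-order terms are at most t times a
      constant, and t is large enough for \<open>t * C\<close> to outweigh that constant.\<close>
    define t where "t = (\<bar>A\<bar> + 2 * \<bar>B\<bar> + 1) / (- C) + 1"
    have t1: "1 \<le> t" using C by (simp add: t_def divide_nonneg_pos del: divide_minus_right)
    have tC: "t * C = - (\<bar>A\<bar> + 2 * \<bar>B\<bar> + 1) + C" using C by (simp add: t_def field_simps)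
    have "A + 2 * t * B + t\<^sup>2 * C \<le> t * \<bar>A\<bar> + t * (2 * \<bar>B\<bar>) + t * (t * C)"
    proof -
      have "A \<le> t * \<bar>A\<bar>" using t1 mult_right_mono[of 1 t "\<bar>A\<bar>"] by simp
      moreover have "2 * t * B \<le> t * (2 * \<bar>B\<bar>)" using t1 by (simp add: mult_left_mono)
      ultimately show ?thesis by (simp add: power2_eq_square mult.assoc)
    qed
    also have "\<dots> = t * (C - 1)" unfolding tC by (simp add: algebra_simps)
    also have "\<dots> < 0" using t1 C by (simp add: mult_pos_neg)
    finally show False using assms[of t] by simp
  qed
  with False have C: "0 < C" by simp
  \<comment> \<open>The minimum of the polynomial, attained at \<open>- B / C\<close>.\<close>
  have "A + 2 * (- B / C) * B + (- B / C)\<^sup>2 * C = A - B\<^sup>2 / C"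
    using C by (simp add: field_simps power2_eq_square)
  with assms[of "- B / C"] have "B\<^sup>2 / C \<le> A" by simp
  with C show ?thesis by (simp add: field_simps)
qed

section \<open>Real bilinear forms, Riesz representation and Lax-Milgram\<close>

definition bilinear_on :: "'a::real_vector set \<Rightarrow> ('a \<Rightarrow> 'a \<Rightarrow> real) \<Rightarrow> bool"
  where "bilinear_on D a \<longleftrightarrow>
    (\<forall>u\<in>D. \<forall>v\<in>D. \<forall>w\<in>D. a (u + v) w = a u w + a v w \<and> a w (u + v) = a w u + a w v) \<and>
    (\<forall>r. \<forall>u\<in>D. \<forall>w\<in>D. a (r *\<^sub>R u) w = r * a u w \<and> a w (r *\<^sub>R u) = r * a w u)"

lemma bilinear_onD:
  assumes "bilinear_on D a" "u \<in> D" "v \<in> D" "w \<in> D"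
  shows "a (u + v) w = a u w + a v w" "a w (u + v) = a w u + a w v"
    "a (r *\<^sub>R u) w = r * a u w" "a w (r *\<^sub>R u) = r * a w u"
  using assms by (auto simp: bilinear_on_def)

lemma bilinear_on_diff:
  assumes "bilinear_on D a" "subspace D" "u \<in> D" "v \<in> D" "w \<in> D"
  shows "a (u - v) w = a u w - a v w" "a w (u - v) = a w u - a w v"
proof -
  have m: "(- 1) *\<^sub>R v \<in> D" using assms by (intro subspace_mul)
  have "a (u + (- 1) *\<^sub>R v) w = a u w + (- 1) * a v w"
    using bilinear_onD(1)[OF assms(1,3) m assms(5)] bilinear_onD(3)[OF assms(1,4,4,5), of "- 1"] by simp
  then show "a (u - v) w = a u w - a v w" by simp
  have "a w (u + (- 1) *\<^sub>R v) = a w u + (- 1) * a w v"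
    using bilinear_onD(2)[OF assms(1,3) m assms(5)] bilinear_onD(4)[OF assms(1,4,4,5), of "- 1"] by simp
  then show "a w (u - v) = a w u - a w v" by simp
qed

text \<open>
  Form domains carry their own Hilbert norm without being types, so Hilbert spaces are sets here.
  The inner product may be degenerate.
\<close>

locale hilbert_set =
  fixes D :: "'a::real_vector set" and s :: "'a \<Rightarrow> 'a \<Rightarrow> real"
  assumes subsp: "subspace D"
    and bil: "bilinear_on D s"
    and sym: "u \<in> D \<Longrightarrow> v \<in> D \<Longrightarrow> s u v = s v u"
    and pos: "u \<in> D \<Longrightarrow> 0 \<le> s u u"
    and complete: "\<And>u. range u \<subseteq> D \<Longrightarrow>
      (\<forall>e>0. \<exists>N::nat. \<forall>m\<ge>N. \<forall>n\<ge>N. s (u m - u n) (u m - u n) < e) \<Longrightarrow>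
      \<exists>x\<in>D. (\<lambda>n. s (u n - x) (u n - x)) \<longlonglongrightarrow> 0"
begin

lemma add_in: "u \<in> D \<Longrightarrow> v \<in> D \<Longrightarrow> u + v \<in> D"
  and scale_in: "u \<in> D \<Longrightarrow> r *\<^sub>R u \<in> D"
  and diff_in: "u \<in> D \<Longrightarrow> v \<in> D \<Longrightarrow> u - v \<in> D"
  and zero_in: "0 \<in> D"
  using subsp by (auto intro: subspace_add subspace_mul subspace_diff subspace_0)

lemmas s_add = bilinear_onD(1,2)[OF bil]
lemmas s_scale = bilinear_onD(3)[OF bil _ zero_in] bilinear_onD(4)[OF bil _ zero_in]
lemmas s_diff = bilinear_on_diff[OF bil subsp]

lemma s_expand:
  assumes "u \<in> D" "f \<in> D"
  shows "s (u + t *\<^sub>R f) (u + t *\<^sub>R f) = s u u + 2 * t * s u f + t\<^sup>2 * s f f"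
  using assms by (simp add: s_add s_scale add_in scale_in sym[of f u] power2_eq_square algebra_simps)

lemma cauchy_schwarz_square:
  assumes "u \<in> D" "v \<in> D"
  shows "(s u v)\<^sup>2 \<le> s u u * s v v"
proof (rule quadratic_nonneg_discriminant)
  fix t
  show "0 \<le> s u u + 2 * t * s u v + t\<^sup>2 * s v v"
    using pos[OF add_in[OF assms(1) scale_in[OF assms(2)]], of t] by (simp add: s_expand assms)
qed

lemma cauchy_schwarz:
  assumes "u \<in> D" "v \<in> D"
  shows "\<bar>s u v\<bar> \<le> sqrt (s u u) * sqrt (s v v)"
  using real_sqrt_le_mono[OF cauchy_schwarz_square[OF assms]] by (simp add: real_sqrt_mult)

lemma triangle:
  assumes "u \<in> D" "v \<in> D"
  shows "sqrt (s (u + v) (u + v)) \<le> sqrt (s u u) + sqrt (s v v)"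
proof (rule real_le_lsqrt)
  have "s (u + v) (u + v) = s u u + 2 * s u v + s v v"
    using s_expand[OF assms, of 1] by simp
  also have "\<dots> \<le> s u u + 2 * (sqrt (s u u) * sqrt (s v v)) + s v v"
    using cauchy_schwarz[OF assms] by simp
  also have "\<dots> = (sqrt (s u u) + sqrt (s v v))\<^sup>2"
    using pos assms by (simp add: power2_sum)
  finally show "s (u + v) (u + v) \<le> (sqrt (s u u) + sqrt (s v v))\<^sup>2" .
qed (use pos assms in auto)

text \<open>Direct method: minimise \<open>J u = s u u - 2 * F u\<close>. Completeness provides a
  limit of a minimising sequence; since \<open>s\<close> may be degenerate, the limit is determined
  only up to null vectors, which suffices.\<close>

theorem riesz:
  assumes add: "\<And>f g. f \<in> D \<Longrightarrow> g \<in> D \<Longrightarrow> F (f + g) = F f + F g"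
    and scale: "\<And>r f. f \<in> D \<Longrightarrow> F (r *\<^sub>R f) = r * F f"
    and bound: "\<And>f. f \<in> D \<Longrightarrow> \<bar>F f\<bar> \<le> K * sqrt (s f f)"
  shows "\<exists>x\<in>D. \<forall>f\<in>D. s x f = F f"
proof -
  define J where "J u = s u u - 2 * F u" for u
  have J_lower: "- K\<^sup>2 \<le> J u" if "u \<in> D" for u
  proof -
    have "0 \<le> (sqrt (s u u) - K)\<^sup>2" by simp
    also have "\<dots> = s u u - 2 * (K * sqrt (s u u)) + K\<^sup>2"
      using pos[OF that] by (simp add: power2_diff algebra_simps)
    finally show ?thesis using bound[OF that] by (simp add: J_def abs_le_iff)
  qed
  define m where "m = Inf (J ` D)"
  have bdd: "bdd_below (J ` D)" using J_lower by (intro bdd_belowI2)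
  have m_le: "m \<le> J u" if "u \<in> D" for u
    unfolding m_def using bdd that by (intro cInf_lower) auto
  have "\<exists>u\<in>D. J u < m + 1 / real (Suc n)" for n
    using cInf_lessD[of "J ` D" "m + 1 / real (Suc n)"] zero_in by (auto simp: m_def)
  then obtain u where uD: "\<And>n. u n \<in> D" and uJ: "\<And>n. J (u n) < m + 1 / real (Suc n)"
    by metis
  have J_expand: "J (v + t *\<^sub>R f) = J v + 2 * t * (s v f - F f) + t\<^sup>2 * s f f"
    if "v \<in> D" "f \<in> D" for v f t
    using that by (simp add: J_def s_expand add scale scale_in algebra_simps)
  \<comment> \<open>An almost minimal value of \<open>J\<close> almost forces the variational
    equation. The equation can thus be carried to the limit without showing that the infimum is
    attained.\<close>
  have near: "(s v f - F f)\<^sup>2 \<le> (J v - m) * s f f" if "v \<in> D" "f \<in> D" for v f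
  proof (rule quadratic_nonneg_discriminant)
    fix t
    show "0 \<le> J v - m + 2 * t * (s v f - F f) + t\<^sup>2 * s f f"
      using m_le[OF add_in[OF that(1) scale_in[OF that(2)]], of t] J_expand[OF that, of t] by simp
  qed
  \<comment> \<open>Parallelogram argument: the value of \<open>J\<close> at the midpoint of v and w
    is still at least m.\<close>
  have par: "s (v - w) (v - w) \<le> 2 * (J v - m) + 2 * (J w - m)" if "v \<in> D" "w \<in> D" for v w
  proof -
    have d: "w - v \<in> D" using that diff_in by blast
    have "J w = J v + 2 * (s v (w - v) - F (w - v)) + s (w - v) (w - v)"
      using J_expand[OF that(1) d, of 1] by simp
    moreover have "m \<le> J v + (s v (w - v) - F (w - v)) + s (w - v) (w - v) / 4"
      using m_le[OF add_in[OF that(1) scale_in[OF d, of "1/2"]]] J_expand[OF that(1) d, of "1/2"]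
      by (simp add: power2_eq_square)
    moreover have "s (v - w) (v - w) = s (w - v) (w - v)"
      using that by (simp add: s_diff diff_in)
    ultimately show ?thesis by simp
  qed
  have "\<exists>x\<in>D. (\<lambda>n. s (u n - x) (u n - x)) \<longlonglongrightarrow> 0"
  proof (rule complete)
    show "range u \<subseteq> D" using uD by auto
    show "\<forall>e>0. \<exists>N. \<forall>m\<ge>N. \<forall>n\<ge>N. s (u m - u n) (u m - u n) < e"
    proof (intro allI impI)
      fix e :: real assume "e > 0"
      \<comment> \<open>\<open>par\<close> counts each of the two defects twice, hence
        \<open>e / 4\<close>.\<close>
      then obtain N where N: "1 / real (Suc N) < e / 4"
        using nat_approx_posE[of "e / 4"] by (metis divide_pos_pos zero_less_numeral)
      have "s (u k - u n) (u k - u n) < e" if "k \<ge> N" "n \<ge> N" for k n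
      proof -
        have "1 / real (Suc k) \<le> 1 / real (Suc N)" "1 / real (Suc n) \<le> 1 / real (Suc N)"
          using that by (auto simp: frac_le)
        then have "J (u k) - m < e / 4" "J (u n) - m < e / 4"
          using uJ[of k] uJ[of n] N by linarith+
        with par[OF uD uD, of k n] show ?thesis by simp
      qed
      then show "\<exists>N. \<forall>m\<ge>N. \<forall>n\<ge>N. s (u m - u n) (u m - u n) < e" by blast
    qed
  qed
  then obtain x where x: "x \<in> D" and lim: "(\<lambda>n. s (u n - x) (u n - x)) \<longlonglongrightarrow> 0" by blast
  have "s x f = F f" if f: "f \<in> D" for f
  proof -
    have "(\<lambda>n. (J (u n) - m) * s f f) \<longlonglongrightarrow> 0"
    proof -
      have "(\<lambda>n. J (u n) - m) \<longlonglongrightarrow> 0"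
      proof (rule tendsto_sandwich[of "\<lambda>_. 0" _ _ "\<lambda>n. 1 / real (Suc n)"])
        show "\<forall>\<^sub>F n in sequentially. J (u n) - m \<le> 1 / real (Suc n)"
          using uJ by (intro always_eventually allI) (simp add: less_imp_le diff_le_eq add.commute)
        show "(\<lambda>n. 1 / real (Suc n)) \<longlonglongrightarrow> 0"
          using LIMSEQ_inverse_real_of_nat by (simp add: inverse_eq_divide)
      qed (use m_le uD in auto)
      then show ?thesis using tendsto_mult_left_zero by blast
    qed
    moreover have "(s (u n) f - F f)\<^sup>2 \<le> (J (u n) - m) * s f f" for n
      using near uD f by blast
    ultimately have "(\<lambda>n. (s (u n) f - F f)\<^sup>2) \<longlonglongrightarrow> 0"
      by (intro tendsto_sandwich[of "\<lambda>_. 0" "\<lambda>n. (s (u n) f - F f)\<^sup>2" _ "\<lambda>n. (J (u n) - m) * s f f"]) auto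
    then have 1: "(\<lambda>n. s (u n) f - F f) \<longlonglongrightarrow> 0"
      using tendsto_real_sqrt[of "\<lambda>n. (s (u n) f - F f)\<^sup>2"] by (simp add: tendsto_rabs_zero_iff)
    have "(\<lambda>n. (s (u n - x) f)\<^sup>2) \<longlonglongrightarrow> 0"
      using tendsto_mult_left_zero[OF lim, of "s f f"] cauchy_schwarz_square[OF diff_in[OF uD x] f]
      by (intro tendsto_sandwich[of "\<lambda>_. 0" "\<lambda>n. (s (u n - x) f)\<^sup>2" _ "\<lambda>n. s (u n - x) (u n - x) * s f f"]) auto
    then have "(\<lambda>n. s (u n - x) f) \<longlonglongrightarrow> 0"
      using tendsto_real_sqrt[of "\<lambda>n. (s (u n - x) f)\<^sup>2"] by (simp add: tendsto_rabs_zero_iff)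
    with 1 have "(\<lambda>n. (s (u n) f - F f) - s (u n - x) f) \<longlonglongrightarrow> 0 - 0"
      by (rule tendsto_diff)
    moreover have "(s (u n) f - F f) - s (u n - x) f = s x f - F f" for n
      using s_diff(1)[OF uD x f, of n] by simp
    ultimately have "s x f - F f = 0" by (simp add: LIMSEQ_const_iff)
    then show ?thesis by simp
  qed
  with x show ?thesis by blast
qed

text \<open>The lower bound turns Cauchy sequences for \<open>t\<close> into Cauchy sequences for
  \<open>s\<close>; the upper bound turns convergence for \<open>s\<close> back into convergence for
  \<open>t\<close>.\<close>

lemma hilbert_set_equivalent:
  assumes "bilinear_on D t" and "\<And>u v. u \<in> D \<Longrightarrow> v \<in> D \<Longrightarrow> t u v = t v u"
    and c: "0 < c" and lower: "\<And>u. u \<in> D \<Longrightarrow> c * s u u \<le> t u u"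
    and upper: "\<And>u. u \<in> D \<Longrightarrow> t u u \<le> K * s u u"
  shows "hilbert_set D t"
proof
  show "subspace D" by (rule subsp)
  show "bilinear_on D t" "\<And>u v. u \<in> D \<Longrightarrow> v \<in> D \<Longrightarrow> t u v = t v u" by fact+
  show t_pos: "0 \<le> t u u" if "u \<in> D" for u
    using lower[OF that] pos[OF that] c by (meson mult_nonneg_nonneg order_trans less_imp_le)
  fix u :: "nat \<Rightarrow> 'a"
  assume u: "range u \<subseteq> D" and cau: "\<forall>e>0. \<exists>N. \<forall>m\<ge>N. \<forall>n\<ge>N. t (u m - u n) (u m - u n) < e"
  have uD: "u n \<in> D" for n using u by auto
  have "\<exists>x\<in>D. (\<lambda>n. s (u n - x) (u n - x)) \<longlonglongrightarrow> 0"
  proof (rule complete[OF u], intro allI impI)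
    fix e :: real assume "e > 0"
    with c have "c * e > 0" by simp
    with cau obtain N where "\<forall>m\<ge>N. \<forall>n\<ge>N. t (u m - u n) (u m - u n) < c * e" by blast
    then have "\<forall>m\<ge>N. \<forall>n\<ge>N. c * s (u m - u n) (u m - u n) < c * e"
      using lower[OF diff_in[OF uD uD]] by (meson le_less_trans)
    with c show "\<exists>N. \<forall>m\<ge>N. \<forall>n\<ge>N. s (u m - u n) (u m - u n) < e" by auto
  qed
  then obtain x where x: "x \<in> D" and lim: "(\<lambda>n. s (u n - x) (u n - x)) \<longlonglongrightarrow> 0" by blast
  have "(\<lambda>n. t (u n - x) (u n - x)) \<longlonglongrightarrow> 0"
    using tendsto_mult_right_zero[OF lim, of K] t_pos upper diff_in[OF uD x]
    by (intro tendsto_sandwich[of "\<lambda>_. 0" "\<lambda>n. t (u n - x) (u n - x)" _ "\<lambda>n. K * s (u n - x) (u n - x)"]) auto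
  with x show "\<exists>x\<in>D. (\<lambda>n. t (u n - x) (u n - x)) \<longlonglongrightarrow> 0" by blast
qed

text \<open>
  Represent \<open>a\<close> by an operator \<open>A\<close>, and the functional by \<open>r\<close>. The form \<open>s (A u) (A v)\<close> is an
  equivalent inner product, so there is \<open>u\<close> with \<open>A u - r\<close> orthogonal to the range of \<open>A\<close>, and
  coercivity at \<open>A u - r\<close> itself forces \<open>A u = r\<close>.
\<close>

theorem lax_milgram:
  assumes a: "bilinear_on D a"
    and bound: "\<And>u v. u \<in> D \<Longrightarrow> v \<in> D \<Longrightarrow> \<bar>a u v\<bar> \<le> K * sqrt (s u u) * sqrt (s v v)"
    and c: "0 < c" and coercive: "\<And>u. u \<in> D \<Longrightarrow> c * s u u \<le> a u u"
    and F_add: "\<And>f g. f \<in> D \<Longrightarrow> g \<in> D \<Longrightarrow> F (f + g) = F f + F g"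
    and F_scale: "\<And>r f. f \<in> D \<Longrightarrow> F (r *\<^sub>R f) = r * F f"
    and F_bound: "\<And>f. f \<in> D \<Longrightarrow> \<bar>F f\<bar> \<le> M * sqrt (s f f)"
  shows "\<exists>u\<in>D. \<forall>f\<in>D. a u f = F f"
proof -
  obtain r where r: "r \<in> D" "\<And>f. f \<in> D \<Longrightarrow> s r f = F f"
    using riesz[of F M] F_add F_scale F_bound by blast
  have "\<exists>x\<in>D. \<forall>f\<in>D. s x f = a u f" if "u \<in> D" for u
    using that by (intro riesz[where K = "K * sqrt (s u u)"])
      (auto simp: bilinear_onD[OF a] bound)
  then obtain A where A: "\<And>u. u \<in> D \<Longrightarrow> A u \<in> D" "\<And>u f. u \<in> D \<Longrightarrow> f \<in> D \<Longrightarrow> s (A u) f = a u f"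
    by metis
  define t where "t u v = s (A u) (A v)" for u v
  have t1: "t u v = a u (A v)" if "u \<in> D" "v \<in> D" for u v
    using that A by (simp add: t_def)
  have t2: "t u v = a v (A u)" if "u \<in> D" "v \<in> D" for u v
    using that A sym by (simp add: t_def)
  have t_bil: "bilinear_on D t"
  proof -
    have "t (u + v) w = t u w + t v w" "t w (u + v) = t w u + t w v"
      if "u \<in> D" "v \<in> D" "w \<in> D" for u v w
      using that A(1) by (simp_all add: t1[of _ w] t2[of w] add_in bilinear_onD(1)[OF a])
    moreover have "t (r *\<^sub>R u) w = r * t u w" "t w (r *\<^sub>R u) = r * t w u"
      if "u \<in> D" "w \<in> D" for u w r
      using that A(1) by (simp_all add: t1[of _ w] t2[of w] scale_in bilinear_onD(3)[OF a])
    ultimately show ?thesis unfolding bilinear_on_def by blast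
  qed
  have A_upper: "t u u \<le> K\<^sup>2 * s u u" if u: "u \<in> D" for u
  proof -
    define p q where "p = sqrt (s u u)" and "q = sqrt (t u u)"
    have tu: "0 \<le> t u u" using u A(1) pos by (simp add: t_def)
    have nn: "0 \<le> p" "0 \<le> q" "p\<^sup>2 = s u u" "q\<^sup>2 = t u u"
      using pos[OF u] tu by (auto simp: p_def q_def)
    \<comment> \<open>The bound of \<open>a\<close> at \<open>v = A u\<close>; dividing by q leaves
      the case \<open>q = 0\<close> aside.\<close>
    have "q\<^sup>2 \<le> K * p * q"
      using bound[OF u A(1)[OF u]] t1[OF u u] nn by (simp add: t_def p_def q_def)
    then have "q \<le> K * p \<or> q = 0"
      using nn mult_right_le_imp_le[of q q "K * p"] by (cases "q = 0") (auto simp: power2_eq_square)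
    then show ?thesis
    proof
      assume "q \<le> K * p"
      then have "q\<^sup>2 \<le> (K * p)\<^sup>2" using nn by (intro power_mono) auto
      then show ?thesis using nn by (simp add: power_mult_distrib)
    qed (use nn pos[OF u] in auto)
  qed
  have A_lower: "c\<^sup>2 * s u u \<le> t u u" if u: "u \<in> D" for u
  proof -
    \<comment> \<open>Coercivity bounds \<open>a u u = s (A u) u\<close> from below, Cauchy-Schwarz
      bounds it from above by the norm of \<open>A u\<close>.\<close>
    have "(c * s u u)\<^sup>2 \<le> (a u u)\<^sup>2"
      using coercive[OF u] c pos[OF u] by (intro power_mono) auto
    also have "\<dots> \<le> t u u * s u u"
      using cauchy_schwarz_square[OF A(1)[OF u] u] A(2)[OF u u] by (simp add: t_def)
    finally have "s u u * (c\<^sup>2 * s u u) \<le> s u u * t u u"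
      by (simp add: power2_eq_square algebra_simps)
    moreover have "0 \<le> t u u" using u A(1) pos by (simp add: t_def)
    ultimately show ?thesis using pos[OF u] by (cases "s u u = 0") auto
  qed
  interpret t: hilbert_set D t
    using t_bil A_lower A_upper c
    by (intro hilbert_set_equivalent[where c = "c\<^sup>2" and K = "K\<^sup>2"]) (auto simp: t_def sym A)
  have "\<exists>u\<in>D. \<forall>f\<in>D. t u f = a f r"
  proof (rule t.riesz)
    fix f assume f: "f \<in> D"
    have "\<bar>a f r\<bar> \<le> sqrt (s r r) * sqrt (t f f)"
      using cauchy_schwarz[OF A(1)[OF f] r(1)] A(2)[OF f r(1)] by (simp add: t_def mult.commute)
    then show "\<bar>a f r\<bar> \<le> sqrt (s r r) * sqrt (t f f)" .
  qed (auto simp: bilinear_onD[OF a] r)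
  then obtain u where u: "u \<in> D" "\<And>f. f \<in> D \<Longrightarrow> t u f = a f r" by blast
  define e where "e = A u - r"
  have e: "e \<in> D" using A u r diff_in by (simp add: e_def)
  \<comment> \<open>Both \<open>a e (A u)\<close> and \<open>a e r\<close> equal
    \<open>t u e\<close>: the former by definition of t, the latter by the choice of u.\<close>
  have "a e e = 0"
    using bilinear_on_diff(2)[OF a subsp A(1)[OF u(1)] r(1) e] t2[OF u(1) e] u(2)[OF e]
    by (simp add: e_def)
  with coercive[OF e] pos[OF e] c have e0: "s e e = 0"
    by (metis mult_eq_0_iff less_irrefl mult_nonneg_nonneg order_antisym less_imp_le)
  \<comment> \<open>A null vector need not be 0, but Cauchy-Schwarz makes it orthogonal to
    everything.\<close>
  have "a u f = F f" if f: "f \<in> D" for f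
  proof -
    have "(s e f)\<^sup>2 \<le> 0" using cauchy_schwarz_square[OF e f] e0 by simp
    then have "s e f = 0" by simp
    then show ?thesis
      using s_diff(1)[OF A(1)[OF u(1)] r(1) f] A(2)[OF u(1) f] r(2)[OF f] by (simp add: e_def)
  qed
  with u show ?thesis by blast
qed

end

section \<open>Closed subspaces, projections and density\<close>

lemma bilinear_on_inner: "bilinear_on D inner"
  by (simp add: bilinear_on_def inner_add_left inner_add_right)

text \<open>Makes \<open>riesz\<close> available for closed subspaces, where it gives orthogonal
  projections, and for \<open>UNIV\<close>, where it gives adjoints of bounded operators.\<close>

lemma hilbert_set_inner:
  fixes D :: "'a::{real_inner, banach} set"
  assumes "subspace D" "closed D"
  shows "hilbert_set D inner"
proof
  fix u :: "nat \<Rightarrow> 'a"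
  assume u: "range u \<subseteq> D"
    and cau: "\<forall>e>0. \<exists>N. \<forall>m\<ge>N. \<forall>n\<ge>N. inner (u m - u n) (u m - u n) < e"
  have "Cauchy u"
    unfolding Cauchy_def
  proof (intro allI impI)
    fix e :: real assume "e > 0"
    with cau obtain N where "\<forall>m\<ge>N. \<forall>n\<ge>N. inner (u m - u n) (u m - u n) < e\<^sup>2"
      by (meson zero_less_power)
    then have "\<forall>m\<ge>N. \<forall>n\<ge>N. dist (u m) (u n) < e"
      using \<open>e > 0\<close>
        by (auto simp: dist_norm power2_norm_eq_inner[symmetric] intro: power2_less_imp_less)
    then show "\<exists>N. \<forall>m\<ge>N. \<forall>n\<ge>N. dist (u m) (u n) < e" by blast
  qed
  then obtain x where x: "u \<longlonglongrightarrow> x" by (auto simp: Cauchy_convergent_iff convergent_def)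
  have "x \<in> D" using closed_sequentially[OF assms(2) _ x] u by auto
  moreover have "(\<lambda>n. inner (u n - x) (u n - x)) \<longlonglongrightarrow> inner (x - x) (x - x)"
    by (intro tendsto_intros x)
  ultimately show "\<exists>x\<in>D. (\<lambda>n. inner (u n - x) (u n - x)) \<longlonglongrightarrow> 0" by auto
qed (auto simp: assms bilinear_on_inner inner_commute)

lemma subspace_closure:
  fixes D :: "'a::real_normed_vector set"
  assumes D: "subspace D"
  shows "subspace (closure D)"
proof (rule subspaceI)
  show "0 \<in> closure D" using subspace_0[OF D] closure_subset by blast
next
  fix x y assume "x \<in> closure D" "y \<in> closure D"
  then obtain f g where "\<And>n. f n \<in> D" "f \<longlonglongrightarrow> x" "\<And>n. g n \<in> D" "g \<longlonglongrightarrow> y"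
    unfolding closure_sequential by blast
  then show "x + y \<in> closure D" unfolding closure_sequential
    by (intro exI[of _ "\<lambda>n. f n + g n"]) (auto intro: subspace_add[OF D] tendsto_add)
next
  fix x c assume "x \<in> closure D"
  then obtain f where "\<And>n. f n \<in> D" "f \<longlonglongrightarrow> x" unfolding closure_sequential by blast
  then show "c *\<^sub>R x \<in> closure D" unfolding closure_sequential
    by (intro exI[of _ "\<lambda>n. c *\<^sub>R f n"]) (auto intro: subspace_mul[OF D] tendsto_scaleR)
qed

text \<open>Riesz on the closure yields the orthogonal projection p of x; the remainder
  \<open>x - p\<close> is orthogonal to D and hence 0.\<close>

lemma dense_subspace_if_orthogonal_trivial:
  fixes D :: "'a::{real_inner, banach} set"
  assumes D: "subspace D" and triv: "\<And>g. (\<forall>f\<in>D. inner g f = 0) \<Longrightarrow> g = 0"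
  shows "closure D = UNIV"
proof -
  interpret hilbert_set "closure D" inner
    using D by (intro hilbert_set_inner subspace_closure) auto
  have "x \<in> closure D" for x
  proof -
    have "\<exists>p\<in>closure D. \<forall>f\<in>closure D. inner p f = inner x f"
      by (intro riesz[where K = "norm x"])
        (auto simp: inner_add_right Cauchy_Schwarz_ineq2 norm_eq_sqrt_inner[symmetric])
    then obtain p where p: "p \<in> closure D" "\<And>f. f \<in> closure D \<Longrightarrow> inner p f = inner x f" by blast
    have "x - p = 0"
      using p(2) closure_subset[of D] by (intro triv) (auto simp: inner_diff_left)
    with p show ?thesis by simp
  qed
  then show ?thesis by auto
qed

lemma orthogonal_dense_eq_0:
  fixes D :: "'a::real_inner set"
  assumes "closure D = UNIV" "\<And>f. f \<in> D \<Longrightarrow> inner g f = 0"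
  shows "g = 0"
proof -
  have "g \<in> closure D" using assms by simp
  then obtain f where f: "\<And>n. f n \<in> D" "f \<longlonglongrightarrow> g"
    unfolding closure_sequential by blast
  have "(\<lambda>n. inner g (f n)) \<longlonglongrightarrow> inner g g" by (intro tendsto_intros f)
  with f assms have "inner g g = 0" by (simp add: LIMSEQ_const_iff)
  then show ?thesis by simp
qed

section \<open>Quadratic polynomials of a bounded symmetric operator\<close>

text \<open>
  If \<open>q(T)\<close> had a negative lower bound \<open>m\<close>, approximate minimisers would be approximate
  eigenvectors of \<open>q(T)\<close> for \<open>m\<close>, and factorising \<open>q - m\<close> would produce an approximate
  eigenvalue \<open>t\<close> of \<open>T\<close> with \<open>q t = m < 0\<close>.
\<close>

theorem quadratic_calculus_nonneg:
  fixes T :: "'a::real_inner \<Rightarrow> 'a" and \<alpha> \<beta> \<gamma> :: real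
  assumes T: "bounded_linear T" and symT: "\<And>u v. inner (T u) v = inner u (T v)"
    and \<alpha>: "\<alpha> \<noteq> 0"
    and gap: "\<And>t. \<alpha> * t\<^sup>2 + \<beta> * t + \<gamma> < 0 \<Longrightarrow> \<exists>c>0. \<forall>u. c * norm u \<le> norm (T u - t *\<^sub>R u)"
  shows "0 \<le> \<alpha> * (norm (T u))\<^sup>2 + \<beta> * inner (T u) u + \<gamma> * (norm u)\<^sup>2"
proof (rule ccontr)
  interpret T: bounded_linear T by (rule T)
  define Q where "Q v = \<alpha> *\<^sub>R T (T v) + \<beta> *\<^sub>R T v + \<gamma> *\<^sub>R v" for v
  have Q_inner: "inner (Q v) v = \<alpha> * (norm (T v))\<^sup>2 + \<beta> * inner (T v) v + \<gamma> * (norm v)\<^sup>2"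
    for v
    by (simp add: Q_def inner_add_left symT power2_norm_eq_inner)
  assume "\<not> ?thesis"
  then have neg: "inner (Q u) u < 0" by (simp add: Q_inner)
  then have u0: "u \<noteq> 0" by auto
  have Q_lin: "bounded_linear Q"
    unfolding Q_def
    by (intro bounded_linear_add bounded_linear_compose[OF bounded_linear_scaleR_right]
        bounded_linear_compose[OF T] T bounded_linear_ident)
  then interpret Q: bounded_linear Q .
  obtain K where K: "K > 0" "\<And>v. norm (Q v) \<le> norm v * K" using Q.pos_bounded by blast
  define S where "S = (\<lambda>v. inner (Q v) v) ` {v. norm v = 1}"
  have low: "- K \<le> inner (Q v) v" if "norm v = 1" for v
    using Cauchy_Schwarz_ineq2[of "Q v" v] K(2)[of v] that by (simp add: abs_le_iff)
  have bdd: "bdd_below S" unfolding S_def using low by (intro bdd_belowI2) auto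
  define m where "m = Inf S"
  have mle1: "m \<le> inner (Q v) v" if "norm v = 1" for v
    unfolding m_def using that bdd by (intro cInf_lower) (auto simp: S_def)
  have mle: "m * (norm v)\<^sup>2 \<le> inner (Q v) v" for v
  proof (cases "v = 0")
    case False
    have "m \<le> inner (Q (v /\<^sub>R norm v)) (v /\<^sub>R norm v)" using False by (intro mle1) simp
    also have "\<dots> = inner (Q v) v / (norm v)\<^sup>2"
      by (simp add: Q.scaleR power2_eq_square field_simps)
    finally show ?thesis using False by (simp add: field_simps)
  qed simp
  have m0: "m < 0"
  proof (rule ccontr)
    assume "\<not> m < 0"
    then have "0 \<le> m * (norm u)\<^sup>2" by simp
    with mle[of u] neg show False by simp
  qed
  have Sne: "S \<noteq> {}"
    using u0 by (auto simp: S_def intro!: exI[of _ "u /\<^sub>R norm u"])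
  define P where "P v = Q v - m *\<^sub>R v" for v
  have P_lin: "bounded_linear P" unfolding P_def
    by (intro bounded_linear_sub Q_lin bounded_linear_scaleR_right)
  then interpret P: bounded_linear P .
  obtain B where B: "B > 0" "\<And>v. norm (P v) \<le> norm v * B" using P.pos_bounded by blast
  have P_sym: "inner (P v) w = inner v (P w)" for v w
    by (simp add: P_def Q_def inner_add_left inner_add_right inner_diff_left inner_diff_right symT)
  have P_pos: "0 \<le> inner (P v) v" for v
    using mle[of v] by (simp add: P_def inner_diff_left power2_norm_eq_inner)
  \<comment> \<open>Cauchy-Schwarz for the non-negative form \<open>inner (P v) w\<close> at
    \<open>w = P v\<close>. It makes \<open>P v\<close> small as soon as v nearly minimises the
    quadratic form of \<open>Q\<close>.\<close>
  have P_small: "(norm (P v))\<^sup>2 \<le> B * inner (P v) v" for v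
  proof -
    have "(inner (P v) (P v))\<^sup>2 \<le> inner (P v) v * inner (P (P v)) (P v)"
    proof (rule quadratic_nonneg_discriminant)
      fix t
      show "0 \<le> inner (P v) v + 2 * t * inner (P v) (P v) + t\<^sup>2 * inner (P (P v)) (P v)"
        using P_pos[of "v + t *\<^sub>R P v"]
        by (simp add: P.add P.scaleR inner_add_left inner_add_right P_sym[of v] P_sym[of "P v"]
            power2_eq_square algebra_simps)
    qed
    also have "\<dots> \<le> inner (P v) v * (B * (norm (P v))\<^sup>2)"
    proof (rule mult_left_mono[OF _ P_pos])
      have "inner (P (P v)) (P v) \<le> norm (P (P v)) * norm (P v)" by (rule norm_cauchy_schwarz)
      also have "\<dots> \<le> (norm (P v) * B) * norm (P v)" using B by (intro mult_right_mono) auto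
      finally show "inner (P (P v)) (P v) \<le> B * (norm (P v))\<^sup>2"
        by (simp add: power2_eq_square algebra_simps)
    qed
    finally have "(norm (P v))\<^sup>2 * (norm (P v))\<^sup>2 \<le> (norm (P v))\<^sup>2 * (B * inner (P v) v)"
      unfolding power2_norm_eq_inner[of "P v", symmetric]
      by (simp only: power2_eq_square[of "(norm (P v))\<^sup>2"] mult_ac)
    then show ?thesis
      using P_pos[of v] B(1)
      by (cases "P v = 0") (simp, erule mult_left_le_imp_le, simp)
  qed
  \<comment> \<open>By the choice of m as an infimum, \<open>P\<close> cannot be bounded below. The
    rest of the proof bounds it below.\<close>
  have not_below: False if b: "b > 0" "\<And>v. b * norm v \<le> norm (P v)" for b
  proof -
    obtain x where "x \<in> S" "x < m + b\<^sup>2 / B"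
      using cInf_lessD[OF Sne, of "m + b\<^sup>2 / B"] b(1) B(1) by (auto simp: m_def)
    then obtain v where v: "norm v = 1" "inner (Q v) v < m + b\<^sup>2 / B" by (auto simp: S_def)
    have "b\<^sup>2 \<le> (norm (P v))\<^sup>2" using b(2)[of v] v b(1) by (intro power_mono) auto
    also have "\<dots> \<le> B * inner (P v) v" by (rule P_small)
    also have "inner (P v) v = inner (Q v) v - m"
      using v by (simp add: P_def inner_diff_left power2_norm_eq_inner[symmetric])
    also have "B * (inner (Q v) v - m) < B * (b\<^sup>2 / B)" using v B by (intro mult_strict_left_mono) auto
    also have "\<dots> = b\<^sup>2" using B by simp
    finally show False by simp
  qed
  \<comment> \<open>Completing the square:
    \<open>q t - m = \<alpha> * ((t - x)^2 + d)\<close>.\<close>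
  define x where "x = - \<beta> / (2 * \<alpha>)"
  define d where "d = (\<gamma> - m) / \<alpha> - x\<^sup>2"
  have bx: "\<beta> = - (\<alpha> * x) - \<alpha> * x" and gx: "\<gamma> - m = \<alpha> * (x\<^sup>2 + d)"
    using \<alpha> by (auto simp: x_def d_def)
  define X where "X v = T v - x *\<^sub>R v" for v
  have PX: "P v = \<alpha> *\<^sub>R (X (X v) + d *\<^sub>R v)" for v
  proof -
    have "P v = \<alpha> *\<^sub>R T (T v) + \<beta> *\<^sub>R T v + (\<gamma> - m) *\<^sub>R v"
      by (simp add: P_def Q_def algebra_simps)
    also have "\<dots> = \<alpha> *\<^sub>R (X (X v) + d *\<^sub>R v)"
      unfolding bx gx X_def
      by (simp add: T.diff T.scaleR algebra_simps power2_eq_square)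
        (simp add: scaleR_add_left[symmetric])
    finally show ?thesis .
  qed
  show False
  proof (cases "d > 0")
    case True
    have X_sym: "inner (X v) w = inner v (X w)" for v w
      by (simp add: X_def inner_diff_left inner_diff_right symT)
    \<comment> \<open>Without real zeros the square of the symmetric \<open>X\<close> only helps:
      pairing with v leaves at least \<open>d\<close> times the squared norm.\<close>
    have "d * norm v \<le> norm (X (X v) + d *\<^sub>R v)" for v
    proof (cases "v = 0")
      case False
      have "d * norm v * norm v \<le> inner (X (X v) + d *\<^sub>R v) v"
        by (simp add: inner_add_left X_sym[of "X v"] power2_norm_eq_inner[symmetric]
            power2_eq_square mult.assoc)
      also have "\<dots> \<le> norm (X (X v) + d *\<^sub>R v) * norm v" by (rule norm_cauchy_schwarz)
      finally show ?thesis using False by simp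
    qed simp
    then have "\<bar>\<alpha>\<bar> * d * norm v \<le> norm (P v)" for v
      by (simp add: PX mult.assoc mult_left_mono)
    with not_below[of "\<bar>\<alpha>\<bar> * d"] True \<alpha> show False by simp
  next
    case False
    define y where "y = sqrt (- d)"
    have d: "d = - y\<^sup>2" using False by (simp add: y_def)
    \<comment> \<open>The real zeros of \<open>q - m\<close> are points where q equals
      \<open>m < 0\<close>, so \<open>gap\<close> applies to both linear factors of
      \<open>P\<close>.\<close>
    have root: "\<alpha> * t\<^sup>2 + \<beta> * t + \<gamma> < 0" if "t = x + y \<or> t = x - y" for t
    proof -
      have "(t - x)\<^sup>2 = y\<^sup>2" using that by auto
      then have "\<alpha> * ((t - x)\<^sup>2 + d) = 0" using d by simp
      moreover have "\<alpha> * ((t - x)\<^sup>2 + d) = \<alpha> * t\<^sup>2 + \<beta> * t + (\<gamma> - m)"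
        unfolding bx gx by (simp add: power2_eq_square algebra_simps)
      ultimately show ?thesis using m0 by linarith
    qed
    obtain c1 where c1: "c1 > 0" "\<And>v. c1 * norm v \<le> norm (T v - (x + y) *\<^sub>R v)"
      using gap[OF root] by blast
    obtain c2 where c2: "c2 > 0" "\<And>v. c2 * norm v \<le> norm (T v - (x - y) *\<^sub>R v)"
      using gap[OF root] by blast
    have "X (X v) + d *\<^sub>R v = T w - (x + y) *\<^sub>R w" if "w = T v - (x - y) *\<^sub>R v" for v w
      unfolding X_def that d by (simp add: T.diff T.add T.scaleR algebra_simps power2_eq_square)
    then have "c1 * (c2 * norm v) \<le> norm (X (X v) + d *\<^sub>R v)" for v
      using c1 c2(2)[of v] by (metis order_trans mult_left_mono less_imp_le)
    then have "\<bar>\<alpha>\<bar> * (c1 * c2) * norm v \<le> norm (P v)" for v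
      by (simp add: PX mult.assoc mult_left_mono)
    with not_below[of "\<bar>\<alpha>\<bar> * (c1 * c2)"] c1 c2 \<alpha> show False by simp
  qed
qed

section \<open>Sesquilinear forms\<close>

lemma cinner_add_right: "cinner x (y + z) = cinner x y + cinner x z"
  by (metis cinner_commute cinner_add_left complex_cnj_add)

lemma cinner_scaleC_right: "cinner x (c *\<^sub>C y) = cnj c * cinner x y"
  by (metis cinner_commute cinner_scaleC_left complex_cnj_mult)

lemma scaleC_one: "1 *\<^sub>C x = x"
  using scaleC_of_real[of 1 x] by simp

lemma scaleC_minus_one: "(- 1) *\<^sub>C x = - x"
  using scaleC_of_real[of "- 1" x] by simp

lemma scaleC_zero_left: "0 *\<^sub>C x = 0"
  using scaleC_of_real[of 0 x] by simp

lemma scaleC_minus_left: "(- c) *\<^sub>C x = - (c *\<^sub>C x)"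
  using scaleC_scaleC[of "- 1" c x] by (simp add: scaleC_minus_one)

lemma scaleC_minus_right: "c *\<^sub>C (- x) = - (c *\<^sub>C x)"
  using scaleC_scaleC[of c "- 1" x] scaleC_minus_left[of c x] by (simp add: scaleC_minus_one)

lemma scaleC_diff_left: "(c - d) *\<^sub>C x = c *\<^sub>C x - d *\<^sub>C x"
  using scaleC_add_left[of c "- d" x] by (simp add: scaleC_minus_left)

lemma scaleC_diff_right: "c *\<^sub>C (x - y) = c *\<^sub>C x - c *\<^sub>C y"
  using scaleC_add_right[of c x "- y"] by (simp add: scaleC_minus_right)

lemma scaleC_zero_right: "c *\<^sub>C 0 = 0"
  using scaleC_diff_right[of c 0 0] by simp

lemma cinner_minus_left: "cinner (- x) y = - cinner x y"
  using cinner_scaleC_left[of "- 1" x y] by (simp add: scaleC_minus_one)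

lemma cinner_minus_right: "cinner x (- y) = - cinner x y"
  using cinner_scaleC_right[of x "- 1" y] by (simp add: scaleC_minus_one)

lemma cinner_diff_left: "cinner (x - y) z = cinner x z - cinner y z"
  using cinner_add_left[of x "- y" z] by (simp add: cinner_minus_left)

lemma cinner_diff_right: "cinner x (y - z) = cinner x y - cinner x z"
  using cinner_add_right[of x y "- z"] by (simp add: cinner_minus_right)

lemma cinner_zero: "cinner 0 x = 0" "cinner x 0 = 0"
  using cinner_diff_left[of 0 0 x] cinner_diff_right[of x 0 0] by simp_all

lemma cinner_self: "cinner x x = complex_of_real ((norm x)\<^sup>2)"
proof (rule complex_eqI)
  have "cinner x x = cnj (cinner x x)" by (rule cinner_commute)
  then have "Im (cinner x x) = - Im (cinner x x)" by (metis cnj.simps(2))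
  then show "Im (cinner x x) = Im (complex_of_real ((norm x)\<^sup>2))" by simp
qed (simp add: Re_cinner power2_norm_eq_inner)

text \<open>The class ties the norm directly only to real scalars; complex homogeneity has to come
  from \<open>cinner\<close>.\<close>

lemma norm_scaleC: "norm (c *\<^sub>C x) = cmod c * norm x"
proof (rule power2_eq_imp_eq)
  have "complex_of_real ((norm (c *\<^sub>C x))\<^sup>2) = c * cnj c * cinner x x"
    by (simp only: cinner_self[symmetric] cinner_scaleC_left cinner_scaleC_right mult_ac)
  also have "\<dots> = complex_of_real ((cmod c * norm x)\<^sup>2)"
    by (simp add: cinner_self complex_norm_square[symmetric] power_mult_distrib)
  finally show "(norm (c *\<^sub>C x))\<^sup>2 = (cmod c * norm x)\<^sup>2" using of_real_eq_iff by blast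
qed auto

lemma sesquilinear_on_cinner: "sesquilinear_on D cinner"
  by (auto simp: sesquilinear_on_def cinner_add_left cinner_add_right cinner_scaleC_left
      cinner_scaleC_right)

lemma csubspaceD:
  assumes "csubspace D"
  shows "0 \<in> D" "u \<in> D \<Longrightarrow> v \<in> D \<Longrightarrow> u + v \<in> D" "u \<in> D \<Longrightarrow> c *\<^sub>C u \<in> D"
  using assms by (auto simp: csubspace_def)

lemma subspace_csubspace: "csubspace D \<Longrightarrow> subspace D"
  by (auto simp: subspace_def scaleC_of_real[symmetric] csubspaceD)

lemma sesquilinear_onD:
  assumes "sesquilinear_on D a" "u \<in> D" "v \<in> D" "w \<in> D"
  shows "a (u + v) w = a u w + a v w" "a w (u + v) = a w u + a w v"
    "a (c *\<^sub>C u) w = c * a u w" "a w (c *\<^sub>C u) = cnj c * a w u"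
  using assms by (auto simp: sesquilinear_on_def)

lemma sesquilinear_on_diff:
  assumes "sesquilinear_on D a" "csubspace D" "u \<in> D" "v \<in> D" "w \<in> D"
  shows "a (u - v) w = a u w - a v w" "a w (u - v) = a w u - a w v"
proof -
  have m: "(- 1) *\<^sub>C v \<in> D" using assms by (intro csubspaceD)
  have "a (u + (- 1) *\<^sub>C v) w = a u w + (- 1) * a v w"
    using sesquilinear_onD(1)[OF assms(1,3) m assms(5)]
      sesquilinear_onD(3)[OF assms(1,4,4,5), of "- 1"] by simp
  then show "a (u - v) w = a u w - a v w" by (simp add: scaleC_minus_one)
  have "a w (u + (- 1) *\<^sub>C v) = a w u + (- 1) * a w v"
    using sesquilinear_onD(2)[OF assms(1,3) m assms(5)]
      sesquilinear_onD(4)[OF assms(1,4,4,5), of "- 1"] by simp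
  then show "a w (u - v) = a w u - a w v" by (simp add: scaleC_minus_one)
qed

text \<open>Passage to the real setting in which Riesz and Lax-Milgram are available.\<close>

lemma bilinear_on_Re:
  assumes "sesquilinear_on D a" "csubspace D"
  shows "bilinear_on D (\<lambda>u v. Re (c * a u v))"
  unfolding bilinear_on_def
  using csubspaceD(1)[OF assms(2)]
  by (auto simp: scaleC_of_real[symmetric] sesquilinear_onD[OF assms(1)] algebra_simps)

text \<open>Testing with \<open>i f\<close> turns imaginary parts into real parts. This is the way
  back from real variational problems to complex equations.\<close>

lemma cinner_eqI:
  assumes "csubspace D" "sesquilinear_on D a" "u \<in> D" "f \<in> D"
    and Re: "\<And>f. f \<in> D \<Longrightarrow> Re (a u f) = inner g f"
  shows "a u f = cinner g f"
proof (rule complex_eqI)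
  have "Re (a u (\<i> *\<^sub>C f)) = inner g (\<i> *\<^sub>C f)" using assms by (intro Re csubspaceD)
  then show "Im (a u f) = Im (cinner g f)"
    using assms by (simp add: sesquilinear_onD(4)[of D] Re_cinner[symmetric] cinner_scaleC_right)
qed (use assms in \<open>simp add: Re_cinner\<close>)

text \<open>Polarization: \<open>t (u + v) (u + v)\<close> and \<open>t (u + i v) (u + i v)\<close> are real.\<close>

lemma hermitian_if_real:
  assumes "csubspace D" "sesquilinear_on D t" and real: "\<And>u. u \<in> D \<Longrightarrow> t u u \<in> \<real>"
    and D: "u \<in> D" "v \<in> D"
  shows "t u v = cnj (t v u)"
proof -
  have iv: "\<i> *\<^sub>C v \<in> D" using assms by (intro csubspaceD)
  have "t (u + v) (u + v) = t u u + t u v + t v u + t v v"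
    using D csubspaceD(2)[OF assms(1) D] by (simp add: sesquilinear_onD[OF assms(2)])
  with real[OF csubspaceD(2)[OF assms(1) D]] real[OF D(1)] real[OF D(2)]
  have 1: "Im (t u v) + Im (t v u) = 0" by (auto simp: complex_is_Real_iff)
  have "t (u + \<i> *\<^sub>C v) (u + \<i> *\<^sub>C v)
      = t u u + t u (\<i> *\<^sub>C v) + t (\<i> *\<^sub>C v) u + t (\<i> *\<^sub>C v) (\<i> *\<^sub>C v)"
    using D iv csubspaceD(2)[OF assms(1) D(1) iv] by (simp add: sesquilinear_onD(1,2)[OF assms(2)])
  also have "\<dots> = t u u - \<i> * t u v + \<i> * t v u + t v v"
    using D iv by (simp add: sesquilinear_onD(3,4)[OF assms(2), of _ u] sesquilinear_onD(3,4)[OF assms(2), of _ v])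
  finally have "Re (t v u) - Re (t u v) = 0"
    using real[OF csubspaceD(2)[OF assms(1) D(1) iv]] real[OF D(1)] real[OF D(2)]
    by (simp add: complex_is_Real_iff)
  with 1 show ?thesis by (intro complex_eqI) auto
qed

text \<open>Rotating w onto the positive axis reduces complex Cauchy-Schwarz inequalities to real
  ones.\<close>

lemma cmod_le_if_Re_le:
  assumes "\<And>c. cmod c = 1 \<Longrightarrow> Re (c * w) \<le> B"
  shows "cmod w \<le> B"
proof (cases "w = 0")
  case True
  then show ?thesis using assms[of 1] by simp
next
  case False
  have "cnj w / cmod w * w = (cnj w * w) / cmod w" by simp
  also have "\<dots> = complex_of_real (cmod w)"
    using False by (simp add: mult.commute[of "cnj w"] complex_norm_square[symmetric] power2_eq_square)
  finally have "Re (cnj w / cmod w * w) = cmod w" by simp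
  moreover have "Re (cnj w / cmod w * w) \<le> B" using False by (intro assms) (simp add: norm_divide)
  ultimately show ?thesis by simp
qed

lemma cmod_cinner_le: "cmod (cinner x y) \<le> norm x * norm y"
proof (rule cmod_le_if_Re_le)
  fix c :: complex assume "cmod c = 1"
  then show "Re (c * cinner x y) \<le> norm x * norm y"
    using norm_cauchy_schwarz[of "c *\<^sub>C x" y]
    by (simp add: cinner_scaleC_left[symmetric] Re_cinner norm_scaleC)
qed

section \<open>Operators given by their graphs\<close>

lemma linear_operatorD:
  assumes "linear_operator T"
  shows "single_valued T" "(0, 0) \<in> T"
    "(u, v) \<in> T \<Longrightarrow> (u', v') \<in> T \<Longrightarrow> (u + u', v + v') \<in> T"
    "(u, v) \<in> T \<Longrightarrow> (c *\<^sub>C u, c *\<^sub>C v) \<in> T"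
  using assms unfolding linear_operator_def by blast+

lemma op_apply_eq:
  "linear_operator R \<Longrightarrow> (u, v) \<in> R \<Longrightarrow> op_apply R u = v"
  unfolding op_apply_def by (blast dest: linear_operatorD(1) single_valuedD)

lemma op_shift_iff: "(u, f) \<in> op_shift T w \<longleftrightarrow> (u, f + w *\<^sub>C u) \<in> T"
proof
  assume "(u, f + w *\<^sub>C u) \<in> T"
  moreover have "f = (f + w *\<^sub>C u) - w *\<^sub>C u" by simp
  ultimately show "(u, f) \<in> op_shift T w" unfolding op_shift_def by blast
qed (auto simp: op_shift_def)

lemma linear_operator_op_shift:
  assumes T: "linear_operator T"
  shows "linear_operator (op_shift T w)"
  unfolding linear_operator_def op_shift_iff
proof (intro conjI allI impI)
  show "single_valued (op_shift T w)"
    using linear_operatorD(1)[OF T] unfolding single_valued_def op_shift_iff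
    by (metis add_right_imp_eq)
  show "(0, 0 + w *\<^sub>C 0) \<in> T" using linear_operatorD(2)[OF T] by (simp add: scaleC_zero_right)
next
  fix u v u' v' assume "(u, v + w *\<^sub>C u) \<in> T" "(u', v' + w *\<^sub>C u') \<in> T"
  from linear_operatorD(3)[OF T this] show "(u + u', v + v' + w *\<^sub>C (u + u')) \<in> T"
    by (simp add: scaleC_add_right add_ac)
next
  fix c u v assume "(u, v + w *\<^sub>C u) \<in> T"
  from linear_operatorD(4)[OF T this, of c] show "(c *\<^sub>C u, c *\<^sub>C v + w *\<^sub>C c *\<^sub>C u) \<in> T"
    by (simp add: scaleC_add_right scaleC_scaleC mult.commute)
qed

lemma op_shift_op_shift: "op_shift (op_shift T v) w = op_shift T (v + w)"
  by (auto simp: op_shift_iff scaleC_add_left add_ac)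

lemma resolvent_op_shift: "resolvent (op_shift T v) w = resolvent T (v + w)"
  by (simp add: resolvent_def op_shift_op_shift fun_eq_iff)

lemma resolvent_set_op_shift: "w \<in> resolvent_set (op_shift T v) \<longleftrightarrow> v + w \<in> resolvent_set T"
  by (simp add: resolvent_set_def op_shift_op_shift resolvent_op_shift)

text \<open>An a-priori bound gives both uniqueness and continuity of the solution, so that only
  solvability needs an existence argument.\<close>

lemma resolvent_setI:
  assumes T: "linear_operator T" and K: "0 \<le> K"
    and surj: "\<And>f. \<exists>u. (u, f) \<in> op_shift T w"
    and bound: "\<And>u f. (u, f) \<in> op_shift T w \<Longrightarrow> norm u \<le> K * norm f"
  shows "w \<in> resolvent_set T" "onorm (resolvent T w) \<le> K"
proof -
  note lin = linear_operatorD[OF linear_operator_op_shift[OF T, of w]]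
  have uniq: "\<exists>!u. (u, f) \<in> op_shift T w" for f
  proof (rule ex_ex1I[OF surj])
    fix u u' assume u: "(u, f) \<in> op_shift T w" "(u', f) \<in> op_shift T w"
    have "(u + (- 1) *\<^sub>C u', f + (- 1) *\<^sub>C f) \<in> op_shift T w" by (intro lin u)
    from bound[OF this] show "u = u'" by (simp add: scaleC_minus_one)
  qed
  define R where "R = resolvent T w"
  have R: "(R f, f) \<in> op_shift T w" for f
    unfolding R_def resolvent_def by (rule theI'[OF uniq])
  have R_eq: "R f = u" if "(u, f) \<in> op_shift T w" for u f
    using uniq[of f] R that by blast
  have "bounded_linear R"
  proof (rule bounded_linear_intro[of _ K])
    show "R (x + y) = R x + R y" for x y by (intro R_eq lin R)
    show "R (r *\<^sub>R x) = r *\<^sub>R R x" for r x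
      using R_eq[OF lin(4)[OF R, of "complex_of_real r" x]] by (simp add: scaleC_of_real)
    show "norm (R x) \<le> norm x * K" for x using bound[OF R[of x]] by (simp add: mult.commute)
  qed
  with uniq show "w \<in> resolvent_set T" by (auto simp: resolvent_set_def R_def)
  show "onorm (resolvent T w) \<le> K"
    using bound R by (intro onorm_bound K) (auto simp: R_def)
qed

lemma resolvent_setD:
  assumes "w \<in> resolvent_set T"
  shows "(resolvent T w f, f) \<in> op_shift T w"
    "(u, f) \<in> op_shift T w \<Longrightarrow> u = resolvent T w f"
    "bounded_linear (resolvent T w)"
proof -
  have uniq: "\<exists>!u. (u, f) \<in> op_shift T w" for f using assms by (simp add: resolvent_set_def)
  show "(resolvent T w f, f) \<in> op_shift T w"
    unfolding resolvent_def by (rule theI'[OF uniq])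
  with uniq show "(u, f) \<in> op_shift T w \<Longrightarrow> u = resolvent T w f" by blast
  show "bounded_linear (resolvent T w)" using assms by (simp add: resolvent_set_def)
qed

lemma resolvent_set_bound:
  assumes "w \<in> resolvent_set T"
  shows "\<exists>K>0. \<forall>u f. (u, f) \<in> op_shift T w \<longrightarrow> norm u \<le> K * norm f"
proof -
  obtain K where "K > 0" "\<And>f. norm (resolvent T w f) \<le> norm f * K"
    using bounded_linear.pos_bounded[OF resolvent_setD(3)[OF assms]] by blast
  then show ?thesis using resolvent_setD(2)[OF assms] by (metis mult.commute)
qed

text \<open>Written as \<open>u = R(z) (f + (w - z) u)\<close>, the equation at w is a contraction
  for w near z. The resulting distance between z and the spectrum later makes the supremum in
  \<omega> finite.\<close>

lemma resolvent_set_open: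
  assumes T: "linear_operator T" and z: "z \<in> resolvent_set T"
  shows "\<exists>d>0. \<forall>w. cmod (w - z) < d \<longrightarrow> w \<in> resolvent_set T"
proof -
  obtain K where K: "K > 0" "\<And>u f. (u, f) \<in> op_shift T z \<Longrightarrow> norm u \<le> K * norm f"
    using resolvent_set_bound[OF z] by blast
  interpret R: bounded_linear "resolvent T z" by (rule resolvent_setD(3)[OF z])
  \<comment> \<open>The radius \<open>1 / (2 * K)\<close> yields the contraction factor 1/2 and, by
    absorbing half of \<open>norm u\<close>, the a-priori constant \<open>2 * K\<close>.\<close>
  have "w \<in> resolvent_set T" if w: "cmod (w - z) < 1 / (2 * K)" for w
  proof (rule resolvent_setI(1)[OF T])
    have small: "K * cmod (w - z) \<le> 1 / 2" using w K(1) by (simp add: field_simps)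
    have iff: "(u, f) \<in> op_shift T w \<longleftrightarrow> (u, f + (w - z) *\<^sub>C u) \<in> op_shift T z"
      for u f
      by (simp add: op_shift_iff scaleC_diff_left)
    show "0 \<le> 2 * K" using K by simp
    fix f
    define g where "g u = resolvent T z (f + (w - z) *\<^sub>C u)" for u
    have "\<exists>!u. g u = u"
    proof (rule banach_fix_type[where c = "1 / 2"])
      show "\<forall>x y. dist (g x) (g y) \<le> 1 / 2 * dist x y"
      proof (intro allI)
        fix x y
        have "g x - g y = resolvent T z ((w - z) *\<^sub>C (x - y))"
          by (simp add: g_def R.diff[symmetric] scaleC_diff_right)
        also have "norm \<dots> \<le> K * norm ((w - z) *\<^sub>C (x - y))"
          by (rule K(2)[OF resolvent_setD(1)[OF z]])
        also have "\<dots> = (K * cmod (w - z)) * norm (x - y)" by (simp add: norm_scaleC)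
        also have "\<dots> \<le> 1 / 2 * norm (x - y)" by (intro mult_right_mono small) auto
        finally show "dist (g x) (g y) \<le> 1 / 2 * dist x y" by (simp add: dist_norm)
      qed
    qed auto
    then obtain u where "g u = u" by blast
    then show "\<exists>u. (u, f) \<in> op_shift T w"
      using resolvent_setD(1)[OF z, of "f + (w - z) *\<^sub>C u"] by (auto simp: iff g_def)
  next
    have small: "K * cmod (w - z) \<le> 1 / 2" using w K(1) by (simp add: field_simps)
    fix u f assume "(u, f) \<in> op_shift T w"
    then have "(u, f + (w - z) *\<^sub>C u) \<in> op_shift T z" by (simp add: op_shift_iff scaleC_diff_left)
    then have "norm u \<le> K * norm (f + (w - z) *\<^sub>C u)" by (rule K(2))
    also have "\<dots> \<le> K * (norm f + cmod (w - z) * norm u)"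
      using K(1) norm_triangle_ineq[of f "(w - z) *\<^sub>C u"] by (simp add: norm_scaleC)
    also have "\<dots> = K * norm f + K * cmod (w - z) * norm u" by (simp add: algebra_simps)
    also have "\<dots> \<le> K * norm f + 1 / 2 * norm u"
      using mult_right_mono[OF small, of "norm u"] by simp
    finally show "norm u \<le> 2 * K * norm f" by simp
  qed
  with K(1) show ?thesis by (intro exI[of _ "1 / (2 * K)"]) auto
qed

text \<open>Density is what makes the graph single-valued: two values at the same point differ by a
  vector orthogonal to D.\<close>

lemma linear_operator_form_operator:
  assumes "csubspace D" "closure D = UNIV" "sesquilinear_on D a"
  shows "linear_operator (form_operator D a)"
  unfolding linear_operator_def
proof (intro conjI allI impI)
  show "single_valued (form_operator D a)"
  proof (rule single_valuedI)
    fix u v v' assume "(u, v) \<in> form_operator D a" "(u, v') \<in> form_operator D a"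
    then have "cinner (v - v') f = 0" if "f \<in> D" for f
      using that by (auto simp: form_operator_def cinner_diff_left)
    then have "v - v' = 0"
      by (intro orthogonal_dense_eq_0[OF assms(2)]) (simp add: Re_cinner[symmetric])
    then show "v = v'" by simp
  qed
  have "a 0 f = 0" if "f \<in> D" for f
    using sesquilinear_onD(3)[OF assms(3) that that that, of 0] by (simp add: scaleC_zero_left)
  then show "(0, 0) \<in> form_operator D a"
    using csubspaceD(1)[OF assms(1)] by (simp add: form_operator_def cinner_zero)
next
  fix u v u' v' assume "(u, v) \<in> form_operator D a" "(u', v') \<in> form_operator D a"
  then show "(u + u', v + v') \<in> form_operator D a"
    using assms by (auto simp: form_operator_def csubspaceD sesquilinear_onD cinner_add_left)
next
  fix c u v assume "(u, v) \<in> form_operator D a"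
  then show "(c *\<^sub>C u, c *\<^sub>C v) \<in> form_operator D a"
    using assms by (auto simp: form_operator_def csubspaceD sesquilinear_onD cinner_scaleC_left)
qed

text \<open>An adjoint graph is cut out by continuous equations, one for each pair of T. Form
  operators are later seen to be closed by exhibiting them as adjoints.\<close>

lemma closed_op_adjoint: "closed (op_adjoint T)"
proof -
  have cont: "continuous_on UNIV (\<lambda>x. cinner v x)" for v :: 'a
  proof -
    have "bounded_linear (cinner v)"
      by (rule bounded_linear_intro[of _ "norm v"])
        (auto simp: cinner_add_right scaleC_of_real[symmetric] cinner_scaleC_right
          scaleC_complex_def mult.commute[of _ "norm v"] cmod_cinner_le)
    then show ?thesis by (rule linear_continuous_on)
  qed
  have "op_adjoint T = (\<Inter>(u, v)\<in>T. {p. cinner v (fst p) = cinner u (snd p)})"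
    by (auto simp: op_adjoint_def)
  moreover have "closed {p :: 'a \<times> 'a. cinner v (fst p) = cinner u (snd p)}" for u v
    by (intro closed_Collect_eq continuous_on_compose2[OF cont] continuous_intros) auto
  ultimately show ?thesis by (auto intro!: closed_INT)
qed

section \<open>Sectors\<close>

text \<open>Trades angles for a linear inequality, on which coercivity and separation rest. For
  \<open>Re w > 0\<close> the argument is an arctangent; elsewhere both sides fail unless
  \<open>w = 0\<close>, the semi-angle being below pi/2.\<close>

lemma sector_arctan_iff:
  assumes "0 < L"
  shows "w \<in> sector (arctan L) \<longleftrightarrow> \<bar>Im w\<bar> \<le> L * Re w"
proof (cases "w = 0")
  case False
  show ?thesis
  proof (cases "0 < Re w")
    case True
    have b: "- (pi / 2) < Arg w" "Arg w < pi / 2"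
      using Arg_Re_pos[of w] True by (auto simp: abs_less_iff)
    have eq: "Re w = cmod w * cos (Arg w)" "Im w = cmod w * sin (Arg w)"
      by (metis Re_rcis rcis_cmod_Arg) (metis Im_rcis rcis_cmod_Arg)
    have "cos (Arg w) > 0" using b by (intro cos_gt_zero_pi) auto
    then have "tan (Arg w) = Im w / Re w" using False unfolding tan_def eq by simp
    then have A: "Arg w = arctan (Im w / Re w)" using arctan_unique b by metis
    have "\<bar>arctan x\<bar> = arctan \<bar>x\<bar>" for x by (simp add: abs_if arctan_minus)
    then have "\<bar>Arg w\<bar> = arctan (\<bar>Im w\<bar> / Re w)" using A True by (simp add: abs_divide)
    then show ?thesis using False True by (simp add: sector_def arctan_le_iff field_simps)
  next
    case nonpos: False
    have "pi / 2 \<le> \<bar>Arg w\<bar>" using Arg_Re_pos[of w] nonpos False by auto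
    then have "w \<notin> sector (arctan L)"
      using False arctan_ubound[of L] by (auto simp: sector_def)
    moreover have "\<not> \<bar>Im w\<bar> \<le> L * Re w"
    proof
      assume le: "\<bar>Im w\<bar> \<le> L * Re w"
      then have "0 \<le> Re w" using assms by (meson abs_ge_zero order_trans zero_le_mult_iff not_less)
      with nonpos have "Re w = 0" by simp
      with le False show False by (simp add: complex_eq_iff)
    qed
    ultimately show ?thesis by simp
  qed
qed (auto simp: sector_def)

text \<open>Law of cosines: modulo full turns, the directions of w and s differ by at least
  \<open>\<theta>\<^sub>0 - \<theta>\<close>.\<close>

lemma sector_distance:
  assumes s: "s \<in> sector \<theta>" and w: "w \<notin> sector \<theta>\<^sub>0"
    and \<theta>: "\<theta> < \<theta>\<^sub>0" "\<theta>\<^sub>0 < pi" "0 \<le> \<theta>"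
  shows "cmod w * sin (\<theta>\<^sub>0 - \<theta>) \<le> cmod (w - s)"
proof (cases "s = 0")
  case True
  then show ?thesis using mult_left_mono[OF sin_le_one, of "cmod w" "\<theta>\<^sub>0 - \<theta>"] by simp
next
  case False
  define \<delta> x where "\<delta> = \<theta>\<^sub>0 - \<theta>" and "x = \<bar>Arg w - Arg s\<bar>"
  have A: "\<bar>Arg s\<bar> \<le> \<theta>" "\<theta>\<^sub>0 < \<bar>Arg w\<bar>" using s w False
    by (auto simp: sector_def)
  have W: "\<bar>Arg w\<bar> \<le> pi" using Arg_bounded[of w] by (auto simp: abs_le_iff)
  have x: "\<delta> \<le> x" "x \<le> pi + \<theta>" using A W unfolding \<delta>_def x_def by linarith+
  have \<delta>: "0 < \<delta>" "\<delta> < pi" using \<theta> by (auto simp: \<delta>_def)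
  have "cos x \<le> cos \<delta>"
  proof (cases "x \<le> pi")
    case True
    then show ?thesis using x \<delta> by (intro cos_monotone_0_pi_le) auto
  next
    case False
    \<comment> \<open>On opposite sides of the real axis the arguments can differ by more than pi.
      The true angle is then \<open>2 * pi - x\<close>, at least \<open>pi - \<theta>\<close>, which
      still exceeds \<delta>.\<close>
    have "cos (2 * pi - x) \<le> cos \<delta>"
      using x \<delta> False \<theta> unfolding \<delta>_def by (intro cos_monotone_0_pi_le) auto
    then show ?thesis by simp
  qed
  moreover have "Re (w * cnj s) = cmod w * cmod s * cos x"
  proof -
    have eq: "Re y = cmod y * cos (Arg y)" "Im y = cmod y * sin (Arg y)" for y
      by (metis Re_rcis rcis_cmod_Arg) (metis Im_rcis rcis_cmod_Arg)
    have "cos x = cos (Arg w - Arg s)" by (simp add: x_def)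
    then show ?thesis
      by (simp add: eq(1)[of w] eq(2)[of w] eq(1)[of s] eq(2)[of s] cos_diff algebra_simps)
  qed
  ultimately have "Re (w * cnj s) \<le> cmod w * cmod s * cos \<delta>"
    by (simp add: mult_left_mono)
  moreover have "(cmod (w - s))\<^sup>2 = (cmod w)\<^sup>2 + (cmod s)\<^sup>2 - 2 * Re (w * cnj s)"
    unfolding cmod_power2 by (simp add: power2_eq_square algebra_simps)
  ultimately have "(cmod w)\<^sup>2 + (cmod s)\<^sup>2 - 2 * (cmod w * cmod s * cos \<delta>) \<le> (cmod (w - s))\<^sup>2"
    by simp
  \<comment> \<open>Completing the square in \<open>cmod s\<close> minimises over the radius of s
    and leaves the distance of w from a line.\<close>
  moreover have "(cmod w)\<^sup>2 + (cmod s)\<^sup>2 - 2 * (cmod w * cmod s * cos \<delta>)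
      = (cmod s - cmod w * cos \<delta>)\<^sup>2 + (cmod w * sin \<delta>)\<^sup>2"
    by (simp add: power2_diff power_mult_distrib cos_squared_eq algebra_simps)
  ultimately have "(cmod w * sin \<delta>)\<^sup>2 \<le> (cmod (w - s))\<^sup>2"
    by (smt (verit) zero_le_power2)
  then show ?thesis unfolding \<delta>_def by (rule power2_le_imp_le) simp
qed

text \<open>Multiplication by \<open>e\<close> turns a separating line through the vertex into the imaginary axis.\<close>

lemma sector_separation:
  assumes L: "0 < L" and w: "w \<notin> sector (arctan L)"
  obtains e c where "e \<noteq> 0" "0 < c" "Re (e * w) \<le> 0"
    "\<And>x. x \<in> sector (arctan L) \<Longrightarrow> c * Re x \<le> Re (e * x)"
proof (cases "Re w \<le> 0")
  case True
  \<comment> \<open>In the left half-plane the imaginary axis itself separates.\<close>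
  then show ?thesis using that[of 1 1] by simp
next
  case False
  have w': "L * Re w < \<bar>Im w\<bar>" using w by (simp add: sector_arctan_iff[OF L])
  have Im_le: "\<bar>Re w * Im x\<bar> \<le> L * Re w * Re x" if "x \<in> sector (arctan L)" for x
    using that mult_left_mono[of "\<bar>Im x\<bar>" "L * Re x" "Re w"] False
    by (simp add: sector_arctan_iff[OF L] abs_mult mult_ac)
  show ?thesis
  proof (cases "0 \<le> Im w")
    case True
    show ?thesis
    \<comment> \<open>Here e is i times the conjugate of w, so that \<open>e * w\<close> is
      imaginary: the separating line passes through w and the vertex. The constant is positive
      precisely because w violates the sector inequality.\<close>
    proof (rule that[of "Complex (Im w) (Re w)" "Im w - L * Re w"])
      fix x assume "x \<in> sector (arctan L)"
      then show "(Im w - L * Re w) * Re x \<le> Re (Complex (Im w) (Re w) * x)"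
        using Im_le[of x] by (simp add: algebra_simps abs_le_iff)
    qed (use False True w' in \<open>auto simp: complex_eq_iff\<close>)
  next
    case neg: False
    show ?thesis
    proof (rule that[of "Complex (- Im w) (- Re w)" "- Im w - L * Re w"])
      fix x assume "x \<in> sector (arctan L)"
      then show "(- Im w - L * Re w) * Re x \<le> Re (Complex (- Im w) (- Re w) * x)"
        using Im_le[of x] by (simp add: algebra_simps abs_le_iff)
    qed (use False neg w' in \<open>auto simp: complex_eq_iff\<close>)
  qed
qed

section \<open>Elliptic forms\<close>

lemma sesquilinear_on_adjoint_form:
  "sesquilinear_on D a \<Longrightarrow> sesquilinear_on D (\<lambda>u v. cnj (a v u))"
  by (auto simp: sesquilinear_on_def)

lemma sesquilinear_on_shift:
  assumes "sesquilinear_on D a"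
  shows "sesquilinear_on D (\<lambda>u v. e * (a u v - w * cinner u v))"
  using assms
  by (auto simp: sesquilinear_on_def cinner_add_left cinner_add_right cinner_scaleC_left
      cinner_scaleC_right algebra_simps)

lemma op_shift_form_operator_iff:
  "(u, f) \<in> op_shift (form_operator D a) w \<longleftrightarrow>
    u \<in> D \<and> (\<forall>v\<in>D. a u v - w * cinner u v = cinner f v)"
  by (auto simp: op_shift_iff form_operator_def cinner_add_left cinner_scaleC_left algebra_simps)

text \<open>Abstract form of the properties of \<open>l_z\<close>: \<open>s\<close> is the real
  inner product of the form domain, K bounds its embedding. Since \<open>lower\<close> has the
  constant 1, L is at once the bound of the form and the slope of the sector.\<close>

locale elliptic_form = hilbert_set D s
  for D :: "'g::complex_hilbert set" and s +
  fixes a :: "'g \<Rightarrow> 'g \<Rightarrow> complex" and \<omega> L K :: real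
  assumes csub: "csubspace D" and dense: "closure D = UNIV"
    and sesq: "sesquilinear_on D a"
    and lower: "u \<in> D \<Longrightarrow> s u u \<le> Re (a u u) + \<omega> * (norm u)\<^sup>2"
    and upper: "u \<in> D \<Longrightarrow> v \<in> D \<Longrightarrow> cmod (a u v) \<le> L * sqrt (s u u) * sqrt (s v v)"
    and embed: "u \<in> D \<Longrightarrow> norm u \<le> K * sqrt (s u u)"
    and L: "0 < L"
begin

abbreviation "T \<equiv> form_operator D a"

lemma linear: "linear_operator T"
  by (rule linear_operator_form_operator[OF csub dense sesq])

lemma upper_diag: "u \<in> D \<Longrightarrow> cmod (a u u) \<le> L * s u u"
  using upper[of u u] pos[of u] by (simp add: mult.assoc)

text \<open>The same quantity \<open>s u u\<close> bounds the imaginary part, with factor L, and is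
  bounded by the shifted real part, with factor 1; L is therefore the tangent of the
  semi-angle.\<close>

lemma form_in_sector:
  assumes "u \<in> D"
  shows "a u u + complex_of_real (\<omega> * (norm u)\<^sup>2) \<in> sector (arctan L)"
proof -
  have "\<bar>Im (a u u)\<bar> \<le> L * s u u"
    using abs_Im_le_cmod[of "a u u"] upper_diag[OF assms] by simp
  also have "\<dots> \<le> L * (Re (a u u) + \<omega> * (norm u)\<^sup>2)"
    using L lower[OF assms] by (intro mult_left_mono) auto
  finally show ?thesis by (simp add: sector_arctan_iff[OF L])
qed

lemma quotient_in_sector:
  assumes "u \<in> D" "u \<noteq> 0"
  shows "a u u / complex_of_real ((norm u)\<^sup>2) + complex_of_real \<omega> \<in> sector (arctan L)"
proof -
  define r where "r = (norm u)\<^sup>2"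
  have r: "r > 0" using assms by (simp add: r_def)
  have eq: "a u u / complex_of_real r + complex_of_real \<omega>
      = (a u u + complex_of_real (\<omega> * r)) / complex_of_real r"
    using r by (simp add: field_simps)
  show ?thesis
    using form_in_sector[OF assms(1)] r
    unfolding r_def[symmetric] eq by (simp add: sector_arctan_iff[OF L] field_simps)
qed

text \<open>\<open>lower\<close> makes a sequence that is convergent in norm and Cauchy for
  \<open>a\<close> also Cauchy for \<open>s\<close>; completeness provides a limit in D, and the
  embedding identifies it with the given one.\<close>

lemma closed: "closed_form D a"
  unfolding closed_form_def
proof (intro allI impI)
  fix u :: "nat \<Rightarrow> 'g" and x
  assume u: "range u \<subseteq> D" and ux: "u \<longlonglongrightarrow> x"
    and cau: "\<forall>e>0. \<exists>N. \<forall>m\<ge>N. \<forall>n\<ge>N. cmod (a (u m - u n) (u m - u n)) < e"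
  have uD: "u n \<in> D" for n using u by auto
  have "\<exists>y\<in>D. (\<lambda>n. s (u n - y) (u n - y)) \<longlonglongrightarrow> 0"
  proof (rule complete[OF u], intro allI impI)
    fix e :: real assume e: "e > 0"
    obtain N1 where N1: "\<forall>m\<ge>N1. \<forall>n\<ge>N1. cmod (a (u m - u n) (u m - u n)) < e / 2"
      using cau e by (meson half_gt_zero)
    \<comment> \<open>Half of e is reserved for the shift term; the summand 1 covers
      \<open>\<omega> = 0\<close>.\<close>
    define d where "d = sqrt (e / (2 * (\<bar>\<omega>\<bar> + 1)))"
    have d: "d > 0" "(\<bar>\<omega>\<bar> + 1) * d\<^sup>2 = e / 2" using e by (auto simp: d_def field_simps)
    obtain N2 where N2: "\<forall>m\<ge>N2. \<forall>n\<ge>N2. dist (u m) (u n) < d"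
      using LIMSEQ_imp_Cauchy[OF ux] d(1) unfolding Cauchy_def by blast
    have "s (u m - u n) (u m - u n) < e" if "m \<ge> max N1 N2" "n \<ge> max N1 N2" for m n
    proof -
      have "s (u m - u n) (u m - u n) \<le> Re (a (u m - u n) (u m - u n)) + \<omega> * (norm (u m - u n))\<^sup>2"
        by (rule lower[OF diff_in[OF uD uD]])
      also have "Re (a (u m - u n) (u m - u n)) < e / 2"
        using N1 that complex_Re_le_cmod[of "a (u m - u n) (u m - u n)"]
        by (meson le_less_trans max.boundedE)
      also have "\<omega> * (norm (u m - u n))\<^sup>2 \<le> (\<bar>\<omega>\<bar> + 1) * d\<^sup>2"
      proof (rule mult_mono)
        show "(norm (u m - u n))\<^sup>2 \<le> d\<^sup>2"
          using N2 that by (intro power_mono) (auto simp: dist_norm less_imp_le)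
      qed auto
      finally show ?thesis using d(2) by simp
    qed
    then show "\<exists>N. \<forall>m\<ge>N. \<forall>n\<ge>N. s (u m - u n) (u m - u n) < e" by blast
  qed
  then obtain y where y: "y \<in> D" and lim: "(\<lambda>n. s (u n - y) (u n - y)) \<longlonglongrightarrow> 0" by blast
  have "(\<lambda>n. K * sqrt (s (u n - y) (u n - y))) \<longlonglongrightarrow> 0"
    using tendsto_mult_right_zero[OF tendsto_real_sqrt[OF lim, simplified]] .
  then have "(\<lambda>n. norm (u n - y)) \<longlonglongrightarrow> 0"
    using embed[OF diff_in[OF uD y]]
    by (intro tendsto_sandwich[of "\<lambda>_. 0" "\<lambda>n. norm (u n - y)" _ "\<lambda>n. K * sqrt (s (u n - y) (u n - y))"]) auto
  then have "u \<longlonglongrightarrow> y" by (simp add: tendsto_norm_zero_iff LIM_zero_iff)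
  with ux have xy: "x = y" by (rule LIMSEQ_unique)
  have "(\<lambda>n. cmod (a (u n - y) (u n - y))) \<longlonglongrightarrow> 0"
    using tendsto_mult_right_zero[OF lim, of L] upper_diag[OF diff_in[OF uD y]]
    by (intro tendsto_sandwich[of "\<lambda>_. 0" "\<lambda>n. cmod (a (u n - y) (u n - y))" _ "\<lambda>n. L * s (u n - y) (u n - y)"]) auto
  with y xy show "x \<in> D \<and> (\<lambda>n. a (u n - x) (u n - x)) \<longlonglongrightarrow> 0"
    by (simp add: tendsto_norm_zero_iff)
qed

lemma surjective:
  assumes w: "w + complex_of_real \<omega> \<notin> sector (arctan L)"
  shows "\<exists>u. (u, f) \<in> op_shift T w"
proof -
  obtain e c where e: "e \<noteq> 0" "0 < c" "Re (e * (w + complex_of_real \<omega>)) \<le> 0"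
    "\<And>x. x \<in> sector (arctan L) \<Longrightarrow> c * Re x \<le> Re (e * x)"
    using sector_separation[OF L w] by blast
  define b where "b u v = e * (a u v - w * cinner u v)" for u v
  have b: "sesquilinear_on D b" unfolding b_def by (rule sesquilinear_on_shift[OF sesq])
  have "\<exists>u\<in>D. \<forall>v\<in>D. Re (1 * b u v) = inner (e *\<^sub>C f) v"
  proof (rule lax_milgram[where K = "cmod e * (L + cmod w * K\<^sup>2)" and c = c
        and M = "norm (e *\<^sub>C f) * K"])
    show "bilinear_on D (\<lambda>u v. Re (1 * b u v))" by (rule bilinear_on_Re[OF b csub])
  next
    fix u v assume u: "u \<in> D" and v: "v \<in> D"
    have "\<bar>Re (1 * b u v)\<bar> \<le> cmod (b u v)" using abs_Re_le_cmod by simp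
    also have "\<dots> = cmod e * cmod (a u v - w * cinner u v)" by (simp add: b_def norm_mult)
    also have "\<dots> \<le> cmod e * (L * sqrt (s u u) * sqrt (s v v)
        + cmod w * (K * sqrt (s u u) * (K * sqrt (s v v))))"
    proof (rule mult_left_mono)
      have "cmod (cinner u v) \<le> norm u * norm v" by (rule cmod_cinner_le)
      also have "\<dots> \<le> K * sqrt (s u u) * (K * sqrt (s v v))"
        using embed[OF u] embed[OF v] norm_ge_zero[of u] order_trans[OF norm_ge_zero embed[OF u]]
        by (intro mult_mono) auto
      finally have "cmod (w * cinner u v) \<le> cmod w * (K * sqrt (s u u) * (K * sqrt (s v v)))"
        by (simp add: norm_mult mult_left_mono)
      with upper[OF u v] norm_triangle_ineq4[of "a u v" "w * cinner u v"]
      show "cmod (a u v - w * cinner u v) \<le> L * sqrt (s u u) * sqrt (s v v)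
        + cmod w * (K * sqrt (s u u) * (K * sqrt (s v v)))" by linarith
    qed simp
    also have "\<dots> = cmod e * (L + cmod w * K\<^sup>2) * sqrt (s u u) * sqrt (s v v)"
      by (simp add: algebra_simps power2_eq_square)
    finally show "\<bar>Re (1 * b u v)\<bar> \<le> cmod e * (L + cmod w * K\<^sup>2) * sqrt (s u u) * sqrt (s v v)" .
  next
    fix u assume u: "u \<in> D"
    define x where "x = a u u + complex_of_real (\<omega> * (norm u)\<^sup>2)"
    have "c * s u u \<le> c * Re x" using e(2) lower[OF u] by (simp add: x_def)
    also have "\<dots> \<le> Re (e * x)" unfolding x_def by (rule e(4)[OF form_in_sector[OF u]])
    \<comment> \<open>The point \<open>w + \<omega>\<close> lies on the other side of the line, so
      subtracting it does not spoil coercivity.\<close>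
    also have "\<dots> \<le> Re (e * x) - Re (e * (w + complex_of_real \<omega>)) * (norm u)\<^sup>2"
      using e(3) by (simp add: mult_nonpos_nonneg)
    also have "\<dots> = Re (1 * b u u)"
      by (simp add: b_def x_def cinner_self algebra_simps)
    finally show "c * s u u \<le> Re (1 * b u u)" .
  next
    fix v assume v: "v \<in> D"
    have "\<bar>inner (e *\<^sub>C f) v\<bar> \<le> norm (e *\<^sub>C f) * norm v" by (rule Cauchy_Schwarz_ineq2)
    also have "\<dots> \<le> norm (e *\<^sub>C f) * (K * sqrt (s v v))"
      using embed[OF v] by (intro mult_left_mono) auto
    finally show "\<bar>inner (e *\<^sub>C f) v\<bar> \<le> norm (e *\<^sub>C f) * K * sqrt (s v v)"
      by (simp add: mult.assoc)
  qed (auto simp: e(2) inner_add_right)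
  then obtain u where u: "u \<in> D" "\<And>v. v \<in> D \<Longrightarrow> Re (b u v) = inner (e *\<^sub>C f) v" by auto
  \<comment> \<open>The real solution solves the complex equation, from which the rotation e
    cancels.\<close>
  have "b u v = cinner (e *\<^sub>C f) v" if "v \<in> D" for v
    by (rule cinner_eqI[OF csub b u(1) that u(2)])
  with u(1) e(1) have "(u, f) \<in> op_shift T w"
    by (simp add: op_shift_form_operator_iff b_def cinner_scaleC_left)
  then show ?thesis by blast
qed

text \<open>Pairing the equation with u gives \<open>cmod (cinner f u)\<close> as the squared norm
  of u times the distance of \<open>w + \<omega>\<close> from a point of the sector.\<close>

lemma shift_lower_bound:
  assumes \<delta>: "\<And>x. x \<in> sector (arctan L) \<Longrightarrow> \<delta> \<le> cmod (w + complex_of_real \<omega> - x)"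
    and u: "(u, f) \<in> op_shift T w"
  shows "\<delta> * norm u \<le> norm f"
proof (cases "u = 0")
  case False
  define r where "r = complex_of_real ((norm u)\<^sup>2)"
  have r: "r \<noteq> 0" using False by (simp add: r_def)
  have uD: "u \<in> D" and eq: "a u u - w * cinner u u = cinner f u"
    using u by (auto simp: op_shift_form_operator_iff)
  have "\<delta> * (norm u * norm u) \<le> cmod (w + complex_of_real \<omega> - (a u u / r + complex_of_real \<omega>)) * cmod r"
    using mult_right_mono[OF \<delta>[OF quotient_in_sector[OF uD False]], of "cmod r"]
    by (simp add: r_def power2_eq_square norm_mult)
  also have "\<dots> = cmod ((w + complex_of_real \<omega> - (a u u / r + complex_of_real \<omega>)) * r)"
    by (simp add: norm_mult)
  also have "\<dots> = cmod (cinner f u)"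
  proof -
    have "(w + complex_of_real \<omega> - (a u u / r + complex_of_real \<omega>)) * r = - cinner f u"
    proof -
      have "(w + complex_of_real \<omega> - (a u u / r + complex_of_real \<omega>)) * r = w * r - a u u"
        using r by (simp add: left_diff_distrib)
      also have "\<dots> = - cinner f u" using eq unfolding cinner_self r_def[symmetric] by (metis minus_diff_eq)
      finally show ?thesis .
    qed
    then show ?thesis by simp
  qed
  also have "\<dots> \<le> norm f * norm u" by (rule cmod_cinner_le)
  finally show ?thesis using False by (simp add: mult.assoc[symmetric])
qed simp

lemma resolvent_bound:
  assumes w: "w + complex_of_real \<omega> \<notin> sector (arctan L)" and \<delta>: "0 < \<delta>"
    and dist: "\<And>x. x \<in> sector (arctan L) \<Longrightarrow> \<delta> \<le> cmod (w + complex_of_real \<omega> - x)"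
  shows "w \<in> resolvent_set T" "onorm (resolvent T w) \<le> 1 / \<delta>"
proof -
  have "norm u \<le> 1 / \<delta> * norm f" if "(u, f) \<in> op_shift T w" for u f
    using shift_lower_bound[OF dist that] \<delta> by (simp add: field_simps)
  with \<delta> surjective[OF w] show "w \<in> resolvent_set T" "onorm (resolvent T w) \<le> 1 / \<delta>"
    by (intro resolvent_setI[OF linear, of "1 / \<delta>"]; simp)+
qed

lemma resolvent_outside_sector:
  assumes \<theta>\<^sub>0: "arctan L < \<theta>\<^sub>0" "\<theta>\<^sub>0 < pi" and w: "w + complex_of_real \<omega> \<notin> sector \<theta>\<^sub>0"
  shows "w \<in> resolvent_set T"
    "onorm (resolvent T w) \<le> 1 / (cmod (w + complex_of_real \<omega>) * sin (\<theta>\<^sub>0 - arctan L))"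
proof -
  have pos: "0 < cmod (w + complex_of_real \<omega>) * sin (\<theta>\<^sub>0 - arctan L)"
  proof (intro mult_pos_pos sin_gt_zero)
    have "0 < arctan L" using L by simp
    with \<theta>\<^sub>0 show "\<theta>\<^sub>0 - arctan L < pi" by linarith
  qed (use w \<theta>\<^sub>0 in \<open>auto simp: sector_def\<close>)
  have "w + complex_of_real \<omega> \<notin> sector (arctan L)" using w \<theta>\<^sub>0
    by (auto simp: sector_def)
  note res = resolvent_bound[OF this pos sector_distance[OF _ w \<theta>\<^sub>0]]
  show "w \<in> resolvent_set T" using L by (intro res(1)) auto
  show "onorm (resolvent T w) \<le> 1 / (cmod (w + complex_of_real \<omega>) * sin (\<theta>\<^sub>0 - arctan L))"
    using L by (intro res(2)) auto
qed

lemma spectrum: "op_spectrum T \<subseteq> (\<lambda>x. x - complex_of_real \<omega>) ` sector (arctan L)"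
proof
  fix w assume w: "w \<in> op_spectrum T"
  have "w + complex_of_real \<omega> \<in> sector (arctan L)"
  proof (rule ccontr)
    assume n: "w + complex_of_real \<omega> \<notin> sector (arctan L)"
    \<comment> \<open>Halfway between the semi-angle and the argument of
      \<open>w + \<omega>\<close>: w then lies outside a strictly larger sector, as the resolvent
      estimate requires.\<close>
    define \<theta> \<alpha> \<theta>\<^sub>0 where "\<theta> = arctan L" and "\<alpha> = \<bar>Arg (w + complex_of_real \<omega>)\<bar>"
      and "\<theta>\<^sub>0 = (\<theta> + \<alpha>) / 2"
    have w0: "w + complex_of_real \<omega> \<noteq> 0" and \<alpha>: "\<theta> < \<alpha>"
      using n by (auto simp: sector_def \<theta>_def \<alpha>_def)
    have "\<alpha> \<le> pi"
      using Arg_bounded[of "w + complex_of_real \<omega>"] by (auto simp: abs_le_iff \<alpha>_def)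
    with \<alpha> have "\<theta> < \<theta>\<^sub>0" "\<theta>\<^sub>0 < pi" "\<theta>\<^sub>0 < \<alpha>"
      unfolding \<theta>\<^sub>0_def by (simp_all add: field_simps)
    with w0 have "w \<in> resolvent_set T"
      by (intro resolvent_outside_sector(1)[of \<theta>\<^sub>0]) (auto simp: sector_def \<theta>_def \<alpha>_def)
    with w show False by (simp add: op_spectrum_def)
  qed
  then show "w \<in> (\<lambda>x. x - complex_of_real \<omega>) ` sector (arctan L)" by (force intro!: image_eqI)
qed

lemma sectorial: "m_sectorial (- \<omega>) (arctan L) T"
  unfolding m_sectorial_def
proof (intro conjI)
  show "0 \<le> arctan L" using L by simp
  show "arctan L < pi / 2" by (rule arctan_ubound)
  show "numerical_range T \<subseteq> (\<lambda>x. x + complex_of_real (- \<omega>)) ` sector (arctan L)"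
  proof
    fix y assume "y \<in> numerical_range T"
    then obtain u v where uv: "(u, v) \<in> T" "norm u = 1" "y = cinner v u"
      by (auto simp: numerical_range_def)
    then have "u \<in> D" "y = a u u" by (auto simp: form_operator_def)
    with form_in_sector[of u] uv(2) have "y + complex_of_real \<omega> \<in> sector (arctan L)" by simp
    then show "y \<in> (\<lambda>x. x + complex_of_real (- \<omega>)) ` sector (arctan L)"
      by (force intro!: image_eqI)
  qed
  \<comment> \<open>Adding \<omega> moves the vertex to 0. The sector then lies in the right
    half-plane, at distance at least \<open>Re \<mu>\<close> from \<open>- \<mu>\<close>.\<close>
  have "m_accretive (op_shift T (- complex_of_real \<omega>))"
    unfolding m_accretive_def
  proof (intro conjI allI impI)
    show "linear_operator (op_shift T (- complex_of_real \<omega>))"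
      by (rule linear_operator_op_shift[OF linear])
    fix \<mu> :: complex assume \<mu>: "0 < Re \<mu>"
    have "- \<mu> \<notin> sector (arctan L)"
    proof
      assume "- \<mu> \<in> sector (arctan L)"
      then have "0 \<le> L * Re (- \<mu>)"
        unfolding sector_arctan_iff[OF L] by (rule order_trans[OF abs_ge_zero])
      then show False using \<mu> L by (simp add: mult_le_0_iff)
    qed
    moreover have "Re \<mu> \<le> cmod (- \<mu> - x)" if "x \<in> sector (arctan L)" for x
    proof -
      have "0 \<le> L * Re x" 
        using that unfolding sector_arctan_iff[OF L] by (rule order_trans[OF abs_ge_zero])
      then have "0 \<le> Re x" using L by (simp add: zero_le_mult_iff)
      then show ?thesis using complex_Re_le_cmod[of "\<mu> + x"] by (simp add: norm_minus_commute add.commute)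
    qed
    ultimately show "- \<mu> \<in> resolvent_set (op_shift T (- complex_of_real \<omega>))"
      "onorm (resolvent (op_shift T (- complex_of_real \<omega>)) (- \<mu>)) \<le> 1 / Re \<mu>"
      using resolvent_bound[of "- complex_of_real \<omega> - \<mu>" "Re \<mu>"] \<mu>
      by (simp_all add: resolvent_set_op_shift resolvent_op_shift)
  qed
  then show "\<exists>\<alpha>. m_accretive (op_shift T (- complex_of_real \<alpha>))" by blast
qed

text \<open>A point to the left of the vertex that serves the form and its adjoint alike; being
  real, it equals its conjugate.\<close>

lemma surjective_left: "\<exists>u. (u, f) \<in> op_shift T (complex_of_real (- \<omega> - 1))"
  by (rule surjective) (simp add: sector_arctan_iff[OF L] not_le L)

lemma densely_defined: "densely_defined T"
  unfolding densely_defined_def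
proof (rule dense_subspace_if_orthogonal_trivial)
  note lin = linear_operatorD[OF linear]
  show "subspace (Domain T)"
  proof (rule subspaceI)
    show "0 \<in> Domain T" using lin(2) by blast
    show "x + y \<in> Domain T" if "x \<in> Domain T" "y \<in> Domain T" for x y
      using that lin(3) by (metis DomainE DomainI)
    show "r *\<^sub>R x \<in> Domain T" if "x \<in> Domain T" for r x
      using that lin(4)[of x _ "complex_of_real r"] by (metis DomainE DomainI scaleC_of_real)
  qed
  fix g assume g: "\<forall>f\<in>Domain T. inner g f = 0"
  \<comment> \<open>The solution lies in the domain, so g is orthogonal to it. Coercivity of
    \<open>T + \<omega> + 1\<close> then forces \<open>u = 0\<close> and with it
    \<open>g = 0\<close>.\<close>
  obtain u where u: "(u, g) \<in> op_shift T (complex_of_real (- \<omega> - 1))" using surjective_left by blast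
  then have uD: "u \<in> D" and eq: "a u u - complex_of_real (- \<omega> - 1) * cinner u u = cinner g u"
    by (auto simp: op_shift_form_operator_iff)
  have "inner g u = 0" using u g by (auto simp: op_shift_iff)
  then have "Re (a u u) + \<omega> * (norm u)\<^sup>2 + (norm u)\<^sup>2 = 0"
    using arg_cong[OF eq, of Re] by (simp add: cinner_self Re_cinner algebra_simps power2_norm_eq_inner)
  then have "(norm u)\<^sup>2 = 0" using lower[OF uD] pos[OF uD] zero_le_power2[of "norm u"] by linarith
  then have "u = 0" by simp
  with u have "(0, g) \<in> T" by (simp add: op_shift_iff scaleC_zero_right)
  with lin(1,2) show "g = 0" by (auto dest: single_valuedD)
qed

text \<open>The hypotheses are invariant under exchanging arguments and conjugating, so all results
  on the operator hold for the adjoint form as well.\<close>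

lemma adjoint_form: "elliptic_form D s (\<lambda>u v. cnj (a v u)) \<omega> L K"
proof unfold_locales
  fix u v assume "u \<in> D" "v \<in> D"
  then show "cmod (cnj (a v u)) \<le> L * sqrt (s u u) * sqrt (s v v)"
    using upper[of v u] by (simp add: mult_ac)
qed (use csub dense sesq lower embed L in \<open>auto simp: sesquilinear_on_adjoint_form\<close>)

text \<open>One inclusion is the symmetry of the two forms. The other is maximality: both shifted
  operators are onto, so the adjoint has no room for a proper extension.\<close>

lemma op_adjoint: "op_adjoint T = form_operator D (\<lambda>u v. cnj (a v u))"
proof -
  interpret adj: elliptic_form D s "\<lambda>u v. cnj (a v u)" \<omega> L K by (rule adjoint_form)
  define w where "w = complex_of_real (- \<omega> - 1)"
  have cw: "cnj w = w" by (simp add: w_def)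
  have sym: "cinner v x = cinner u y" if "(u, v) \<in> T" "(x, y) \<in> adj.T" for u v x y
  proof -
    have "cinner v x = a u x" using that by (auto simp: form_operator_def)
    moreover have "cnj (a u x) = cinner y u" using that by (auto simp: form_operator_def)
    ultimately show ?thesis by (metis cinner_commute complex_cnj_cnj)
  qed
  have "(x, y) \<in> adj.T" if xy: "(x, y) \<in> op_adjoint T" for x y
  proof -
    \<comment> \<open>\<open>x'\<close> has the image under the shifted operator of the adjoint form
      that x should have. The u below has the image \<open>x - x'\<close>, so pairing with it tests
      \<open>x - x'\<close> against itself.\<close>
    obtain x' where x': "(x', y - w *\<^sub>C x) \<in> op_shift adj.T w"
      using adj.surjective_left unfolding w_def by blast
    obtain u where u: "(u, x - x') \<in> op_shift T w"
      using surjective_left unfolding w_def by blast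
    have "cinner (x - x' + w *\<^sub>C u) x = cinner u y"
      using xy u by (auto simp: op_adjoint_def op_shift_iff)
    moreover have "cinner (x - x' + w *\<^sub>C u) x' = cinner u (y - w *\<^sub>C x + w *\<^sub>C x')"
      using sym u x' by (auto simp: op_shift_iff)
    ultimately have "cinner (x - x' + w *\<^sub>C u) x - cinner (x - x' + w *\<^sub>C u) x'
        = cinner u y - cinner u (y - w *\<^sub>C x + w *\<^sub>C x')" by simp
    then have "cinner (x - x') (x - x') = 0"
      by (simp add: cinner_add_left cinner_add_right cinner_diff_left cinner_diff_right
          cinner_scaleC_left cinner_scaleC_right cw) (simp add: algebra_simps)
    then have "x = x'" by (simp add: cinner_self)
    with x' show ?thesis by (simp add: op_shift_iff)
  qed
  moreover have "(x, y) \<in> op_adjoint T" if "(x, y) \<in> adj.T" for x y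
    unfolding op_adjoint_def using sym that by blast
  ultimately show ?thesis by (simp add: set_eq_iff split_paired_all) blast
qed

lemma closed_operator: "Topological_Spaces.closed T"
proof -
  interpret adj: elliptic_form D s "\<lambda>u v. cnj (a v u)" \<omega> L K by (rule adjoint_form)
  have "T = op_adjoint adj.T" by (simp add: adj.op_adjoint)
  then show ?thesis by (metis closed_op_adjoint)
qed

end

section \<open>Boundary pairs\<close>

lemma sesquilinear_on_subset: "sesquilinear_on D a \<Longrightarrow> E \<subseteq> D \<Longrightarrow> sesquilinear_on E a"
  unfolding sesquilinear_on_def by blast

text \<open>The test space E may be smaller than the space of u, as for weak solutions tested
  against the kernel of \<Gamma>.\<close>

lemma sesquilinear_eq_0_if_Re:
  assumes "csubspace E" "E \<subseteq> D" "sesquilinear_on D a" "u \<in> D"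
    and Re: "\<And>f. f \<in> E \<Longrightarrow> Re (a u f) = 0" and f: "f \<in> E"
  shows "a u f = 0"
proof (rule complex_eqI)
  have "Re (a u (\<i> *\<^sub>C f)) = 0" using assms by (intro Re csubspaceD)
  then show "Im (a u f) = Im 0"
    using assms by (simp add: sesquilinear_onD(4)[OF assms(3) subsetD[OF assms(2)]])
qed (use Re f in simp)

text \<open>A real supremum says something only once the quotients are known to be bounded; any
  constant K, of either sign, supplies this.\<close>

lemma onorm_on_bounds:
  assumes p: "\<And>u. u \<in> D \<Longrightarrow> 0 \<le> p u" and q: "\<And>u. u \<in> D \<Longrightarrow> 0 \<le> q (T u)" and ne: "D \<noteq> {}"
    and bound: "\<And>u. u \<in> D \<Longrightarrow> q (T u) \<le> K * p u"
  shows "0 \<le> onorm_on D p q T" "u \<in> D \<Longrightarrow> q (T u) \<le> onorm_on D p q T * p u"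
proof -
  have bdd: "bdd_above ((\<lambda>u. q (T u) / p u) ` D)"
  proof (rule bdd_aboveI2)
    fix u assume u: "u \<in> D"
    show "q (T u) / p u \<le> \<bar>K\<bar>"
    proof (cases "p u = 0")
      case False
      then have "0 < p u" using p[OF u] by simp
      moreover have "q (T u) \<le> \<bar>K\<bar> * p u"
        using bound[OF u] mult_right_mono[OF abs_ge_self p[OF u], of K] by linarith
      ultimately show ?thesis by (simp add: pos_divide_le_eq)
    qed simp
  qed
  have upper: "q (T u) / p u \<le> onorm_on D p q T" if "u \<in> D" for u
    unfolding onorm_on_def by (rule cSUP_upper[OF that bdd])
  obtain v where v: "v \<in> D" using ne by blast
  have "0 \<le> q (T v) / p v" using p q v by simp
  then show "0 \<le> onorm_on D p q T" using upper[OF v] by linarith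
  assume u: "u \<in> D"
  show "q (T u) \<le> onorm_on D p q T * p u"
  proof (cases "p u = 0")
    case True
    then show ?thesis using bound[OF u] by simp
  next
    case False
    then have "0 < p u" using p[OF u] by simp
    then show ?thesis using upper[OF u] by (simp add: field_simps)
  qed
qed

locale bdry_pair =
  fixes H1 :: "'h::complex_hilbert set"
    and h :: "'h \<Rightarrow> 'h \<Rightarrow> complex"
    and \<Gamma> :: "'h \<Rightarrow> 'g::complex_hilbert"
  assumes is_boundary_pair: "boundary_pair H1 h \<Gamma>"
begin

abbreviation "HD \<equiv> H1D H1 \<Gamma>"
abbreviation "G \<equiv> G_half H1 \<Gamma>"
abbreviation "N \<equiv> N1 H1 h \<Gamma>"
abbreviation "S \<equiv> sol_op H1 h \<Gamma>"
abbreviation "A \<equiv> dirichlet_operator H1 h \<Gamma>"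
abbreviation "\<rho> \<equiv> resolvent_set A"
abbreviation "nrm \<equiv> form_norm h"
abbreviation "nrmG \<equiv> norm_half H1 h \<Gamma>"
abbreviation "\<l> \<equiv> dn_form H1 h \<Gamma>"

text \<open>The inner product of the Hilbert space \<open>H1\<close>; its real part
  \<open>s1\<close> is what \<open>hilbert_set\<close> works with.\<close>

definition h1 :: "'h \<Rightarrow> 'h \<Rightarrow> complex" where "h1 u v = h u v + cinner u v"
definition s1 :: "'h \<Rightarrow> 'h \<Rightarrow> real" where "s1 u v = Re (h1 u v)"

lemma csub: "csubspace H1"
  and sesq: "sesquilinear_on H1 h"
  and real: "u \<in> H1 \<Longrightarrow> h u u \<in> \<real>"
  and nonneg: "u \<in> H1 \<Longrightarrow> 0 \<le> Re (h u u)"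
  and closed: "closed_form H1 h"
  and \<Gamma>_lin: "clinear_on H1 \<Gamma>"
  and dense_HD: "closure HD = UNIV"
  and dense_G: "closure G = UNIV"
  using is_boundary_pair by (auto simp: boundary_pair_def closed_nonneg_form_def)

lemma \<Gamma>_add: "u \<in> H1 \<Longrightarrow> v \<in> H1 \<Longrightarrow> \<Gamma> (u + v) = \<Gamma> u + \<Gamma> v"
  and \<Gamma>_scaleC: "u \<in> H1 \<Longrightarrow> \<Gamma> (c *\<^sub>C u) = c *\<^sub>C \<Gamma> u"
  using \<Gamma>_lin by (auto simp: clinear_on_def)

lemma \<Gamma>_diff: "u \<in> H1 \<Longrightarrow> v \<in> H1 \<Longrightarrow> \<Gamma> (u - v) = \<Gamma> u - \<Gamma> v"
  using \<Gamma>_add[of u "(- 1) *\<^sub>C v"] csubspaceD(3)[OF csub, of v "- 1"] \<Gamma>_scaleC[of v "- 1"]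
  by (simp add: scaleC_minus_one)

lemma HD_iff: "u \<in> HD \<longleftrightarrow> u \<in> H1 \<and> \<Gamma> u = 0"
  by (simp add: H1D_def)

lemma HD_subset: "HD \<subseteq> H1"
  by (auto simp: HD_iff)

lemma csub_HD: "csubspace HD"
  using csubspaceD[OF csub] \<Gamma>_scaleC[of 0 0]
  by (auto simp: csubspace_def HD_iff \<Gamma>_add \<Gamma>_scaleC scaleC_zero_right scaleC_zero_left)

lemma csub_G: "csubspace G"
proof -
  have "0 \<in> G" using csubspaceD(1)[OF csub_HD] by (force simp: G_half_def HD_iff)
  moreover have "u + v \<in> G" if "u \<in> G" "v \<in> G" for u v
    using that csubspaceD(2)[OF csub] by (auto simp: G_half_def \<Gamma>_add[symmetric])
  moreover have "c *\<^sub>C u \<in> G" if "u \<in> G" for c u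
    using that csubspaceD(3)[OF csub] by (auto simp: G_half_def \<Gamma>_scaleC[symmetric])
  ultimately show ?thesis by (simp add: csubspace_def)
qed

lemma sesq_h1: "sesquilinear_on H1 h1"
  using sesq sesquilinear_on_cinner[of H1]
  unfolding h1_def sesquilinear_on_def by (simp add: algebra_simps)

lemma herm: "u \<in> H1 \<Longrightarrow> v \<in> H1 \<Longrightarrow> h u v = cnj (h v u)"
  by (rule hermitian_if_real[OF csub sesq real])

lemma h1_herm: "u \<in> H1 \<Longrightarrow> v \<in> H1 \<Longrightarrow> h1 u v = cnj (h1 v u)"
  using herm[of u v] cinner_commute[of u v] by (simp add: h1_def)

lemma h_diag: "u \<in> H1 \<Longrightarrow> h u u = complex_of_real (Re (h u u))"
  using real[of u] by (simp add: complex_is_Real_iff complex_eq_iff)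

lemma s1_diag: "s1 u u = Re (h u u) + (norm u)\<^sup>2"
  by (simp add: s1_def h1_def cinner_self)

lemma nrm_eq: "nrm u = sqrt (s1 u u)"
  by (simp add: form_norm_def s1_diag)

lemma nrm_nonneg: "u \<in> H1 \<Longrightarrow> 0 \<le> nrm u"
  using nonneg by (simp add: form_norm_def)

lemma nrm_square: "u \<in> H1 \<Longrightarrow> (nrm u)\<^sup>2 = Re (h u u) + (norm u)\<^sup>2"
  using nonneg by (simp add: form_norm_def)

lemma norm_le_nrm: "u \<in> H1 \<Longrightarrow> norm u \<le> nrm u"
  using nonneg by (auto simp: form_norm_def intro!: real_le_rsqrt)

lemma \<Gamma>_bound: "\<exists>K. \<forall>u\<in>H1. norm (\<Gamma> u) \<le> K * nrm u"
  using is_boundary_pair by (auto simp: boundary_pair_def)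

lemma norm_\<Gamma>_bound: "u \<in> H1 \<Longrightarrow> norm (\<Gamma> u) \<le> norm_\<Gamma> H1 h \<Gamma> * nrm u"
proof -
  obtain K where "\<forall>u\<in>H1. norm (\<Gamma> u) \<le> K * nrm u" using \<Gamma>_bound by blast
  then show "u \<in> H1 \<Longrightarrow> norm (\<Gamma> u) \<le> norm_\<Gamma> H1 h \<Gamma> * nrm u"
    unfolding norm_\<Gamma>_def using csubspaceD(1)[OF csub]
    by (intro onorm_on_bounds(2)[of H1 nrm norm \<Gamma> K]; force simp: nrm_nonneg)
qed

text \<open>\<open>s1\<close> dominates both the squared norm and the form. A Cauchy sequence
  therefore converges in the surrounding space first, and closedness of the form places the limit in
  the domain.\<close>

sublocale H1: hilbert_set H1 s1
proof
  show sub: "subspace H1" by (rule subspace_csubspace[OF csub])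
  show "bilinear_on H1 s1" using bilinear_on_Re[OF sesq_h1 csub, of 1] by (simp add: s1_def[abs_def])
  show "s1 u v = s1 v u" if "u \<in> H1" "v \<in> H1" for u v
    using h1_herm[OF that] by (simp add: s1_def)
  show "0 \<le> s1 u u" if "u \<in> H1" for u using nonneg[OF that] by (simp add: s1_diag)
  fix u :: "nat \<Rightarrow> 'h"
  assume u: "range u \<subseteq> H1" and cau: "\<forall>e>0. \<exists>N. \<forall>m\<ge>N. \<forall>n\<ge>N. s1 (u m - u n) (u m - u n) < e"
  have uD: "u n \<in> H1" for n using u by auto
  have d: "u m - u n \<in> H1" for m n using subspace_diff[OF sub uD uD] .
  have "Cauchy u" unfolding Cauchy_def
  proof (intro allI impI)
    fix e :: real assume e: "e > 0"
    then obtain N where N: "\<forall>m\<ge>N. \<forall>n\<ge>N. s1 (u m - u n) (u m - u n) < e\<^sup>2"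
      using cau by (meson zero_less_power)
    have "dist (u m) (u n) < e" if "m \<ge> N" "n \<ge> N" for m n
    proof -
      have "(norm (u m - u n))\<^sup>2 \<le> s1 (u m - u n) (u m - u n)" using nonneg[OF d] by (simp add: s1_diag)
      then have "(norm (u m - u n))\<^sup>2 < e\<^sup>2" using N that by (meson le_less_trans)
      then show ?thesis using e unfolding dist_norm by (intro power2_less_imp_less[of _ e]) auto
    qed
    then show "\<exists>N. \<forall>m\<ge>N. \<forall>n\<ge>N. dist (u m) (u n) < e" by blast
  qed
  then obtain x where x: "u \<longlonglongrightarrow> x" by (auto simp: Cauchy_convergent_iff convergent_def)
  have le: "cmod (h (u m - u n) (u m - u n)) \<le> s1 (u m - u n) (u m - u n)" for m n
    by (subst h_diag[OF d]) (use nonneg[OF d] in \<open>simp add: s1_diag\<close>)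
  have "\<forall>e>0. \<exists>N. \<forall>m\<ge>N. \<forall>n\<ge>N. cmod (h (u m - u n) (u m - u n)) < e"
    using cau le by (meson le_less_trans)
  with closed u x have xH: "x \<in> H1" and lim: "(\<lambda>n. h (u n - x) (u n - x)) \<longlonglongrightarrow> 0"
    unfolding closed_form_def by blast+
  have "(\<lambda>n. Re (h (u n - x) (u n - x)) + (norm (u n - x))\<^sup>2) \<longlonglongrightarrow> Re 0 + (norm (x - x))\<^sup>2"
    by (intro tendsto_intros lim x)
  then have "(\<lambda>n. s1 (u n - x) (u n - x)) \<longlonglongrightarrow> 0" by (simp add: s1_diag)
  with xH show "\<exists>x\<in>H1. (\<lambda>n. s1 (u n - x) (u n - x)) \<longlonglongrightarrow> 0" by blast
qed

lemma \<Gamma>_eq_limit: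
  assumes u: "\<And>n. u n \<in> H1" "x \<in> H1" "(\<lambda>n. s1 (u n - x) (u n - x)) \<longlonglongrightarrow> 0"
  shows "(\<lambda>n. \<Gamma> (u n)) \<longlonglongrightarrow> \<Gamma> x"
proof -
  obtain K where K: "\<forall>u\<in>H1. norm (\<Gamma> u) \<le> K * nrm u" using \<Gamma>_bound by blast
  have "(\<lambda>n. K * nrm (u n - x)) \<longlonglongrightarrow> 0"
    using tendsto_mult_right_zero[OF tendsto_real_sqrt[OF u(3), simplified]] unfolding nrm_eq .
  moreover have "norm (\<Gamma> (u n) - \<Gamma> x) \<le> K * nrm (u n - x)" for n
    using K H1.diff_in[OF u(1,2)] \<Gamma>_diff[OF u(1,2)] by metis
  ultimately have "(\<lambda>n. norm (\<Gamma> (u n) - \<Gamma> x)) \<longlonglongrightarrow> 0"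
    by (intro tendsto_sandwich[of "\<lambda>_. 0" "\<lambda>n. norm (\<Gamma> (u n) - \<Gamma> x)" _ "\<lambda>n. K * nrm (u n - x)"]) auto
  then show ?thesis by (simp add: tendsto_norm_zero_iff LIM_zero_iff)
qed

sublocale HD: hilbert_set HD s1
proof
  show "subspace HD" by (rule subspace_csubspace[OF csub_HD])
  show "bilinear_on HD s1" using H1.bil HD_subset unfolding bilinear_on_def by blast
  show "s1 u v = s1 v u" if "u \<in> HD" "v \<in> HD" for u v using that HD_subset H1.sym by blast
  show "0 \<le> s1 u u" if "u \<in> HD" for u using that HD_subset H1.pos by blast
  fix u :: "nat \<Rightarrow> 'h"
  assume u: "range u \<subseteq> HD" and cau: "\<forall>e>0. \<exists>N. \<forall>m\<ge>N. \<forall>n\<ge>N. s1 (u m - u n) (u m - u n) < e"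
  obtain x where x: "x \<in> H1" "(\<lambda>n. s1 (u n - x) (u n - x)) \<longlonglongrightarrow> 0"
    using H1.complete[OF _ cau] u HD_subset by blast
  have "\<Gamma> (u n) = 0" "u n \<in> H1" for n using u HD_iff[of "u n"] by auto
  with \<Gamma>_eq_limit[of u x] x have "\<Gamma> x = 0" by (simp add: LIMSEQ_const_iff)
  with x show "\<exists>x\<in>HD. (\<lambda>n. s1 (u n - x) (u n - x)) \<longlonglongrightarrow> 0"
    by (auto simp: HD_iff)
qed

section \<open>Weak solutions and the solution operator\<close>

text \<open>Orthogonal projection onto the kernel of \<Gamma> in \<open>H1\<close>: orthogonality of
  the remainder is the equation at \<open>z = - 1\<close>. Solutions for other z are obtained from
  this one by \<open>N_shift\<close>.\<close>

lemma harmonic_part: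
  assumes u: "u \<in> H1"
  shows "\<exists>d\<in>HD. u - d \<in> N (- 1)"
proof -
  have "\<exists>d\<in>HD. \<forall>f\<in>HD. s1 d f = s1 u f"
  proof (rule HD.riesz)
    fix f assume "f \<in> HD"
    then show "\<bar>s1 u f\<bar> \<le> sqrt (s1 u u) * sqrt (s1 f f)"
      using u HD_subset by (intro H1.cauchy_schwarz) auto
  qed (use u HD_subset in \<open>auto simp: H1.s_add H1.s_scale subset_iff\<close>)
  then obtain d where d: "d \<in> HD" "\<And>f. f \<in> HD \<Longrightarrow> s1 d f = s1 u f" by blast
  have dH: "d \<in> H1" and udH: "u - d \<in> H1" using d HD_subset u H1.diff_in by auto
  have "h1 (u - d) f = 0" if f: "f \<in> HD" for f
  proof (rule sesquilinear_eq_0_if_Re[OF csub_HD HD_subset sesq_h1 udH _ f])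
    fix f assume f: "f \<in> HD"
    then show "Re (h1 (u - d) f) = 0"
      using H1.s_diff(1)[OF u dH, of f] d(2)[OF f] HD_subset by (auto simp: s1_def)
  qed
  then have "h (u - d) f = - 1 * cinner (u - d) f" if "f \<in> HD" for f
    using that by (simp add: h1_def eq_neg_iff_add_eq_0)
  with udH d(1) show ?thesis by (auto simp: N1_def)
qed

lemma linear_A: "linear_operator A"
  unfolding dirichlet_operator_def
  by (rule linear_operator_form_operator[OF csub_HD dense_HD sesquilinear_on_subset[OF sesq HD_subset]])

lemma A_shift_iff:
  "(u, f) \<in> op_shift A z \<longleftrightarrow> u \<in> HD \<and> (\<forall>v\<in>HD. h u v - z * cinner u v = cinner f v)"
  unfolding dirichlet_operator_def by (rule op_shift_form_operator_iff)

text \<open>At -1 the resolvent equation is a Riesz representation in the kernel of \<Gamma> with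
  the inner product of \<open>H1\<close>.\<close>

lemma minus_one_in_resolvent_set: "- 1 \<in> \<rho>"
proof -
  have surj: "\<exists>u. (u, f) \<in> op_shift A (- 1)" for f
  proof -
    have "\<exists>u\<in>HD. \<forall>v\<in>HD. s1 u v = inner f v"
    proof (rule HD.riesz)
      fix v assume v: "v \<in> HD"
      have "\<bar>inner f v\<bar> \<le> norm f * norm v" by (rule Cauchy_Schwarz_ineq2)
      also have "\<dots> \<le> norm f * sqrt (s1 v v)"
        using norm_le_nrm[of v] v HD_subset by (intro mult_left_mono) (auto simp: nrm_eq)
      finally show "\<bar>inner f v\<bar> \<le> norm f * sqrt (s1 v v)" .
    qed (auto simp: inner_add_right)
    then obtain u where u: "u \<in> HD" "\<And>v. v \<in> HD \<Longrightarrow> Re (h1 u v) = inner f v"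
      by (auto simp: s1_def)
    have "h1 u v = cinner f v" if "v \<in> HD" for v
      by (rule cinner_eqI[OF csub_HD sesquilinear_on_subset[OF sesq_h1 HD_subset] u(1) that u(2)])
    with u(1) show ?thesis by (auto simp: A_shift_iff h1_def)
  qed
  have bound: "norm u \<le> 1 * norm f" if "(u, f) \<in> op_shift A (- 1)" for u f
  proof (cases "u = 0")
    case False
    have u: "u \<in> H1" "h1 u u = cinner f u" using that HD_subset by (auto simp: A_shift_iff h1_def)
    have "norm u * norm u \<le> Re (h1 u u)" using nonneg[OF u(1)]
      by (simp add: h1_def cinner_self power2_eq_square)
    also have "\<dots> \<le> norm f * norm u" unfolding u(2) Re_cinner by (rule norm_cauchy_schwarz)
    finally show ?thesis using False by simp
  qed simp
  show ?thesis by (rule resolvent_setI(1)[OF linear_A _ surj bound]) auto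
qed

text \<open>The difference lies in the kernel of \<Gamma> and solves the homogeneous equation of the
  Dirichlet operator at z.\<close>

lemma N_diff_eq:
  assumes z: "z \<in> \<rho>" and u: "u \<in> N z" "v \<in> N z" "\<Gamma> u = \<Gamma> v"
  shows "u = v"
proof -
  have H: "u \<in> H1" "v \<in> H1" using u by (auto simp: N1_def)
  have "u - v \<in> HD" using H H1.diff_in u(3) by (simp add: HD_iff \<Gamma>_diff)
  moreover have "h (u - v) f - z * cinner (u - v) f = 0" if "f \<in> HD" for f
    using u that H HD_subset sesquilinear_on_diff(1)[OF sesq csub H, of f]
    by (auto simp: N1_def cinner_diff_left algebra_simps)
  ultimately have "(u - v, 0) \<in> op_shift A z" by (simp add: A_shift_iff cinner_zero)
  then have "u - v = resolvent A z 0" by (rule resolvent_setD(2)[OF z])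
  also have "\<dots> = 0" using resolvent_setD(3)[OF z] by (rule linear_simps(3))
  finally show ?thesis by simp
qed

text \<open>A correction d in the kernel of \<Gamma> keeps the boundary value, and the equation for
  \<open>x + d\<close> at z becomes \<open>(A - z) d = (z + 1) x\<close>.\<close>

lemma N_shift:
  assumes x: "x \<in> N (- 1)" and d: "(d, (z + 1) *\<^sub>C x) \<in> op_shift A z"
  shows "x + d \<in> N z" "\<Gamma> (x + d) = \<Gamma> x"
proof -
  have H: "x \<in> H1" "d \<in> H1" "d \<in> HD" using x d HD_subset by (auto simp: N1_def A_shift_iff)
  show "\<Gamma> (x + d) = \<Gamma> x" using H by (simp add: HD_iff \<Gamma>_add)
  have "h (x + d) f = z * cinner (x + d) f" if f: "f \<in> HD" for f
  proof -
    have "h x f = - cinner x f" using x f by (simp add: N1_def)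
    moreover have "h d f = z * cinner d f + (z + 1) * cinner x f"
      using d f by (simp add: A_shift_iff cinner_scaleC_left algebra_simps)
    moreover have "h (x + d) f = h x f + h d f"
      using H f HD_subset by (intro sesquilinear_onD[OF sesq]) auto
    ultimately show ?thesis by (simp add: cinner_add_left algebra_simps)
  qed
  then show "x + d \<in> N z" using H H1.add_in by (simp add: N1_def)
qed

lemma N_exists:
  assumes z: "z \<in> \<rho>" and \<phi>: "\<phi> \<in> G"
  shows "\<exists>u\<in>N z. \<Gamma> u = \<phi>"
proof -
  obtain u where u: "u \<in> H1" "\<Gamma> u = \<phi>" using \<phi> by (auto simp: G_half_def)
  obtain d where d: "d \<in> HD" "u - d \<in> N (- 1)" using harmonic_part[OF u(1)] by blast
  have "\<Gamma> (u - d) = \<phi>" using u d by (simp add: HD_iff \<Gamma>_diff)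
  then show ?thesis using N_shift[OF d(2) resolvent_setD(1)[OF z]] by metis
qed

lemma S_in: "z \<in> \<rho> \<Longrightarrow> \<phi> \<in> G \<Longrightarrow> S z \<phi> \<in> N z"
  and \<Gamma>_S: "z \<in> \<rho> \<Longrightarrow> \<phi> \<in> G \<Longrightarrow> \<Gamma> (S z \<phi>) = \<phi>"
  unfolding sol_op_def using N_exists by (auto intro!: inv_into_into f_inv_into_f)

lemma S_H1: "z \<in> \<rho> \<Longrightarrow> \<phi> \<in> G \<Longrightarrow> S z \<phi> \<in> H1"
  using S_in by (auto simp: N1_def)

lemma S_eq: "z \<in> \<rho> \<Longrightarrow> u \<in> N z \<Longrightarrow> S z (\<Gamma> u) = u"
  unfolding sol_op_def using N_diff_eq by (intro inv_into_f_f inj_onI) auto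

lemma csub_N: "csubspace (N z)"
  unfolding csubspace_def
proof (intro conjI ballI allI)
  have z: "h 0 f = 0" if "f \<in> HD" for f
    using sesquilinear_onD(3)[OF sesq, of f f f 0] that HD_subset by (auto simp: scaleC_zero_left)
  then show "0 \<in> N z" using csubspaceD(1)[OF csub] by (auto simp: N1_def cinner_zero)
next
  fix u v assume "u \<in> N z" "v \<in> N z"
  then show "u + v \<in> N z" using HD_subset sesquilinear_onD(1)[OF sesq, of u v]
    by (auto simp: N1_def H1.add_in cinner_add_left algebra_simps)
next
  fix c u assume "u \<in> N z"
  then show "c *\<^sub>C u \<in> N z" using HD_subset sesquilinear_onD(3)[OF sesq, of u]
    by (auto simp: N1_def csubspaceD(3)[OF csub] cinner_scaleC_left)
qed

lemma S_add: "z \<in> \<rho> \<Longrightarrow> \<phi> \<in> G \<Longrightarrow> \<psi> \<in> G \<Longrightarrow> S z (\<phi> + \<psi>) = S z \<phi> + S z \<psi>"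
  using S_eq[OF _ csubspaceD(2)[OF csub_N], of z "S z \<phi>" "S z \<psi>"]
  by (simp add: S_in S_H1 \<Gamma>_add \<Gamma>_S)

lemma S_scaleC: "z \<in> \<rho> \<Longrightarrow> \<phi> \<in> G \<Longrightarrow> S z (c *\<^sub>C \<phi>) = c *\<^sub>C S z \<phi>"
  using S_eq[OF _ csubspaceD(3)[OF csub_N], of z "S z \<phi>" c]
  by (simp add: S_in S_H1 \<Gamma>_scaleC \<Gamma>_S)

lemma S_diff:
  assumes "z \<in> \<rho>" "\<phi> \<in> G" "\<psi> \<in> G"
  shows "S z (\<phi> - \<psi>) = S z \<phi> - S z \<psi>"
proof -
  have "S z (\<phi> + (- 1) *\<^sub>C \<psi>) = S z \<phi> + (- 1) *\<^sub>C S z \<psi>"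
    using assms csubspaceD(3)[OF csub_G assms(3)] by (simp add: S_add S_scaleC)
  then show ?thesis by (simp add: scaleC_minus_one)
qed

text \<open>The formula \<open>S(z) = S + (z + 1) (A - z)^{-1} S\<close>, in terms of
  graphs.\<close>

lemma S_shift:
  assumes z: "z \<in> \<rho>" and \<phi>: "\<phi> \<in> G"
  shows "(S z \<phi> - S (- 1) \<phi>, (z + 1) *\<^sub>C S (- 1) \<phi>) \<in> op_shift A z"
proof -
  define x d where "x = S (- 1) \<phi>" and "d = resolvent A z ((z + 1) *\<^sub>C x)"
  have x: "x \<in> N (- 1)" "\<Gamma> x = \<phi>"
    using S_in[OF minus_one_in_resolvent_set \<phi>] \<Gamma>_S[OF minus_one_in_resolvent_set \<phi>]
      by (auto simp: x_def)
  have d: "(d, (z + 1) *\<^sub>C x) \<in> op_shift A z" unfolding d_def by (rule resolvent_setD(1)[OF z])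
  have "S z \<phi> = x + d" using S_eq[OF z N_shift(1)[OF x(1) d]] N_shift(2)[OF x(1) d] x(2) by simp
  with d show ?thesis by (simp add: x_def)
qed

lemma S_bounded_norm:
  assumes z: "z \<in> \<rho>"
  shows "\<exists>K\<ge>0. \<forall>\<phi>\<in>G. norm (S z \<phi>) \<le> K * norm (S (- 1) \<phi>)"
proof -
  obtain K where K: "K > 0" "\<And>u f. (u, f) \<in> op_shift A z \<Longrightarrow> norm u \<le> K * norm f"
    using resolvent_set_bound[OF z] by blast
  have "norm (S z \<phi>) \<le> (1 + K * cmod (z + 1)) * norm (S (- 1) \<phi>)" if "\<phi> \<in> G" for \<phi>
    using K(2)[OF S_shift[OF z that]] norm_triangle_sub[of "S z \<phi>" "S (- 1) \<phi>"]
    by (simp add: norm_scaleC algebra_simps)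
  with K(1) show ?thesis by (intro exI[of _ "1 + K * cmod (z + 1)"]) auto
qed

text \<open>Makes the supremum in \<open>L_const\<close> meaningful. The resolvent is bounded only
  in the weaker norm; the form norm of the correction d is recovered by testing its equation with d
  itself.\<close>

lemma S_bounded:
  assumes z: "z \<in> \<rho>"
  shows "\<exists>K. \<forall>\<phi>\<in>G. nrm (S z \<phi>) \<le> K * nrmG \<phi>"
proof -
  obtain K where K: "K > 0" "\<And>u f. (u, f) \<in> op_shift A z \<Longrightarrow> norm u \<le> K * norm f"
    using resolvent_set_bound[OF z] by blast
  define k where "k = K * cmod (z + 1)"
  \<comment> \<open>The factor of the squared norm of x: the two terms of \<open>h d d\<close>, with
    \<open>norm d\<close> replaced by \<open>k * norm x\<close>, and the squared norm of d.\<close>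
  define B where "B = cmod z * k\<^sup>2 + cmod (z + 1) * k + k\<^sup>2"
  have B: "0 \<le> B" using K(1) by (simp add: B_def k_def)
  have "nrm (S z \<phi>) \<le> (1 + sqrt B) * nrmG \<phi>" if \<phi>: "\<phi> \<in> G" for \<phi>
  proof -
    define x d where "x = S (- 1) \<phi>" and "d = S z \<phi> - x"
    have sh: "(d, (z + 1) *\<^sub>C x) \<in> op_shift A z" using S_shift[OF z \<phi>] by (simp add: x_def d_def)
    have x: "x \<in> H1" using S_H1[OF minus_one_in_resolvent_set \<phi>] by (simp add: x_def)
    have d: "d \<in> HD" "d \<in> H1" using sh HD_subset by (auto simp: A_shift_iff)
    have "h d d = z * cinner d d + (z + 1) * cinner x d"
      using sh d(1) by (simp add: A_shift_iff cinner_scaleC_left algebra_simps)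
    then have "Re (h d d) \<le> cmod (z * cinner d d + (z + 1) * cinner x d)"
      using complex_Re_le_cmod by metis
    also have "\<dots> \<le> cmod z * (norm d)\<^sup>2 + cmod (z + 1) * (norm x * norm d)"
      using norm_triangle_ineq[of "z * cinner d d" "(z + 1) * cinner x d"]
        mult_left_mono[OF cmod_cinner_le[of x d] norm_ge_zero[of "z + 1"]]
      by (simp add: norm_mult cinner_self norm_power)
    finally have le: "Re (h d d) \<le> cmod z * (norm d)\<^sup>2 + cmod (z + 1) * (norm x * norm d)" .
    have nd: "norm d \<le> k * norm x" using K(2)[OF sh] by (simp add: norm_scaleC k_def mult.assoc)
    have nd2: "(norm d)\<^sup>2 \<le> k\<^sup>2 * (norm x)\<^sup>2" using power_mono[OF nd, of 2]
      by (simp add: power_mult_distrib)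
    have "(nrm d)\<^sup>2 \<le> cmod z * (k\<^sup>2 * (norm x)\<^sup>2) + cmod (z + 1) * (norm x * (k * norm x)) + k\<^sup>2 * (norm x)\<^sup>2"
      unfolding nrm_square[OF d(2)] using nd2
      by (intro add_mono order_trans[OF le] mult_left_mono nd) auto
    also have "\<dots> = B * (norm x)\<^sup>2" by (simp add: B_def power2_eq_square algebra_simps)
    also have "\<dots> \<le> B * (nrm x)\<^sup>2"
      using norm_le_nrm[OF x] B by (intro mult_left_mono power_mono) auto
    finally have "nrm d \<le> sqrt B * nrm x"
      using nrm_nonneg[OF x] B by (intro power2_le_imp_le[of "nrm d"]) (auto simp: power_mult_distrib)
    moreover have "nrm (x + d) \<le> nrm x + nrm d" unfolding nrm_eq by (rule H1.triangle[OF x d(2)])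
    ultimately show ?thesis by (simp add: x_def d_def norm_half_def algebra_simps)
  qed
  then show ?thesis by blast
qed

lemma nrmG_nonneg: "\<phi> \<in> G \<Longrightarrow> 0 \<le> nrmG \<phi>"
  using S_H1[OF minus_one_in_resolvent_set] by (simp add: norm_half_def nrm_nonneg)

lemma norm_S_le: "\<phi> \<in> G \<Longrightarrow> norm (S (- 1) \<phi>) \<le> nrmG \<phi>"
  using S_H1[OF minus_one_in_resolvent_set] by (simp add: norm_half_def norm_le_nrm)

lemma norm_le_nrmG: "\<phi> \<in> G \<Longrightarrow> norm \<phi> \<le> norm_\<Gamma> H1 h \<Gamma> * nrmG \<phi>"
  using norm_\<Gamma>_bound[OF S_H1[OF minus_one_in_resolvent_set]] \<Gamma>_S[OF minus_one_in_resolvent_set]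
  by (simp add: norm_half_def)

section \<open>The Hilbert space of boundary values\<close>

definition sG :: "'g \<Rightarrow> 'g \<Rightarrow> real" where "sG \<phi> \<psi> = s1 (S (- 1) \<phi>) (S (- 1) \<psi>)"

lemma nrmG_eq: "nrmG \<phi> = sqrt (sG \<phi> \<phi>)"
  by (simp add: norm_half_def sG_def nrm_eq)

lemma N_closed:
  assumes u: "\<And>n. u n \<in> N (- 1)" "x \<in> H1" "(\<lambda>n. s1 (u n - x) (u n - x)) \<longlonglongrightarrow> 0"
  shows "x \<in> N (- 1)"
proof -
  have uH: "u n \<in> H1" for n using u(1) by (auto simp: N1_def)
  have "h1 x f = 0" if f: "f \<in> HD" for f
  proof (rule sesquilinear_eq_0_if_Re[OF csub_HD HD_subset sesq_h1 u(2) _ f])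
    fix f assume f: "f \<in> HD"
    then have fH: "f \<in> H1" using HD_subset by blast
    have "s1 (u n) f = 0" for n using u(1)[of n] f by (simp add: N1_def s1_def h1_def)
    then have eq: "s1 (u n - x) f = - s1 x f" for n using H1.s_diff(1)[OF uH u(2) fH, of n] by simp
    have "(s1 x f)\<^sup>2 \<le> s1 (u n - x) (u n - x) * s1 f f" for n
      using H1.cauchy_schwarz_square[OF H1.diff_in[OF uH u(2)] fH, of n] unfolding eq by simp
    then have "(s1 x f)\<^sup>2 \<le> 0"
      using tendsto_mult_left_zero[OF u(3), of "s1 f f"] by (intro tendsto_lowerbound) auto
    then show "Re (h1 x f) = 0" by (simp add: s1_def)
  qed
  then show ?thesis using u(2) by (simp add: N1_def h1_def eq_neg_iff_add_eq_0)
qed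

text \<open>\<open>S (- 1)\<close> is an isometry onto \<open>N (- 1)\<close>, which is closed in
  \<open>H1\<close>; completeness is carried over.\<close>

sublocale G: hilbert_set G sG
proof
  note m = minus_one_in_resolvent_set
  show sub: "subspace G" by (rule subspace_csubspace[OF csub_G])
  have scaleR: "S (- 1) (r *\<^sub>R \<phi>) = r *\<^sub>R S (- 1) \<phi>" if "\<phi> \<in> G" for r \<phi>
    using S_scaleC[OF m that, of "complex_of_real r"] by (simp add: scaleC_of_real)
  show "bilinear_on G sG"
    unfolding bilinear_on_def sG_def
    by (auto simp: S_add[OF m] scaleR S_H1[OF m] H1.s_add H1.s_scale)
  show "sG u v = sG v u" if "u \<in> G" "v \<in> G" for u v
    using that by (simp add: sG_def H1.sym S_H1[OF m])
  show "0 \<le> sG u u" if "u \<in> G" for u using that by (simp add: sG_def H1.pos S_H1[OF m])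
  fix u :: "nat \<Rightarrow> 'g"
  assume u: "range u \<subseteq> G" and cau: "\<forall>e>0. \<exists>N. \<forall>m\<ge>N. \<forall>n\<ge>N. sG (u m - u n) (u m - u n) < e"
  have uG: "u n \<in> G" for n using u by auto
  have eq: "sG (\<phi> - \<psi>) (\<phi> - \<psi>) = s1 (S (- 1) \<phi> - S (- 1) \<psi>) (S (- 1) \<phi> - S (- 1) \<psi>)"
    if "\<phi> \<in> G" "\<psi> \<in> G" for \<phi> \<psi>
    using that by (simp add: sG_def S_diff[OF m])
  have "\<exists>x\<in>H1. (\<lambda>n. s1 (S (- 1) (u n) - x) (S (- 1) (u n) - x)) \<longlonglongrightarrow> 0"
  proof (rule H1.complete)
    show "range (\<lambda>n. S (- 1) (u n)) \<subseteq> H1" using S_H1[OF m uG] by blast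
  qed (rule cau[unfolded eq[OF uG uG]])
  then obtain x where x: "x \<in> H1" "(\<lambda>n. s1 (S (- 1) (u n) - x) (S (- 1) (u n) - x)) \<longlonglongrightarrow> 0" by blast
  have xN: "x \<in> N (- 1)"
    by (rule N_closed[OF S_in[OF m uG] x])
  have "\<Gamma> x \<in> G" using x(1) by (auto simp: G_half_def)
  moreover have "(\<lambda>n. sG (u n - \<Gamma> x) (u n - \<Gamma> x)) \<longlonglongrightarrow> 0"
    using x(2) unfolding eq[OF uG \<open>\<Gamma> x \<in> G\<close>] S_eq[OF m xN] .
  ultimately show "\<exists>x\<in>G. (\<lambda>n. sG (u n - x) (u n - x)) \<longlonglongrightarrow> 0" by blast
qed

section \<open>The Dirichlet-to-Neumann form\<close>

text \<open>Two extensions of \<psi> differ by an element of the kernel of \<Gamma>, against which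
  \<open>S z \<phi>\<close> solves its equation. The freedom to choose v gives the adjoint
  relation.\<close>

lemma dn_form_eq:
  assumes z: "z \<in> \<rho>" and "\<phi> \<in> G" "\<psi> \<in> G" and v: "v \<in> H1" "\<Gamma> v = \<psi>"
  shows "\<l> z \<phi> \<psi> = h (S z \<phi>) v - z * cinner (S z \<phi>) v"
proof -
  define w where "w = S (- 1) \<psi>"
  have w: "w \<in> H1" "\<Gamma> w = \<psi>" using S_H1 \<Gamma>_S assms(3) minus_one_in_resolvent_set
    by (auto simp: w_def)
  have d: "w - v \<in> HD" using w v H1.diff_in by (simp add: HD_iff \<Gamma>_diff)
  have u: "S z \<phi> \<in> H1" "S z \<phi> \<in> N z" using S_H1 S_in assms by auto
  have "h (S z \<phi>) w - h (S z \<phi>) v = z * (cinner (S z \<phi>) w - cinner (S z \<phi>) v)"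
    using u(2) d sesquilinear_on_diff(2)[OF sesq csub w(1) v(1) u(1)]
    by (simp add: N1_def cinner_diff_right)
  then show ?thesis by (simp add: dn_form_def w_def algebra_simps)
qed

lemma dn_form_rep:
  assumes z: "z \<in> \<rho>" and \<phi>: "\<phi> \<in> G" and \<psi>: "\<psi> \<in> G"
  shows "\<l> z \<phi> \<psi> = h1 (S (- 1) \<phi>) (S (- 1) \<psi>) - (z + 1) * cinner (S z \<phi>) (S (- 1) \<psi>)"
proof -
  note m = minus_one_in_resolvent_set
  define x d y where "x = S (- 1) \<phi>" and "d = S z \<phi> - x" and "y = S (- 1) \<psi>"
  have d: "d \<in> HD" using S_shift[OF z \<phi>] by (simp add: A_shift_iff d_def x_def)
  have H: "x \<in> H1" "y \<in> H1" "d \<in> H1" using S_H1[OF m] \<phi> \<psi> d HD_subset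
    by (auto simp: x_def y_def)
  \<comment> \<open>In \<open>H1\<close> the solutions at -1 are orthogonal to the kernel of
    \<Gamma>; Hermitian symmetry moves d to the first argument.\<close>
  have "h y d = - cinner y d" using S_in[OF m \<psi>] d by (simp add: N1_def y_def)
  then have hd: "h d y = - cinner d y" using herm[OF H(3,2)] cinner_commute[of d y] by simp
  have S: "S z \<phi> = x + d" by (simp add: d_def)
  have "\<l> z \<phi> \<psi> = h (x + d) y - z * cinner (x + d) y" by (simp add: dn_form_def S y_def)
  also have "h (x + d) y = h x y + h d y" using H by (intro sesquilinear_onD[OF sesq])
  finally have "\<l> z \<phi> \<psi> = h1 x y - (z + 1) * cinner (x + d) y"
    using hd by (simp add: h1_def cinner_add_left algebra_simps)
  then show ?thesis unfolding S[symmetric] unfolding x_def y_def .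
qed

lemma sesq_dn_form:
  assumes z: "z \<in> \<rho>"
  shows "sesquilinear_on G (\<l> z)"
proof -
  note m = minus_one_in_resolvent_set
  have H: "S z \<phi> \<in> H1" "S (- 1) \<phi> \<in> H1" if "\<phi> \<in> G" for \<phi>
    using that S_H1 z m by auto
  have "\<l> z (\<phi> + \<psi>) \<eta> = \<l> z \<phi> \<eta> + \<l> z \<psi> \<eta>" "\<l> z \<eta> (\<phi> + \<psi>) = \<l> z \<eta> \<phi> + \<l> z \<eta> \<psi>"
    if "\<phi> \<in> G" "\<psi> \<in> G" "\<eta> \<in> G" for \<phi> \<psi> \<eta>
    unfolding dn_form_def S_add[OF z that(1,2)] S_add[OF m that(1,2)]
      sesquilinear_onD(1)[OF sesq H(1)[OF that(1)] H(1)[OF that(2)] H(2)[OF that(3)]]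
      sesquilinear_onD(2)[OF sesq H(2)[OF that(1)] H(2)[OF that(2)] H(1)[OF that(3)]]
      cinner_add_left cinner_add_right
    by (simp_all add: distrib_left)
  moreover have "\<l> z (c *\<^sub>C \<phi>) \<eta> = c * \<l> z \<phi> \<eta>" "\<l> z \<eta> (c *\<^sub>C \<phi>) = cnj c * \<l> z \<eta> \<phi>"
    if "\<phi> \<in> G" "\<eta> \<in> G" for \<phi> \<eta> c
    unfolding dn_form_def S_scaleC[OF z that(1)] S_scaleC[OF m that(1)]
      sesquilinear_onD(3)[OF sesq H(1)[OF that(1)] H(1)[OF that(1)] H(2)[OF that(2)]]
      sesquilinear_onD(4)[OF sesq H(2)[OF that(1)] H(2)[OF that(1)] H(1)[OF that(2)]]
      cinner_scaleC_left cinner_scaleC_right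
    by (simp_all add: right_diff_distrib mult_ac)
  ultimately show ?thesis unfolding sesquilinear_on_def by blast
qed

text \<open>The summand 1 in L comes from Cauchy-Schwarz in \<open>H1\<close> for the first term of
  \<open>dn_form_rep\<close>, the rest from the second term.\<close>

lemma L_const_ge_1: "z \<in> \<rho> \<Longrightarrow> 1 \<le> L_const H1 h \<Gamma> z"
  and dn_form_bound: "z \<in> \<rho> \<Longrightarrow> \<phi> \<in> G \<Longrightarrow> \<psi> \<in> G \<Longrightarrow>
    cmod (\<l> z \<phi> \<psi>) \<le> L_const H1 h \<Gamma> z * nrmG \<phi> * nrmG \<psi>"
proof -
  assume z: "z \<in> \<rho>"
  note m = minus_one_in_resolvent_set
  define n where "n = onorm_on G nrmG nrm (S z)"
  obtain K where "\<forall>\<phi>\<in>G. nrm (S z \<phi>) \<le> K * nrmG \<phi>" using S_bounded[OF z] by blast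
  then have n: "0 \<le> n" "\<phi> \<in> G \<Longrightarrow> nrm (S z \<phi>) \<le> n * nrmG \<phi>" for \<phi>
    unfolding n_def using csubspaceD(1)[OF csub_G]
    by (intro onorm_on_bounds[of G nrmG nrm "S z" K]; auto simp: nrm_nonneg nrmG_nonneg S_H1[OF z])+
  have L: "L_const H1 h \<Gamma> z = 1 + cmod (z + 1) * n" by (simp add: L_const_def n_def)
  show "1 \<le> L_const H1 h \<Gamma> z" using n(1) by (simp add: L)
  assume \<phi>: "\<phi> \<in> G" and \<psi>: "\<psi> \<in> G"
  have H: "S (- 1) \<phi> \<in> H1" "S (- 1) \<psi> \<in> H1" "S z \<phi> \<in> H1"
    using S_H1 z m \<phi> \<psi> by auto
  have "cmod (h1 (S (- 1) \<phi>) (S (- 1) \<psi>)) \<le> nrmG \<phi> * nrmG \<psi>"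
  proof (rule cmod_le_if_Re_le)
    fix c :: complex assume c: "cmod c = 1"
    have cH: "c *\<^sub>C S (- 1) \<phi> \<in> H1" using H csubspaceD(3)[OF csub] by blast
    have "h1 (c *\<^sub>C S (- 1) \<phi>) (c *\<^sub>C S (- 1) \<phi>) = c * cnj c * h1 (S (- 1) \<phi>) (S (- 1) \<phi>)"
      using H cH by (simp add: sesquilinear_onD(3,4)[OF sesq_h1 H(1) H(1)])
    also have "c * cnj c = 1" using c by (simp add: complex_norm_square[symmetric])
    finally have "s1 (c *\<^sub>C S (- 1) \<phi>) (c *\<^sub>C S (- 1) \<phi>) = s1 (S (- 1) \<phi>) (S (- 1) \<phi>)"
      by (simp add: s1_def)
    moreover have "Re (c * h1 (S (- 1) \<phi>) (S (- 1) \<psi>)) = s1 (c *\<^sub>C S (- 1) \<phi>) (S (- 1) \<psi>)"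
      using H by (simp add: s1_def sesquilinear_onD(3)[OF sesq_h1])
    ultimately show "Re (c * h1 (S (- 1) \<phi>) (S (- 1) \<psi>)) \<le> nrmG \<phi> * nrmG \<psi>"
      using H1.cauchy_schwarz[OF cH H(2)] by (simp add: norm_half_def nrm_eq)
  qed
  moreover have "cmod (cinner (S z \<phi>) (S (- 1) \<psi>)) \<le> n * nrmG \<phi> * nrmG \<psi>"
  proof -
    have "cmod (cinner (S z \<phi>) (S (- 1) \<psi>)) \<le> norm (S z \<phi>) * norm (S (- 1) \<psi>)"
      by (rule cmod_cinner_le)
    also have "\<dots> \<le> (n * nrmG \<phi>) * nrmG \<psi>"
      using norm_le_nrm[OF H(3)] n(2)[OF \<phi>] norm_S_le[OF \<psi>] n(1) nrmG_nonneg[OF \<phi>]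
      by (intro mult_mono) auto
    finally show ?thesis .
  qed
  ultimately have "cmod (\<l> z \<phi> \<psi>) \<le> nrmG \<phi> * nrmG \<psi> + cmod (z + 1) * (n * nrmG \<phi> * nrmG \<psi>)"
    unfolding dn_form_rep[OF z \<phi> \<psi>]
    using norm_triangle_ineq4[of "h1 (S (- 1) \<phi>) (S (- 1) \<psi>)" "(z + 1) * cinner (S z \<phi>) (S (- 1) \<psi>)"]
      mult_left_mono[of _ _ "cmod (z + 1)", OF _ norm_ge_zero]
    unfolding norm_mult by (meson add_mono order_trans)
  then show "cmod (\<l> z \<phi> \<psi>) \<le> L_const H1 h \<Gamma> z * nrmG \<phi> * nrmG \<psi>"
    by (simp add: L algebra_simps)
qed

end

text \<open>Extension by uniform continuity; linearity and the bound pass to limits. With uniqueness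
  on a dense set it shows that the definite description \<open>sol_op_ext\<close> denotes
  something.\<close>

lemma bounded_linear_extension:
  fixes f :: "'a::real_normed_vector \<Rightarrow> 'b::banach"
  assumes D: "subspace D" and dense: "closure D = UNIV"
    and add: "\<And>u v. u \<in> D \<Longrightarrow> v \<in> D \<Longrightarrow> f (u + v) = f u + f v"
    and scale: "\<And>r u. u \<in> D \<Longrightarrow> f (r *\<^sub>R u) = r *\<^sub>R f u"
    and bound: "\<And>u. u \<in> D \<Longrightarrow> norm (f u) \<le> K * norm u"
  shows "\<exists>g. bounded_linear g \<and> (\<forall>u\<in>D. g u = f u)"
proof -
  have diff: "f u - f v = f (u - v)" if "u \<in> D" "v \<in> D" for u v
    using add[OF that(1) subspace_mul[OF D that(2), of "- 1"]] scale[OF that(2), of "- 1"] by simp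
  have "(\<bar>K\<bar> + 1)-lipschitz_on D f"
  proof (rule lipschitz_onI)
    fix u v assume uv: "u \<in> D" "v \<in> D"
    have "norm (f (u - v)) \<le> K * norm (u - v)" using subspace_diff[OF D uv] by (rule bound)
    also have "\<dots> \<le> (\<bar>K\<bar> + 1) * norm (u - v)" by (intro mult_right_mono) auto
    finally show "dist (f u) (f v) \<le> (\<bar>K\<bar> + 1) * dist u v" by (simp add: dist_norm diff[OF uv])
  qed simp
  then have uc: "uniformly_continuous_on D f" by (rule lipschitz_on_uniformly_continuous)
  obtain g where g: "uniformly_continuous_on (closure D) g" "\<And>x. x \<in> D \<Longrightarrow> f x = g x"
    by (rule uniformly_continuous_on_extension_on_closure[OF uc]) metis
  have cont: "continuous_on UNIV g" using uniformly_continuous_imp_continuous[OF g(1)] dense by simp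
  have approx: "\<exists>a. (\<forall>n. a n \<in> D) \<and> a \<longlonglongrightarrow> x" for x
    using dense closure_sequential[of x D] by auto
  have lim: "(\<lambda>n. g (a n)) \<longlonglongrightarrow> g x"
    if "a \<longlonglongrightarrow> x" for a :: "nat \<Rightarrow> 'a" and x
    using continuous_on_tendsto_compose[OF cont that] by simp
  have "bounded_linear g"
  proof (rule bounded_linear_intro)
    fix x y
    obtain a b where a: "\<And>n. a n \<in> D" "a \<longlonglongrightarrow> x" and b: "\<And>n. b n \<in> D" "b \<longlonglongrightarrow> y"
      using approx by metis
    have "g (a n + b n) = g (a n) + g (b n)" for n
      using a b add by (simp add: g(2)[symmetric] subspace_add[OF D])
    moreover have "(\<lambda>n. g (a n + b n)) \<longlonglongrightarrow> g (x + y)" by (intro lim tendsto_add a b)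
    moreover have "(\<lambda>n. g (a n) + g (b n)) \<longlonglongrightarrow> g x + g y"
      by (intro lim tendsto_add a b)
    ultimately show "g (x + y) = g x + g y" using LIMSEQ_unique by simp
  next
    fix r x
    obtain a where a: "\<And>n. a n \<in> D" "a \<longlonglongrightarrow> x" using approx by metis
    have "g (r *\<^sub>R a n) = r *\<^sub>R g (a n)" for n
      using a scale by (simp add: g(2)[symmetric] subspace_mul[OF D])
    moreover have "(\<lambda>n. g (r *\<^sub>R a n)) \<longlonglongrightarrow> g (r *\<^sub>R x)"
      by (intro lim tendsto_intros a)
    moreover have "(\<lambda>n. r *\<^sub>R g (a n)) \<longlonglongrightarrow> r *\<^sub>R g x"
      by (intro lim tendsto_intros a)
    ultimately show "g (r *\<^sub>R x) = r *\<^sub>R g x" using LIMSEQ_unique by simp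
  next
    fix x
    obtain a where a: "\<And>n. a n \<in> D" "a \<longlonglongrightarrow> x" using approx by metis
    have "norm (g (a n)) \<le> norm (a n) * K" for n
      using bound[OF a(1)] g(2)[OF a(1)] by (metis mult.commute)
    then show "norm (g x) \<le> norm x * K"
      using tendsto_norm[OF lim[OF a(2)]] tendsto_mult_right[OF tendsto_norm[OF a(2)], of K]
      by (intro LIMSEQ_le[where X = "\<lambda>n. norm (g (a n))" and Y = "\<lambda>n. norm (a n) * K"])
        (auto simp: mult.commute)
  qed
  with g(2) show ?thesis by auto
qed

lemma bounded_linear_eq_on_dense:
  assumes "bounded_linear f" "bounded_linear g" "closure D = UNIV" "\<And>u. u \<in> D \<Longrightarrow> f u = g u"
  shows "f = g"
proof
  fix x
  obtain a where a: "\<And>n. a n \<in> D" "a \<longlonglongrightarrow> x"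
    using assms(3) closure_sequential[of x D] by auto
  have "(\<lambda>n. f (a n)) \<longlonglongrightarrow> f x" "(\<lambda>n. g (a n)) \<longlonglongrightarrow> g x"
    using bounded_linear.tendsto[OF assms(1) a(2)] bounded_linear.tendsto[OF assms(2) a(2)] by auto
  with assms(4)[OF a(1)] show "f x = g x" using LIMSEQ_unique by simp
qed

section \<open>The Dirichlet resolvent at -1 and the spectral bound\<close>

context bdry_pair
begin

definition T :: "'h \<Rightarrow> 'h" where "T = resolvent A (- 1)"

lemma T_shift: "(T f, f) \<in> op_shift A (- 1)"
  unfolding T_def by (rule resolvent_setD(1)[OF minus_one_in_resolvent_set])

lemma T_in: "T f \<in> HD" "T f \<in> H1"
  using T_shift[of f] HD_subset by (auto simp: A_shift_iff)

lemma T_form: "v \<in> HD \<Longrightarrow> h1 (T f) v = cinner f v"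
  using T_shift[of f] by (simp add: A_shift_iff h1_def)

lemma bounded_linear_T: "bounded_linear T"
  unfolding T_def by (rule resolvent_setD(3)[OF minus_one_in_resolvent_set])

text \<open>Adding \<open>(z + 1) u\<close> on both sides turns every resolvent equation of the
  unbounded \<open>A\<close> into an equation for the bounded \<open>T\<close>.\<close>

lemma shift_iff_T: "(u, f) \<in> op_shift A z \<longleftrightarrow> u = T (f + (z + 1) *\<^sub>C u)"
proof -
  have "(u, f) \<in> op_shift A z \<longleftrightarrow> (u, f + (z + 1) *\<^sub>C u) \<in> op_shift A (- 1)"
    by (simp add: op_shift_iff scaleC_add_left scaleC_minus_one scaleC_one)
  also have "\<dots> \<longleftrightarrow> u = T (f + (z + 1) *\<^sub>C u)"
    using T_shift resolvent_setD(2)[OF minus_one_in_resolvent_set] unfolding T_def by metis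
  finally show ?thesis .
qed

lemma T_scaleC: "T (c *\<^sub>C f) = c *\<^sub>C T f"
  using linear_operatorD(4)[OF linear_operator_op_shift[OF linear_A] T_shift]
    resolvent_setD(2)[OF minus_one_in_resolvent_set] unfolding T_def by metis

lemma T_sym: "cinner (T f) g = cinner f (T g)"
proof -
  have "cinner f (T g) = h1 (T f) (T g)" by (simp add: T_form T_in)
  also have "\<dots> = cnj (h1 (T g) (T f))" by (rule h1_herm[OF T_in(2) T_in(2)])
  also have "\<dots> = cinner (T f) g" using cinner_commute[of "T f" g] by (simp add: T_form T_in)
  finally show ?thesis by simp
qed

lemma T_sym_inner: "inner (T f) g = inner f (T g)"
  using arg_cong[OF T_sym[of f g], of Re] by (simp add: Re_cinner)

lemma T_pos: "0 \<le> inner (T f) f"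
  using H1.pos[OF T_in(2)[of f]] T_form[OF T_in(1), of f f]
  by (simp add: s1_def Re_cinner inner_commute)

text \<open>By symmetry a vector g orthogonal to the range satisfies \<open>T g = 0\<close>, and
  then the equation defining \<open>T g\<close> makes it orthogonal to the dense
  \<open>HD\<close>.\<close>

lemma T_dense_range: "closure (range T) = UNIV"
proof (rule dense_subspace_if_orthogonal_trivial)
  show "subspace (range T)"
    using bounded_linear.linear[OF bounded_linear_T] subspace_UNIV by (rule linear_subspace_image)
  fix g assume "\<forall>f\<in>range T. inner g f = 0"
  then have "inner (T g) (T g) = 0" by (simp add: T_sym_inner)
  then have "T g = 0" by simp
  then have "cinner g v = 0" if "v \<in> HD" for v
    using T_form[OF that, of g] sesquilinear_onD(3)[OF sesq_h1, of v v v 0] that HD_subset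
    by (auto simp: scaleC_zero_left)
  then show "g = 0" by (intro orthogonal_dense_eq_0[OF dense_HD]) (simp add: Re_cinner[symmetric])
qed

lemma shift_adjoint:
  assumes "(u, g) \<in> op_shift A (cnj z)" "(w, f) \<in> op_shift A z"
  shows "cinner u f = cinner g w"
proof -
  have H: "u \<in> HD" "w \<in> HD" "u \<in> H1" "w \<in> H1" using assms HD_subset by (auto simp: A_shift_iff)
  have "cinner g w = h u w - cnj z * cinner u w" using assms H by (simp add: A_shift_iff)
  also have "\<dots> = cnj (h w u - z * cinner w u)"
    using herm[OF H(3,4)] cinner_commute[of u w] by simp
  also have "h w u - z * cinner w u = cinner f u" using assms H by (simp add: A_shift_iff)
  finally show ?thesis using cinner_commute[of u f] by simp
qed

text \<open>The adjoint of the resolvent at z inverts the shifted operator at \<open>cnj z\<close>.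
  Riesz supplies the adjoint, and \<open>T\<close> shows that its values lie in the domain and solve
  the equation.\<close>

lemma cnj_in_resolvent_set:
  assumes z: "z \<in> \<rho>"
  shows "cnj z \<in> \<rho>"
proof -
  define R where "R = resolvent A z"
  have R: "(R f, f) \<in> op_shift A z" for f unfolding R_def by (rule resolvent_setD(1)[OF z])
  interpret R: bounded_linear R unfolding R_def by (rule resolvent_setD(3)[OF z])
  obtain K where K: "K > 0" "\<And>f. norm (R f) \<le> norm f * K" using R.pos_bounded by blast
  interpret H: hilbert_set "UNIV :: 'h set" inner by (rule hilbert_set_inner) auto
  show ?thesis
  proof (rule resolvent_setI(1)[OF linear_A, of K])
    fix g
    have "\<exists>u\<in>UNIV. \<forall>f\<in>UNIV. inner u f = inner g (R f)"
    proof (rule H.riesz)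
      fix f
      have "\<bar>inner g (R f)\<bar> \<le> norm g * norm (R f)" by (rule Cauchy_Schwarz_ineq2)
      also have "\<dots> \<le> norm g * (norm f * K)" using K by (intro mult_left_mono) auto
      finally show "\<bar>inner g (R f)\<bar> \<le> norm g * K * sqrt (inner f f)"
        by (simp add: norm_eq_sqrt_inner[symmetric] mult_ac)
    qed (auto simp: R.add R.scaleR inner_add_right)
    then obtain u where u: "\<And>f. inner u f = inner g (R f)" by blast
    have "inner (u - T (g + (cnj z + 1) *\<^sub>C u)) f = 0" for f
    proof -
      \<comment> \<open>On these test vectors the resolvent at z is explicit: it returns
        \<open>T f\<close>.\<close>
      have "(T f, f - (z + 1) *\<^sub>C T f) \<in> op_shift A z" by (simp add: shift_iff_T)
      then have "T f = R (f - (z + 1) *\<^sub>C T f)" unfolding R_def by (rule resolvent_setD(2)[OF z])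
      then have "inner u (f - (z + 1) *\<^sub>C T f) = inner g (T f)" using u by metis
      moreover have "inner u ((z + 1) *\<^sub>C T f) = inner ((cnj z + 1) *\<^sub>C u) (T f)"
        by (simp add: Re_cinner[symmetric] cinner_scaleC_left cinner_scaleC_right)
      ultimately show ?thesis
        by (simp add: inner_diff_left inner_diff_right T_sym_inner inner_add_left)
    qed
    then have "u - T (g + (cnj z + 1) *\<^sub>C u) = 0" by (metis inner_eq_zero_iff)
    then show "\<exists>u. (u, g) \<in> op_shift A (cnj z)" unfolding shift_iff_T by auto
  next
    fix u g assume ug: "(u, g) \<in> op_shift A (cnj z)"
    show "norm u \<le> K * norm g"
    proof (cases "u = 0")
      case False
      have "norm u * norm u = cmod (cinner u u)" by (simp add: cinner_self norm_mult power2_eq_square)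
      also have "\<dots> = cmod (cinner g (R u))" using shift_adjoint[OF ug R] by simp
      also have "\<dots> \<le> norm g * norm (R u)" by (rule cmod_cinner_le)
      also have "\<dots> \<le> norm g * (norm u * K)" using K by (intro mult_left_mono) auto
      finally have "norm u * norm u \<le> norm u * (K * norm g)" by (simp add: mult_ac)
      then show ?thesis using False by simp
    qed (use K in simp)
  qed (use K in simp)
qed

text \<open>With \<open>\<lambda> = 1 / t - 1\<close> one has
  \<open>T u - t u = - t (A - \<lambda>) (T u)\<close>. The resolvent at \<lambda> thus controls
  \<open>T u\<close>, and the triangle inequality controls u.\<close>

lemma T_gap:
  assumes t: "0 < t" and \<rho>: "complex_of_real (1 / t - 1) \<in> \<rho>"
  shows "\<exists>c>0. \<forall>u. c * norm u \<le> norm (T u - t *\<^sub>R u)"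
proof -
  obtain K where K: "K > 0" "\<And>u f. (u, f) \<in> op_shift A (complex_of_real (1 / t - 1)) \<Longrightarrow> norm u \<le> K * norm f"
    using resolvent_set_bound[OF \<rho>] by blast
  have "t * norm u \<le> (1 + K / t) * norm (T u - t *\<^sub>R u)" for u
  proof -
    have "complex_of_real (1 / t - 1) + 1 = complex_of_real (1 / t)" by simp
    then have "(complex_of_real (1 / t - 1) + 1) *\<^sub>C T u = (1 / t) *\<^sub>R T u"
      by (metis scaleC_of_real)
    then have "(T u, u - (1 / t) *\<^sub>R T u) \<in> op_shift A (complex_of_real (1 / t - 1))"
      unfolding shift_iff_T by simp
    from K(2)[OF this] have 1: "norm (T u) \<le> K * norm (u - (1 / t) *\<^sub>R T u)" .
    have "T u - t *\<^sub>R u = (- t) *\<^sub>R (u - (1 / t) *\<^sub>R T u)" using t by (simp add: algebra_simps)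
    then have 2: "norm (T u - t *\<^sub>R u) = t * norm (u - (1 / t) *\<^sub>R T u)" using t by simp
    have "t * norm u \<le> norm (T u - t *\<^sub>R u) + norm (T u)"
      using norm_triangle_ineq2[of "t *\<^sub>R u" "T u"] t by (simp add: norm_minus_commute)
    also have "norm (T u) \<le> K / t * norm (T u - t *\<^sub>R u)" using 1 t unfolding 2 by simp
    finally show ?thesis by (simp add: algebra_simps)
  qed
  moreover have "0 < 1 + K / t" using K t by (simp add: add_pos_pos)
  ultimately have "t / (1 + K / t) * norm u \<le> norm (T u - t *\<^sub>R u)" for u
    by (simp add: pos_divide_le_eq mult.commute)
  then show ?thesis using t \<open>0 < 1 + K / t\<close> by (intro exI[of _ "t / (1 + K / t)"]) auto
qed

text \<open>An isolated point \<open>0\<close> of the spectrum of \<open>T\<close> would be an eigenvalue, but \<open>T\<close> is injective.\<close>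

lemma T_gap_0:
  assumes \<epsilon>: "0 < \<epsilon>" and \<rho>: "\<And>t. 0 < t \<Longrightarrow> t < \<epsilon> \<Longrightarrow> complex_of_real (1 / t - 1) \<in> \<rho>"
  shows "\<epsilon> * norm u \<le> norm (T u)"
proof -
  \<comment> \<open>The polynomial \<open>t * (t - \<epsilon>)\<close> is negative only between 0
    and \<epsilon>, where \<open>T_gap\<close> applies; hence \<open>\<epsilon> T\<close> is at most
    the square of \<open>T\<close>.\<close>
  have below: "\<epsilon> * inner (T v) v \<le> (norm (T v))\<^sup>2" for v
  proof -
    have "0 \<le> 1 * (norm (T v))\<^sup>2 + (- \<epsilon>) * inner (T v) v + 0 * (norm v)\<^sup>2"
    proof (rule quadratic_calculus_nonneg[OF bounded_linear_T T_sym_inner])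
      fix t :: real assume "1 * t\<^sup>2 + - \<epsilon> * t + 0 < 0"
      then have neg: "t * (t - \<epsilon>) < 0" by (simp add: power2_eq_square algebra_simps)
      with \<epsilon> have "0 < t" "t < \<epsilon>" by (auto simp: mult_less_0_iff)
      then show "\<exists>c>0. \<forall>u. c * norm u \<le> norm (T u - t *\<^sub>R u)" by (intro T_gap \<rho>)
    qed simp
    then show ?thesis by simp
  qed
  have cs: "(inner u (T g))\<^sup>2 \<le> inner (T u) u * inner (T g) g" for g
  proof (rule quadratic_nonneg_discriminant)
    fix t
    have "inner (T (u + t *\<^sub>R g)) (u + t *\<^sub>R g)
        = inner (T u) u + 2 * t * inner u (T g) + t\<^sup>2 * inner (T g) g"
      by (simp add: linear_simps[OF bounded_linear_T] inner_add_left inner_add_right T_sym_inner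
          inner_commute[of g "T u"] power2_eq_square algebra_simps)
    then show "0 \<le> inner (T u) u + 2 * t * inner u (T g) + t\<^sup>2 * inner (T g) g"
      using T_pos[of "u + t *\<^sub>R g"] by simp
  qed
  \<comment> \<open>Cauchy-Schwarz for the form of \<open>T\<close>, with both factors estimated by
    \<open>below\<close>. This bounds u tested against the range; density of the range then admits u
    itself as a test vector.\<close>
  have range_bound: "\<epsilon> * inner u (T g) \<le> norm (T u) * norm (T g)" for g
  proof -
    have "(\<epsilon> * inner u (T g))\<^sup>2 \<le> (\<epsilon> * inner (T u) u) * (\<epsilon> * inner (T g) g)"
      using mult_left_mono[OF cs[of g], of "\<epsilon>\<^sup>2"] by (simp add: power2_eq_square mult_ac)
    also have "\<dots> \<le> (norm (T u))\<^sup>2 * (norm (T g))\<^sup>2"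
      using below \<epsilon> T_pos by (intro mult_mono) auto
    finally have "(\<epsilon> * inner u (T g))\<^sup>2 \<le> (norm (T u) * norm (T g))\<^sup>2"
      by (simp add: power_mult_distrib)
    then show ?thesis by (rule power2_le_imp_le) simp
  qed
  obtain a where a: "\<And>n. a n \<in> range T" "a \<longlonglongrightarrow> u"
    using T_dense_range closure_sequential[of u "range T"] by auto
  have "\<epsilon> * inner u (a n) \<le> norm (T u) * norm (a n)" for n using a(1)[of n] range_bound by auto
  then have "\<epsilon> * inner u u \<le> norm (T u) * norm u"
    by (intro LIMSEQ_le[of "\<lambda>n. \<epsilon> * inner u (a n)" _ "\<lambda>n. norm (T u) * norm (a n)"] tendsto_intros a) auto
  then have "norm u * (\<epsilon> * norm u) \<le> norm u * norm (T u)"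
    by (simp add: power2_norm_eq_inner[symmetric] power2_eq_square mult_ac)
  then show ?thesis by (cases "u = 0") auto
qed

text \<open>
  With \<open>t = 1 / (\<lambda> + 1)\<close> the function \<open>\<lambda> \<mapsto> (z + 1) (\<lambda> + 1) / (\<lambda> - z)\<close> is
  \<open>(z + 1) / (1 - (z + 1) t)\<close>, so that the hypothesis on \<open>M\<close> says that a quadratic polynomial is
  non-negative on the spectrum of \<open>T\<close>. At \<open>t = 0\<close>, that is \<open>\<lambda> = \<infinity>\<close>, this holds by continuity.
\<close>

lemma spectral_bound:
  fixes z :: complex and M :: real
  assumes z: "z \<in> \<rho>" "z \<noteq> - 1" and M: "0 < M"
    and spec: "\<And>\<mu>. complex_of_real \<mu> \<notin> \<rho> \<Longrightarrow>
      Re ((z + 1) * (complex_of_real \<mu> + 1) / (complex_of_real \<mu> - z)) \<le> M"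
    and x: "u - x = (z + 1) *\<^sub>C T u"
  shows "Re ((z + 1) * cinner u x) \<le> M * (norm x)\<^sup>2"
proof -
  define c where "c = z + 1"
  define \<alpha> \<beta> \<gamma> where "\<alpha> = M * (cmod c)\<^sup>2" and "\<beta> = (cmod c)\<^sup>2 - 2 * M * Re c" and "\<gamma> = M - Re c"
  define q where "q t = \<alpha> * t\<^sup>2 + \<beta> * t + \<gamma>" for t
  \<comment> \<open>With \<open>w = 1 - c * t\<close>, non-negativity of \<open>q t\<close> is
    \<open>Re (c / w) <= M\<close> after multiplication by the squared modulus of w.\<close>
  have q_eq: "q t = M * (cmod (1 - c * t))\<^sup>2 - Re (c * cnj (1 - c * t))" for t
    unfolding q_def \<alpha>_def \<beta>_def \<gamma>_def cmod_power2 by (simp add: power2_eq_square algebra_simps)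
  have gap_pos: "complex_of_real (1 / t - 1) \<in> \<rho>" if t: "0 < t" and neg: "q t < 0" for t
  proof (rule ccontr)
    assume not: "\<not> ?thesis"
    define w where "w = 1 - c * t"
    have t0: "complex_of_real t \<noteq> 0" using t by simp
    have \<mu>z: "complex_of_real (1 / t - 1) - z = w / t" using t0 by (simp add: w_def c_def field_simps)
    have w: "w \<noteq> 0"
    proof
      assume "w = 0"
      with \<mu>z have "complex_of_real (1 / t - 1) = z" by simp
      with not z show False by simp
    qed
    have "(z + 1) * (complex_of_real (1 / t - 1) + 1) / (complex_of_real (1 / t - 1) - z) = c / w"
      unfolding \<mu>z using t0 w by (simp add: c_def)
    with spec[OF not] have "Re (c / w) \<le> M" by simp
    moreover have "Re (c / w) = Re (c * cnj w) / (cmod w)\<^sup>2"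
      by (simp add: complex_div_cnj[of c w] flip: of_real_power)
    ultimately have "Re (c * cnj w) \<le> M * (cmod w)\<^sup>2" using w by (simp add: pos_divide_le_eq)
    with neg show False by (simp add: q_eq w_def)
  qed
  have gap: "\<exists>k>0. \<forall>u. k * norm u \<le> norm (T u - t *\<^sub>R u)" if neg: "q t < 0" for t
  proof -
    consider "0 < t" | "t < 0" | "t = 0" by linarith
    then show ?thesis
    proof cases
      case 1
      then show ?thesis using gap_pos neg T_gap by blast
    next
      case 2
      have "- t * norm v \<le> norm (T v - t *\<^sub>R v)" for v
      proof (cases "v = 0")
        case False
        have "- t * norm v * norm v \<le> inner (T v - t *\<^sub>R v) v"
          using T_pos[of v] by (simp add: inner_diff_left power2_norm_eq_inner[symmetric] power2_eq_square)
        also have "\<dots> \<le> norm (T v - t *\<^sub>R v) * norm v" by (rule norm_cauchy_schwarz)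
        finally show ?thesis using False mult_right_le_imp_le[of "- t * norm v" "norm v"] by simp
      qed simp
      with 2 show ?thesis by (intro exI[of _ "- t"]) auto
    next
      case 3
      \<comment> \<open>A negative value at 0 would spread to an interval to the right of 0, so that
        \<open>T_gap_0\<close> applies.\<close>
      have "(q \<longlongrightarrow> q 0) (at 0)" unfolding q_def by (intro tendsto_intros)
      then have "\<forall>\<^sub>F t in at 0. q t < 0" using neg 3 by (intro order_tendstoD(2)) auto
      then obtain \<epsilon> where \<epsilon>: "0 < \<epsilon>" "\<And>t. t \<noteq> 0 \<Longrightarrow> dist t 0 < \<epsilon> \<Longrightarrow> q t < 0"
        unfolding eventually_at by blast
      have "\<epsilon> * norm v \<le> norm (T v)" for v
        using \<epsilon> by (intro T_gap_0 gap_pos) auto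
      with \<epsilon>(1) 3 show ?thesis by auto
    qed
  qed
  have "0 \<le> \<alpha> * (norm (T u))\<^sup>2 + \<beta> * inner (T u) u + \<gamma> * (norm u)\<^sup>2"
    using M z(2) gap unfolding q_def eq_neg_iff_add_eq_0
    by (intro quadratic_calculus_nonneg[OF bounded_linear_T T_sym_inner])
      (auto simp: \<alpha>_def c_def)
  \<comment> \<open>Since \<open>x = (1 - c T) u\<close>, this is \<open>q_eq\<close> with t
    replaced by \<open>T\<close> and evaluated at u.\<close>
  also have "\<dots> = M * (norm x)\<^sup>2 - Re (c * cinner u x)"
  proof -
    define a where "a = inner (T u) u"
    have Tu: "cinner (T u) u = complex_of_real a"
    proof (rule complex_eqI)
      have "cinner (T u) u = cnj (cinner (T u) u)" using T_sym[of u u] cinner_commute[of u "T u"] by simp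
      then show "Im (cinner (T u) u) = Im (complex_of_real a)"
        by (metis Im_complex_of_real Reals_cnj_iff complex_is_Real_iff)
    qed (simp add: a_def Re_cinner)
    have uT: "cinner u (T u) = complex_of_real a" using T_sym[of u u] Tu by simp
    have cc: "c * cnj c = (complex_of_real (cmod c))\<^sup>2"
      by (metis complex_norm_square of_real_power)
    have xe: "x = u - c *\<^sub>C T u" using x by (simp add: c_def algebra_simps)
    have ux: "c * cinner u x = c * (norm u)\<^sup>2 - (cmod c)\<^sup>2 * a"
      unfolding xe
      by (simp add: cinner_diff_right cinner_scaleC_right uT cinner_self cc algebra_simps)
    have "complex_of_real ((norm x)\<^sup>2) = (norm u)\<^sup>2 - c * a - cnj c * a + c * cnj c * (norm (T u))\<^sup>2"
      unfolding cinner_self[symmetric] xe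
      by (simp add: cinner_diff_right cinner_diff_left cinner_scaleC_right cinner_scaleC_left uT Tu
          algebra_simps)
    then have "(norm x)\<^sup>2 = Re ((norm u)\<^sup>2 - c * a - cnj c * a + c * cnj c * (norm (T u))\<^sup>2)"
      by (metis Re_complex_of_real)
    also have "\<dots> = (norm u)\<^sup>2 - 2 * Re c * a + (cmod c)\<^sup>2 * (norm (T u))\<^sup>2"
      unfolding complex_norm_square[symmetric] by (simp flip: of_real_power of_real_mult)
    finally have nx: "(norm x)\<^sup>2 = (norm u)\<^sup>2 - 2 * Re c * a + (cmod c)\<^sup>2 * (norm (T u))\<^sup>2" .
    have "Re (c * cinner u x) = Re c * (norm u)\<^sup>2 - (cmod c)\<^sup>2 * a"
      unfolding ux by (simp flip: of_real_power of_real_mult)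
    then show ?thesis unfolding nx \<alpha>_def \<beta>_def \<gamma>_def a_def[symmetric]
      by (simp add: algebra_simps)
  qed
  finally show ?thesis by (simp add: c_def)
qed

definition sup_spec :: "complex \<Rightarrow> real"
  where "sup_spec z = real_of_ereal
    (max (SUP \<mu>\<in>op_spectrum A. ereal (Re ((z + 1) * (\<mu> + 1) / (\<mu> - z)))) 0)"

lemma \<omega>_const_eq: "\<omega>_const H1 h \<Gamma> z = (C_ell H1 h \<Gamma>)\<^sup>2 * sup_spec z"
  by (simp add: \<omega>_const_def sup_spec_def)

lemma sup_spec_nonneg: "0 \<le> sup_spec z"
  unfolding sup_spec_def by (intro real_of_ereal_pos) simp

text \<open>\<open>real_of_ereal\<close> is faithful only on finite values. The quotient is
  \<open>(z + 1) * (1 + (z + 1) / (w - z))\<close>, bounded on the spectrum because z has positive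
  distance from it.\<close>

lemma sup_spec_upper:
  assumes z: "z \<in> \<rho>" and \<mu>: "\<mu> \<notin> \<rho>"
  shows "Re ((z + 1) * (\<mu> + 1) / (\<mu> - z)) \<le> sup_spec z"
proof -
  obtain d where d: "d > 0" "\<And>w. cmod (w - z) < d \<Longrightarrow> w \<in> \<rho>"
    using resolvent_set_open[OF linear_A z] by blast
  define B where "B = cmod (z + 1) * (1 + cmod (z + 1) / d)"
  define P where "P = (SUP \<mu>\<in>op_spectrum A. ereal (Re ((z + 1) * (\<mu> + 1) / (\<mu> - z))))"
  have bound: "Re ((z + 1) * (w + 1) / (w - z)) \<le> B" if "w \<notin> \<rho>" for w
  proof -
    have dw: "d \<le> cmod (w - z)" using d(2)[of w] that by (meson not_le)
    then have w: "w - z \<noteq> 0" using d(1) by auto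
    have "(z + 1) * (w + 1) / (w - z) = (z + 1) * (1 + (z + 1) / (w - z))"
      using w by (simp add: field_simps)
    then have "Re ((z + 1) * (w + 1) / (w - z)) \<le> cmod ((z + 1) * (1 + (z + 1) / (w - z)))"
      using complex_Re_le_cmod by metis
    also have "\<dots> \<le> B" unfolding B_def norm_mult
    proof (rule mult_left_mono)
      have "cmod (1 + (z + 1) / (w - z)) \<le> 1 + cmod (z + 1) / cmod (w - z)"
        using norm_triangle_ineq[of 1 "(z + 1) / (w - z)"] by (simp add: norm_divide)
      also have "\<dots> \<le> 1 + cmod (z + 1) / d" using dw d(1)
        by (intro add_left_mono divide_left_mono mult_pos_pos) auto
      finally show "cmod (1 + (z + 1) / (w - z)) \<le> 1 + cmod (z + 1) / d" .
    qed simp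
    finally show ?thesis .
  qed
  have "0 \<le> B" using d(1) by (simp add: B_def)
  then have "max P 0 \<le> ereal B" unfolding P_def
    using bound by (auto intro!: SUP_least simp: op_spectrum_def)
  then have "ereal (sup_spec z) = max P 0"
    unfolding sup_spec_def P_def[symmetric]
    by (cases "max P 0") (auto simp: max_def split: if_splits)
  moreover have "ereal (Re ((z + 1) * (\<mu> + 1) / (\<mu> - z))) \<le> max P 0"
    unfolding P_def using \<mu> by (intro max.coboundedI1 SUP_upper) (simp add: op_spectrum_def)
  ultimately show ?thesis by (metis ereal_less_eq(3))
qed

lemma S_spectral_bound:
  assumes z: "z \<in> \<rho>" and \<phi>: "\<phi> \<in> G"
  shows "Re ((z + 1) * cinner (S z \<phi>) (S (- 1) \<phi>)) \<le> sup_spec z * (norm (S (- 1) \<phi>))\<^sup>2"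
proof (cases "z = - 1")
  case True
  then show ?thesis using sup_spec_nonneg by simp
next
  case False
  define x u where "x = S (- 1) \<phi>" and "u = S z \<phi>"
  have "u - x = T ((z + 1) *\<^sub>C x + (z + 1) *\<^sub>C (u - x))"
    using S_shift[OF z \<phi>] unfolding shift_iff_T x_def u_def .
  then have ux: "u - x = (z + 1) *\<^sub>C T u" by (simp add: scaleC_add_right[symmetric] T_scaleC)
  \<comment> \<open>A strictly larger M is positive, as the leading coefficient of the polynomial
    requires; letting M decrease recovers the sharp constant.\<close>
  have "Re ((z + 1) * cinner u x) \<le> M * (norm x)\<^sup>2" if M: "M > sup_spec z" for M
  proof (rule spectral_bound[OF z False _ _ ux])
    show "0 < M" using M sup_spec_nonneg[of z] by linarith
    show "Re ((z + 1) * (complex_of_real \<mu> + 1) / (complex_of_real \<mu> - z)) \<le> M"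
      if "complex_of_real \<mu> \<notin> \<rho>" for \<mu>
      using sup_spec_upper[OF z that] M by linarith
  qed
  then have "Re ((z + 1) * cinner u x) \<le> sup_spec z * (norm x)\<^sup>2"
  proof (intro tendsto_lowerbound[of "\<lambda>M. M * (norm x)\<^sup>2" _ "at_right (sup_spec z)"])
    show "((\<lambda>M. M * (norm x)\<^sup>2) \<longlongrightarrow> sup_spec z * (norm x)\<^sup>2) (at_right (sup_spec z))"
      by (intro tendsto_intros)
  qed (auto simp: eventually_at_right_less eventually_at_filter)
  then show ?thesis by (simp add: x_def u_def)
qed

text \<open>Each form is evaluated with the solution of the other equation as the extension of its
  second argument; what remains is Hermitian symmetry of \<open>h\<close>.\<close>

lemma dn_form_cnj:
  assumes z: "z \<in> \<rho>" and \<phi>: "\<phi> \<in> G" and \<psi>: "\<psi> \<in> G"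
  shows "\<l> (cnj z) \<phi> \<psi> = cnj (\<l> z \<psi> \<phi>)"
proof -
  note cz = cnj_in_resolvent_set[OF z]
  have H: "S z \<psi> \<in> H1" "S (cnj z) \<phi> \<in> H1" using S_H1 z cz \<phi> \<psi> by auto
  have "\<l> (cnj z) \<phi> \<psi> = h (S (cnj z) \<phi>) (S z \<psi>) - cnj z * cinner (S (cnj z) \<phi>) (S z \<psi>)"
    by (rule dn_form_eq[OF cz \<phi> \<psi> H(1) \<Gamma>_S[OF z \<psi>]])
  moreover have "\<l> z \<psi> \<phi> = h (S z \<psi>) (S (cnj z) \<phi>) - z * cinner (S z \<psi>) (S (cnj z) \<phi>)"
    by (rule dn_form_eq[OF z \<psi> \<phi> H(2) \<Gamma>_S[OF cz \<phi>]])
  ultimately show ?thesis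
    using herm[OF H(2,1)] cinner_commute[of "S (cnj z) \<phi>" "S z \<psi>"] by simp
qed

end

section \<open>Elliptic regularity and the associated operators\<close>

locale regular_bdry_pair = bdry_pair H1 h \<Gamma>
  for H1 :: "'h::complex_hilbert set"
    and h :: "'h \<Rightarrow> 'h \<Rightarrow> complex"
    and \<Gamma> :: "'h \<Rightarrow> 'g::complex_hilbert" +
  assumes is_elliptically_regular: "elliptically_regular H1 h \<Gamma>"
begin

lemma sol_op_ext: "bounded_linear (sol_op_ext H1 h \<Gamma>)"
  "\<phi> \<in> G \<Longrightarrow> sol_op_ext H1 h \<Gamma> \<phi> = S (- 1) \<phi>"
proof -
  note m = minus_one_in_resolvent_set
  obtain K where K: "\<forall>\<phi>\<in>G. norm (S (- 1) \<phi>) \<le> K * norm \<phi>"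
    using is_elliptically_regular by (auto simp: elliptically_regular_def)
  have "\<exists>g. bounded_linear g \<and> (\<forall>\<phi>\<in>G. g \<phi> = S (- 1) \<phi>)"
    using K S_scaleC[OF m, of _ "complex_of_real _"]
    by (intro bounded_linear_extension[OF G.subsp dense_G, of _ K]) (auto simp: S_add[OF m] scaleC_of_real)
  then obtain g where g: "bounded_linear g \<and> (\<forall>\<phi>\<in>G. g \<phi> = S (- 1) \<phi>)" by blast
  have "\<exists>!g. bounded_linear g \<and> (\<forall>\<phi>\<in>G. g \<phi> = S (- 1) \<phi>)"
  proof (rule ex1I)
    show "bounded_linear g \<and> (\<forall>\<phi>\<in>G. g \<phi> = S (- 1) \<phi>)" by (rule g)
    fix f :: "'g \<Rightarrow> 'h" assume f: "bounded_linear f \<and> (\<forall>\<phi>\<in>G. f \<phi> = S (- 1) \<phi>)"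
    show "f = g" by (rule bounded_linear_eq_on_dense[OF _ _ dense_G]) (use f g in auto)
  qed
  from theI'[OF this] show "bounded_linear (sol_op_ext H1 h \<Gamma>)"
    "\<phi> \<in> G \<Longrightarrow> sol_op_ext H1 h \<Gamma> \<phi> = S (- 1) \<phi>"
    unfolding sol_op_ext_def by auto
qed

lemma C_ell_nonneg: "0 \<le> C_ell H1 h \<Gamma>"
  unfolding C_ell_def by (rule onorm_pos_le[OF sol_op_ext(1)])

lemma sol_op_ext_bound: "norm (sol_op_ext H1 h \<Gamma> \<phi>) \<le> C_ell H1 h \<Gamma> * norm \<phi>"
  unfolding C_ell_def by (rule onorm[OF sol_op_ext(1)])

lemma S_elliptic_bound: "\<phi> \<in> G \<Longrightarrow> norm (S (- 1) \<phi>) \<le> C_ell H1 h \<Gamma> * norm \<phi>"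
  using sol_op_ext_bound[of \<phi>] by (simp add: sol_op_ext(2))

text \<open>k is the adjoint of the extended solution operator applied to x, so its norm is
  controlled by \<open>C_ell\<close>.\<close>

lemma S_adjoint_exists:
  "\<exists>k. norm k \<le> C_ell H1 h \<Gamma> * norm x \<and>
    (\<forall>\<psi>\<in>G. cinner x (S (- 1) \<psi>) = cinner k \<psi>)"
proof -
  note m = minus_one_in_resolvent_set
  define E where "E = sol_op_ext H1 h \<Gamma>"
  interpret E: bounded_linear E unfolding E_def by (rule sol_op_ext(1))
  interpret U: hilbert_set "UNIV :: 'g set" inner by (rule hilbert_set_inner) auto
  have E_bound: "\<bar>inner x (E \<psi>)\<bar> \<le> C_ell H1 h \<Gamma> * norm x * norm \<psi>" for \<psi>
    using Cauchy_Schwarz_ineq2[of x "E \<psi>"]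
      mult_left_mono[OF sol_op_ext_bound[of \<psi>] norm_ge_zero[of x]] by (simp add: E_def mult_ac)
  have "\<exists>k\<in>UNIV. \<forall>\<psi>\<in>UNIV. inner k \<psi> = inner x (E \<psi>)"
    using E_bound
    by (intro U.riesz[where K = "C_ell H1 h \<Gamma> * norm x"])
      (auto simp: E.add E.scaleR inner_add_right norm_eq_sqrt_inner[symmetric])
  then obtain k where k: "\<And>\<psi>. inner k \<psi> = inner x (E \<psi>)" by blast
  have "norm k * norm k \<le> C_ell H1 h \<Gamma> * norm x * norm k"
    using k[of k] E_bound[of k] by (simp add: power2_norm_eq_inner[symmetric] power2_eq_square abs_le_iff)
  then have nk: "norm k \<le> C_ell H1 h \<Gamma> * norm x"
    using C_ell_nonneg by (cases "k = 0") auto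
  have "cinner x (S (- 1) \<psi>) = cinner k \<psi>" if \<psi>: "\<psi> \<in> G" for \<psi>
  proof (rule complex_eqI)
    show "Re (cinner x (S (- 1) \<psi>)) = Re (cinner k \<psi>)"
      using k[of \<psi>] \<psi> by (simp add: E_def sol_op_ext(2) Re_cinner)
    have "inner k (\<i> *\<^sub>C \<psi>) = inner x (\<i> *\<^sub>C S (- 1) \<psi>)"
      using k csubspaceD(3)[OF csub_G \<psi>] \<psi> by (simp add: E_def sol_op_ext(2) S_scaleC[OF m])
    then show "Im (cinner x (S (- 1) \<psi>)) = Im (cinner k \<psi>)"
      by (simp add: Re_cinner[symmetric] cinner_scaleC_right)
  qed
  with nk show ?thesis by blast
qed

lemma elliptic:
  assumes z: "z \<in> \<rho>"
  shows "elliptic_form G sG (\<l> z) (\<omega>_const H1 h \<Gamma> z) (L_const H1 h \<Gamma> z) (norm_\<Gamma> H1 h \<Gamma>)"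
proof
  show "csubspace G" "closure G = UNIV" "sesquilinear_on G (\<l> z)"
    by (fact csub_G dense_G sesq_dn_form[OF z])+
  show "0 < L_const H1 h \<Gamma> z" using L_const_ge_1[OF z] by simp
  fix u assume u: "u \<in> G"
  show "norm u \<le> norm_\<Gamma> H1 h \<Gamma> * sqrt (sG u u)" using norm_le_nrmG[OF u] by (simp add: nrmG_eq)
  show "cmod (\<l> z u v) \<le> L_const H1 h \<Gamma> z * sqrt (sG u u) * sqrt (sG v v)" if "v \<in> G" for v
    using dn_form_bound[OF z u that] by (simp add: nrmG_eq)
  have "Re ((z + 1) * cinner (S z u) (S (- 1) u)) \<le> sup_spec z * (norm (S (- 1) u))\<^sup>2"
    by (rule S_spectral_bound[OF z u])
  \<comment> \<open>Elliptic regularity replaces the norm of the solution by that of its boundary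
    value; this is the factor \<open>C^2\<close> in \<omega>.\<close>
  also have "\<dots> \<le> sup_spec z * (C_ell H1 h \<Gamma> * norm u)\<^sup>2"
    by (intro mult_left_mono power_mono S_elliptic_bound u sup_spec_nonneg) auto
  also have "\<dots> = \<omega>_const H1 h \<Gamma> z * (norm u)\<^sup>2"
    by (simp add: \<omega>_const_eq power_mult_distrib)
  finally show "sG u u \<le> Re (\<l> z u u) + \<omega>_const H1 h \<Gamma> z * (norm u)\<^sup>2"
    unfolding dn_form_rep[OF z u u] by (simp add: sG_def s1_def)
qed

lemma \<omega>_const_nonneg: "0 \<le> \<omega>_const H1 h \<Gamma> z"
  by (simp add: \<omega>_const_eq sup_spec_nonneg)

lemma form_upper_bound:
  assumes z: "z \<in> \<rho>" and \<phi>: "\<phi> \<in> G"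
  shows "Re (\<l> z \<phi> \<phi>) + \<omega>_const H1 h \<Gamma> z * (norm \<phi>)\<^sup>2
    \<le> (L_const H1 h \<Gamma> z + \<omega>_const H1 h \<Gamma> z * (norm_\<Gamma> H1 h \<Gamma>)\<^sup>2) * (nrmG \<phi>)\<^sup>2"
proof -
  have "Re (\<l> z \<phi> \<phi>) \<le> L_const H1 h \<Gamma> z * (nrmG \<phi>)\<^sup>2"
    using complex_Re_le_cmod[of "\<l> z \<phi> \<phi>"] dn_form_bound[OF z \<phi> \<phi>]
      by (simp add: power2_eq_square mult_ac)
  moreover have "(norm \<phi>)\<^sup>2 \<le> (norm_\<Gamma> H1 h \<Gamma>)\<^sup>2 * (nrmG \<phi>)\<^sup>2"
    using power_mono[OF norm_le_nrmG[OF \<phi>], of 2] by (simp add: power_mult_distrib)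
  then have "\<omega>_const H1 h \<Gamma> z * (norm \<phi>)\<^sup>2
      \<le> \<omega>_const H1 h \<Gamma> z * ((norm_\<Gamma> H1 h \<Gamma>)\<^sup>2 * (nrmG \<phi>)\<^sup>2)"
    by (rule mult_left_mono[OF _ \<omega>_const_nonneg])
  ultimately show ?thesis by (simp add: algebra_simps)
qed

text \<open>Definiteness is not part of \<open>hilbert_set\<close>; here it comes from the bound of
  \<Gamma>, which controls \<open>norm u\<close> by \<open>nrmG u\<close>.\<close>

lemma norm_on_sqrt_form:
  assumes "hilbert_set G t" and scale: "\<And>c u. u \<in> G \<Longrightarrow> t (c *\<^sub>C u) (c *\<^sub>C u) = (cmod c)\<^sup>2 * t u u"
    and lower: "\<And>u. u \<in> G \<Longrightarrow> sG u u \<le> t u u"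
  shows "norm_on G (\<lambda>u. sqrt (t u u))"
proof -
  interpret t: hilbert_set G t by fact
  have "sqrt (t u u) = 0 \<longleftrightarrow> u = 0" if u: "u \<in> G" for u
  proof
    assume "sqrt (t u u) = 0"
    then have "sG u u = 0" using lower[OF u] G.pos[OF u] by simp
    then show "u = 0" using norm_le_nrmG[OF u] by (simp add: nrmG_eq)
  next
    assume "u = 0"
    then show "sqrt (t u u) = 0" using scale[OF u, of 0] by (simp add: scaleC_zero_left)
  qed
  then show ?thesis
    unfolding norm_on_def by (auto simp: t.pos t.triangle scale real_sqrt_mult)
qed

lemma equivalent_norms:
  assumes z: "z \<in> \<rho>"
  shows "equivalent_norms_on G (norm_dn_form H1 h \<Gamma> z) nrmG"
proof -
  interpret e: elliptic_form G sG "\<l> z" "\<omega>_const H1 h \<Gamma> z" "L_const H1 h \<Gamma> z" "norm_\<Gamma> H1 h \<Gamma>"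
    by (rule elliptic[OF z])
  define \<omega> where "\<omega> = \<omega>_const H1 h \<Gamma> z"
  define B where "B = L_const H1 h \<Gamma> z + \<omega> * (norm_\<Gamma> H1 h \<Gamma>)\<^sup>2"
  \<comment> \<open>For non-real z the form need not be Hermitian. The symmetrised real part has the
    same diagonal and is an inner product.\<close>
  define t where "t u v = (Re (\<l> z u v) + Re (\<l> z v u)) / 2 + \<omega> * inner u v" for u v
  have t_diag: "t u u = Re (\<l> z u u) + \<omega> * (norm u)\<^sup>2" for u
    by (simp add: t_def power2_norm_eq_inner)
  have B: "1 \<le> B" using L_const_ge_1[OF z] \<omega>_const_nonneg[of z]
    by (simp add: B_def \<omega>_def add_increasing2)
  have lower: "sG u u \<le> t u u" if "u \<in> G" for u using e.lower[OF that] by (simp add: t_diag \<omega>_def)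
  have upper: "t u u \<le> B * sG u u" if "u \<in> G" for u
    using form_upper_bound[OF z that] G.pos[OF that] by (simp add: t_diag \<omega>_def B_def nrmG_eq)
  have bil: "bilinear_on G (\<lambda>u v. Re (1 * \<l> z u v))" by (rule bilinear_on_Re[OF e.sesq csub_G])
  have "bilinear_on G t"
    unfolding bilinear_on_def t_def
    using bilinear_onD[OF bil] csubspaceD(1)[OF csub_G]
    by (auto simp: inner_add_left inner_add_right field_simps)
  then have t: "hilbert_set G t"
    by (rule G.hilbert_set_equivalent[where c = 1 and K = B])
      (use lower upper in \<open>auto simp: t_def inner_commute\<close>)
  have scale: "t (c *\<^sub>C u) (c *\<^sub>C u) = (cmod c)\<^sup>2 * t u u" if u: "u \<in> G" for c u
  proof -
    have "\<l> z (c *\<^sub>C u) (c *\<^sub>C u) = complex_of_real ((cmod c)\<^sup>2) * \<l> z u u"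
      using sesquilinear_onD(3)[OF e.sesq u u csubspaceD(3)[OF csub_G u]] sesquilinear_onD(4)[OF e.sesq u u u]
      by (simp add: complex_norm_square del: of_real_power)
    then have "Re (\<l> z (c *\<^sub>C u) (c *\<^sub>C u)) = (cmod c)\<^sup>2 * Re (\<l> z u u)"
      by (simp only: Re_complex_of_real times_complex.simps Im_complex_of_real)
    then show ?thesis by (simp add: t_diag norm_scaleC power_mult_distrib algebra_simps)
  qed
  have scale_G: "sG (c *\<^sub>C u) (c *\<^sub>C u) = (cmod c)\<^sup>2 * sG u u" if u: "u \<in> G" for c u
  proof -
    note m = minus_one_in_resolvent_set
    have H: "S (- 1) u \<in> H1" by (rule S_H1[OF m u])
    have "h1 (c *\<^sub>C S (- 1) u) (c *\<^sub>C S (- 1) u) = complex_of_real ((cmod c)\<^sup>2) * h1 (S (- 1) u) (S (- 1) u)"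
      using sesquilinear_onD(3)[OF sesq_h1 H H csubspaceD(3)[OF csub H]] sesquilinear_onD(4)[OF sesq_h1 H H H]
      by (simp add: complex_norm_square del: of_real_power)
    then show ?thesis unfolding sG_def s1_def S_scaleC[OF m u]
      by (simp only: Re_complex_of_real times_complex.simps Im_complex_of_real)
  qed
  have n1: "norm_on G (norm_dn_form H1 h \<Gamma> z)"
    using norm_on_sqrt_form[OF t scale lower]
    unfolding t_diag \<omega>_def norm_dn_form_def[abs_def] .
  have n2: "norm_on G nrmG"
    using norm_on_sqrt_form[OF G.hilbert_set_axioms scale_G order_refl] unfolding nrmG_eq[abs_def] .
  have eq: "norm_dn_form H1 h \<Gamma> z u = sqrt (t u u)" for u
    by (simp add: norm_dn_form_def t_diag \<omega>_def)
  have "1 / sqrt B * norm_dn_form H1 h \<Gamma> z u \<le> nrmG u" if "u \<in> G" for u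
    using real_sqrt_le_mono[OF upper[OF that]] B
    by (simp add: eq nrmG_eq real_sqrt_mult divide_le_eq mult.commute)
  moreover have "nrmG u \<le> 1 * norm_dn_form H1 h \<Gamma> z u" if "u \<in> G" for u
    using lower[OF that] by (simp add: eq nrmG_eq)
  ultimately show ?thesis
    unfolding equivalent_norms_on_def using n1 n2 B
    by (intro conjI exI[of _ "1 / sqrt B"] exI[of _ 1]) auto
qed

lemma dn_operator_iff: "(\<phi>, \<eta>) \<in> dn_operator H1 h \<Gamma> z \<longleftrightarrow> \<phi> \<in> G \<and> (\<forall>\<psi>\<in>G. \<l> z \<phi> \<psi> = cinner \<eta> \<psi>)"
  by (simp add: dn_operator_def form_operator_def)

text \<open>The difference of \<open>\<Lambda>(z)\<close> and \<open>\<Lambda>\<close> is the bounded operator \<open>- (z + 1) S* S(z)\<close>.\<close>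

lemma dn_operator_perturbation:
  assumes z: "z \<in> \<rho>"
  shows "\<exists>K\<ge>0. \<forall>\<phi>\<in>G. \<exists>k. norm k \<le> K * norm \<phi> \<and>
    (\<forall>\<eta>. (\<phi>, \<eta>) \<in> dn_operator H1 h \<Gamma> (- 1) \<longleftrightarrow> (\<phi>, \<eta> - k) \<in> dn_operator H1 h \<Gamma> z)"
proof -
  note m = minus_one_in_resolvent_set
  define C where "C = C_ell H1 h \<Gamma>"
  obtain K where K: "0 \<le> K" "\<And>\<phi>. \<phi> \<in> G \<Longrightarrow> norm (S z \<phi>) \<le> K * norm (S (- 1) \<phi>)"
    using S_bounded_norm[OF z] by blast
  have C: "0 \<le> C" by (simp add: C_def C_ell_nonneg)
  have "\<exists>k. norm k \<le> (C * cmod (z + 1) * K * C) * norm \<phi> \<and>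
    (\<forall>\<eta>. (\<phi>, \<eta>) \<in> dn_operator H1 h \<Gamma> (- 1) \<longleftrightarrow> (\<phi>, \<eta> - k) \<in> dn_operator H1 h \<Gamma> z)"
    if \<phi>: "\<phi> \<in> G" for \<phi>
  proof -
    obtain k where k: "norm k \<le> C * norm ((z + 1) *\<^sub>C S z \<phi>)"
      "\<And>\<psi>. \<psi> \<in> G \<Longrightarrow> cinner ((z + 1) *\<^sub>C S z \<phi>) (S (- 1) \<psi>) = cinner k \<psi>"
      using S_adjoint_exists[of "(z + 1) *\<^sub>C S z \<phi>"] unfolding C_def by blast
    have "norm (S z \<phi>) \<le> K * (C * norm \<phi>)"
      using K(2)[OF \<phi>] mult_left_mono[OF S_elliptic_bound[OF \<phi>] K(1)] by (simp add: C_def)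
    then have "C * (cmod (z + 1) * norm (S z \<phi>)) \<le> C * (cmod (z + 1) * (K * (C * norm \<phi>)))"
      using C by (intro mult_left_mono) auto
    with k(1) have "norm k \<le> (C * cmod (z + 1) * K * C) * norm \<phi>"
      by (simp add: norm_scaleC mult_ac)
    moreover have "\<l> z \<phi> \<psi> = \<l> (- 1) \<phi> \<psi> - cinner k \<psi>"
      if "\<psi> \<in> G" for \<psi>
      using k(2)[OF that] dn_form_rep[OF z \<phi> that] dn_form_rep[OF m \<phi> that]
      by (simp add: cinner_scaleC_left)
    then have "(\<phi>, \<eta>) \<in> dn_operator H1 h \<Gamma> (- 1) \<longleftrightarrow> (\<phi>, \<eta> - k) \<in> dn_operator H1 h \<Gamma> z"
      for \<eta>
      by (auto simp: dn_operator_iff cinner_diff_left)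
    ultimately show ?thesis by blast
  qed
  moreover have "0 \<le> C * cmod (z + 1) * K * C" using C K(1) by simp
  ultimately show ?thesis by blast
qed

lemma Domain_dn_operator:
  assumes z: "z \<in> \<rho>"
  shows "Domain (dn_operator H1 h \<Gamma> z) = G_one H1 h \<Gamma>"
proof -
  have "(\<exists>\<eta>. (\<phi>, \<eta>) \<in> dn_operator H1 h \<Gamma> z) \<longleftrightarrow> (\<exists>\<eta>. (\<phi>, \<eta>) \<in> dn_operator H1 h \<Gamma> (- 1))"
    for \<phi>
  proof (cases "\<phi> \<in> G")
    case True
    then obtain k where
      "\<And>\<eta>. (\<phi>, \<eta>) \<in> dn_operator H1 h \<Gamma> (- 1) \<longleftrightarrow> (\<phi>, \<eta> - k) \<in> dn_operator H1 h \<Gamma> z"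
      using dn_operator_perturbation[OF z] by blast
    then show ?thesis by (metis add_diff_cancel)
  qed (simp add: dn_operator_iff)
  then show ?thesis by (auto simp: G_one_def Domain_iff)
qed

lemma linear_dn_operator: "z \<in> \<rho> \<Longrightarrow> linear_operator (dn_operator H1 h \<Gamma> z)"
  unfolding dn_operator_def by (rule linear_operator_form_operator[OF csub_G dense_G sesq_dn_form])

lemma dn_operator_bounded:
  assumes z: "z \<in> \<rho>"
  shows "\<exists>K. \<forall>\<phi>\<in>G_one H1 h \<Gamma>. norm (op_apply (dn_operator H1 h \<Gamma> z) \<phi>) \<le> K * norm_one H1 h \<Gamma> \<phi>"
proof -
  note m = minus_one_in_resolvent_set
  define c where "c = norm_\<Gamma> H1 h \<Gamma>"
  obtain K where K: "0 \<le> K" "\<forall>\<phi>\<in>G. \<exists>k. norm k \<le> K * norm \<phi> \<and>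
    (\<forall>\<eta>. (\<phi>, \<eta>) \<in> dn_operator H1 h \<Gamma> (- 1) \<longleftrightarrow> (\<phi>, \<eta> - k) \<in> dn_operator H1 h \<Gamma> z)"
    using dn_operator_perturbation[OF z] by blast
  have "norm (op_apply (dn_operator H1 h \<Gamma> z) \<phi>) \<le> (1 + K * c\<^sup>2) * norm_one H1 h \<Gamma> \<phi>"
    if \<phi>1: "\<phi> \<in> G_one H1 h \<Gamma>" for \<phi>
  proof -
    obtain \<eta> where \<eta>: "(\<phi>, \<eta>) \<in> dn_operator H1 h \<Gamma> (- 1)"
      using \<phi>1 unfolding G_one_def by blast
    then have \<phi>: "\<phi> \<in> G" by (simp add: dn_operator_iff)
    obtain k where k: "norm k \<le> K * norm \<phi>" "(\<phi>, \<eta> - k) \<in> dn_operator H1 h \<Gamma> z"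
      using K(2) \<phi> \<eta> by blast
    \<comment> \<open>Coercivity of \<Lambda>: the form at -1 is the inner product of the boundary
      space, whose embedding has norm at most c. The perturbation k is thereby controlled by
      \<eta>.\<close>
    have "norm \<phi> \<le> c\<^sup>2 * norm \<eta>"
    proof (cases "\<phi> = 0")
      case False
      have "sG \<phi> \<phi> = inner \<eta> \<phi>"
        using dn_form_rep[OF m \<phi> \<phi>] \<eta> \<phi>
          by (simp add: dn_operator_iff sG_def s1_def Re_cinner[symmetric])
      then have "sG \<phi> \<phi> \<le> norm \<eta> * norm \<phi>"
        using norm_cauchy_schwarz[of \<eta> \<phi>] by simp
      then have "c\<^sup>2 * sG \<phi> \<phi> \<le> c\<^sup>2 * (norm \<eta> * norm \<phi>)"
        by (intro mult_left_mono) auto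
      moreover have "(norm \<phi>)\<^sup>2 \<le> c\<^sup>2 * sG \<phi> \<phi>"
        using power_mono[OF norm_le_nrmG[OF \<phi>], of 2] G.pos[OF \<phi>]
        by (simp add: c_def nrmG_eq power_mult_distrib)
      ultimately have "norm \<phi> * norm \<phi> \<le> c\<^sup>2 * norm \<eta> * norm \<phi>"
        by (simp add: power2_eq_square mult_ac)
      then show ?thesis using False by simp
    qed simp
    then have "norm k \<le> K * (c\<^sup>2 * norm \<eta>)" using k(1) K(1) by (meson mult_left_mono order_trans)
    then have "norm (\<eta> - k) \<le> (1 + K * c\<^sup>2) * norm \<eta>"
      using norm_triangle_ineq4[of \<eta> k] by (simp add: algebra_simps)
    then show ?thesis
      unfolding norm_one_def op_apply_eq[OF linear_dn_operator[OF z] k(2)]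
        op_apply_eq[OF linear_dn_operator[OF m] \<eta>] .
  qed
  then show ?thesis by blast
qed

lemma op_adjoint_dn_operator:
  assumes z: "z \<in> \<rho>"
  shows "op_adjoint (dn_operator H1 h \<Gamma> z) = dn_operator H1 h \<Gamma> (cnj z)"
proof -
  interpret e: elliptic_form G sG "\<l> z" "\<omega>_const H1 h \<Gamma> z" "L_const H1 h \<Gamma> z" "norm_\<Gamma> H1 h \<Gamma>"
    by (rule elliptic[OF z])
  have "form_operator G (\<lambda>u v. cnj (\<l> z v u)) = form_operator G (\<l> (cnj z))"
    by (simp add: form_operator_def dn_form_cnj[OF z] cong: conj_cong)
  then show ?thesis by (simp add: dn_operator_def e.op_adjoint)
qed

text \<open>At a real point \<open>dn_form_cnj\<close> makes the diagonal of the form real, and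
  coercivity with shift \<omega> gives the lower bound \<open>- \<omega>\<close>.\<close>

lemma dn_bounded_below:
  assumes \<mu>: "complex_of_real \<mu> \<in> \<rho>"
  shows "form_bounded_below G (\<l> (complex_of_real \<mu>))"
    "op_bounded_below (dn_operator H1 h \<Gamma> (complex_of_real \<mu>))"
proof -
  interpret e: elliptic_form G sG "\<l> \<mu>" "\<omega>_const H1 h \<Gamma> \<mu>" "L_const H1 h \<Gamma> \<mu>" "norm_\<Gamma> H1 h \<Gamma>"
    by (rule elliptic[OF \<mu>])
  have real: "\<l> \<mu> \<phi> \<phi> \<in> \<real>" if "\<phi> \<in> G" for \<phi>
    using dn_form_cnj[OF \<mu> that that] by (simp add: Reals_cnj_iff)
  have low: "- \<omega>_const H1 h \<Gamma> \<mu> * (norm \<phi>)\<^sup>2 \<le> Re (\<l> \<mu> \<phi> \<phi>)"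
    if "\<phi> \<in> G" for \<phi>
    using e.lower[OF that] G.pos[OF that] by simp
  show "form_bounded_below G (\<l> (complex_of_real \<mu>))"
    unfolding form_bounded_below_def using real low by blast
  show "op_bounded_below (dn_operator H1 h \<Gamma> (complex_of_real \<mu>))"
    unfolding op_bounded_below_def dn_operator_iff using real low by metis
qed

end

theorem theorem3p10:
  fixes H1 :: "'h::complex_hilbert set"
    and \<h> :: "'h \<Rightarrow> 'h \<Rightarrow> complex"
    and \<Gamma> :: "'h \<Rightarrow> 'g::complex_hilbert"
    and z :: complex
  defines "\<sigma>D \<equiv> op_spectrum (dirichlet_operator H1 \<h> \<Gamma>)"
    and "G12 \<equiv> G_half H1 \<Gamma>"
    and "\<l> \<equiv> dn_form H1 \<h> \<Gamma>"
    and "\<Lambda> \<equiv> dn_operator H1 \<h> \<Gamma>"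
    and "L \<equiv> L_const H1 \<h> \<Gamma>"
    and "\<omega> \<equiv> \<omega>_const H1 \<h> \<Gamma> z"
    and "\<theta> \<equiv> \<theta>_const H1 \<h> \<Gamma> z"
  assumes "boundary_pair H1 \<h> \<Gamma>"
    and "elliptically_regular H1 \<h> \<Gamma>"
    and "z \<notin> \<sigma>D"
  shows
    "(equivalent_norms_on G12 (norm_dn_form H1 \<h> \<Gamma> z) (norm_half H1 \<h> \<Gamma>) \<and>
      (\<forall>\<phi>\<in>G12.
        (norm_half H1 \<h> \<Gamma> \<phi>)\<^sup>2 \<le> Re (\<l> z \<phi> \<phi>) + \<omega> * (norm \<phi>)\<^sup>2 \<and>
        Re (\<l> z \<phi> \<phi>) + \<omega> * (norm \<phi>)\<^sup>2
          \<le> (L z + \<omega> * (norm_\<Gamma> H1 \<h> \<Gamma>)\<^sup>2) * (norm_half H1 \<h> \<Gamma> \<phi>)\<^sup>2)) \<and>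
     (\<forall>\<mu>::real. complex_of_real \<mu> \<notin> \<sigma>D \<longrightarrow>
        form_bounded_below G12 (\<l> (complex_of_real \<mu>)) \<and>
        op_bounded_below (\<Lambda> (complex_of_real \<mu>))) \<and>
     (closed_form G12 (\<l> z) \<and>
      (\<forall>\<phi>\<in>G12. \<l> z \<phi> \<phi>
        \<in> (\<lambda>s. s - complex_of_real (\<omega> * (norm \<phi>)\<^sup>2)) ` sector \<theta>)) \<and>
     (linear_operator (\<Lambda> z) \<and> densely_defined (\<Lambda> z) \<and>
      op_adjoint (\<Lambda> z) = \<Lambda> (cnj z) \<and>
      closed (\<Lambda> z) \<and>
      (z \<in> \<real> \<longrightarrow> self_adjoint (\<Lambda> z)) \<and>
      Domain (\<Lambda> z) = G_one H1 \<h> \<Gamma> \<and>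
      (\<exists>K. \<forall>\<phi>\<in>G_one H1 \<h> \<Gamma>.
        norm (op_apply (\<Lambda> z) \<phi>) \<le> K * norm_one H1 \<h> \<Gamma> \<phi>)) \<and>
     op_spectrum (\<Lambda> z) \<subseteq> (\<lambda>s. s - complex_of_real \<omega>) ` sector \<theta> \<and>
     (m_sectorial (- \<omega>) \<theta> (\<Lambda> z) \<and>
      (\<forall>\<theta>\<^sub>0 w. \<theta> < \<theta>\<^sub>0 \<longrightarrow> \<theta>\<^sub>0 < pi \<longrightarrow>
        w \<notin> (\<lambda>s. s - complex_of_real \<omega>) ` sector \<theta>\<^sub>0 \<longrightarrow>
        w \<in> resolvent_set (\<Lambda> z) \<and>
        onorm (resolvent (\<Lambda> z) w)
          \<le> 1 / (cmod (w + complex_of_real \<omega>) * sin (\<theta>\<^sub>0 - \<theta>))))"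
proof -
  interpret regular_bdry_pair H1 \<h> \<Gamma> by unfold_locales fact+
  have \<rho>: "w \<notin> \<sigma>D \<longleftrightarrow> w \<in> resolvent_set (dirichlet_operator H1 \<h> \<Gamma>)"
    for w
    by (simp add: \<sigma>D_def op_spectrum_def)
  have z: "z \<in> resolvent_set (dirichlet_operator H1 \<h> \<Gamma>)"
    using \<open>z \<notin> \<sigma>D\<close> by (simp add: \<rho>)
  interpret e: elliptic_form G12 sG "\<l> z" \<omega> "L z" "norm_\<Gamma> H1 \<h> \<Gamma>"
    unfolding G12_def \<l>_def \<omega>_def L_def by (rule elliptic[OF z])
  have \<Lambda>: "\<Lambda> z = form_operator G12 (\<l> z)"
    by (simp add: \<Lambda>_def dn_operator_def G12_def \<l>_def)
  have \<theta>: "\<theta> = arctan (L z)" by (simp add: \<theta>_def \<theta>_const_def L_def)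
  have i: "equivalent_norms_on G12 (norm_dn_form H1 \<h> \<Gamma> z) (norm_half H1 \<h> \<Gamma>)"
    unfolding G12_def by (rule equivalent_norms[OF z])
  have i_lower: "(norm_half H1 \<h> \<Gamma> \<phi>)\<^sup>2 \<le> Re (\<l> z \<phi> \<phi>) + \<omega> * (norm \<phi>)\<^sup>2"
    if "\<phi> \<in> G12" for \<phi>
    using e.lower[OF that] e.pos[OF that] by (simp add: nrmG_eq)
  have i_upper: "Re (\<l> z \<phi> \<phi>) + \<omega> * (norm \<phi>)\<^sup>2
      \<le> (L z + \<omega> * (norm_\<Gamma> H1 \<h> \<Gamma>)\<^sup>2) * (norm_half H1 \<h> \<Gamma> \<phi>)\<^sup>2" if "\<phi> \<in> G12" for \<phi>
    using form_upper_bound[OF z] that unfolding G12_def \<l>_def \<omega>_def L_def by blast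
  have ii: "form_bounded_below G12 (\<l> (complex_of_real \<mu>)) \<and>
      op_bounded_below (\<Lambda> (complex_of_real \<mu>))" if "complex_of_real \<mu> \<notin> \<sigma>D" for \<mu>
    using dn_bounded_below that unfolding \<rho> G12_def \<l>_def \<Lambda>_def by blast
  have iii: "\<l> z \<phi> \<phi> \<in> (\<lambda>s. s - complex_of_real (\<omega> * (norm \<phi>)\<^sup>2)) ` sector \<theta>"
    if "\<phi> \<in> G12" for \<phi>
    using e.form_in_sector[OF that] unfolding \<theta> by (force intro!: image_eqI)
  have adj: "op_adjoint (\<Lambda> z) = \<Lambda> (cnj z)" unfolding \<Lambda>_def
    by (rule op_adjoint_dn_operator[OF z])
  have sa: "self_adjoint (\<Lambda> z)" if "z \<in> \<real>"
    using adj that e.linear e.densely_defined unfolding self_adjoint_def \<Lambda>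
    by (simp add: Reals_cnj_iff \<Lambda>)
  have dom: "Domain (\<Lambda> z) = G_one H1 \<h> \<Gamma>" unfolding \<Lambda>_def
    by (rule Domain_dn_operator[OF z])
  have bdd: "\<exists>K. \<forall>\<phi>\<in>G_one H1 \<h> \<Gamma>. norm (op_apply (\<Lambda> z) \<phi>) \<le> K * norm_one H1 \<h> \<Gamma> \<phi>"
    unfolding \<Lambda>_def by (rule dn_operator_bounded[OF z])
  have vi: "w \<in> resolvent_set (\<Lambda> z) \<and>
      onorm (resolvent (\<Lambda> z) w) \<le> 1 / (cmod (w + complex_of_real \<omega>) * sin (\<theta>\<^sub>0 - \<theta>))"
    if "\<theta> < \<theta>\<^sub>0" "\<theta>\<^sub>0 < pi" "w \<notin> (\<lambda>s. s - complex_of_real \<omega>) ` sector \<theta>\<^sub>0"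
      for \<theta>\<^sub>0 w
  proof -
    have "w + complex_of_real \<omega> \<notin> sector \<theta>\<^sub>0" using that(3) by (force intro!: image_eqI)
    with that(1,2) show ?thesis unfolding \<Lambda> \<theta> using e.resolvent_outside_sector by blast
  qed
  show ?thesis
    using i i_lower i_upper ii e.closed iii e.linear e.densely_defined adj e.closed_operator sa dom bdd
      e.spectrum e.sectorial vi
    unfolding \<Lambda> \<theta> by blast
qed

end
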